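(* If $\Gamma$ is a finite set of spineless simple equations that contains an expansive equation, then the variety $\mathsf{CRL}+\Gamma$ has an undecidable equational theory.
   Context: A residuated lattice is an algebra $\mathbf{R}=(R,\vee,\wedge,\cdot,\backslash,/,1)$ such that $(R,\vee,\wedge)$ is a lattice, $(R,\cdot,1)$ is a monoid, and for all $x,y,z\in R$: $x\cdot y\le z$ iff $x\le z/y$ iff $y\le x\backslash z$, where $\le$ is the lattice order. It is commutative if $\cdot$ is commutative. $\mathsf{CRL}$ denotes the variety of commutative residuated lattices. An inequality $s\le t$ abbreviates the equation $s\vee t=t$. For a set $\Gamma$ of equations, $\mathsf{CRL}+\Gamma$ is the subvariety of $\mathsf{CRL}$ axiomatized by $\Gamma$. Simple and basic equations: for $n\ge 1$ and a column vector $d\in\mathbb{N}^n$ (here $0\in\mathbb{N}$) let $\mathbf{x}_n^{d}:=x_1^{d(1)}\cdots x_n^{d(n)}$, with $x^0=1$; $\mathbf{1}$ is the all-ones vector. A simple equation in $n$ variables is $[D]:\ \mathbf{x}_n^{\mathbf{1}}=x_1\cdots x_n\le\bigvee_{d\in D}\mathbf{x}_n^{d}$, where $D\subseteq\mathbb{N}^n$ is finite, nonempty, and for each $i\le n$ some $d\in D$ has $d(i)\ne0$. A basic equation in $k$ variables is $[f,A]:\ \mathbf{x}_k^{f}\le\bigvee_{a\in A}\mathbf{x}_k^{a}$ with $f\in(\mathbb{Z}^+)^k$ and $A\subseteq\mathbb{N}^k$ finite and nonempty such that for each $i\le k$ some $a\in A$ has $a(i)\neq 0$. Spinal, prespinal,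 spineless: a basic equation $[f,V]$ in $k\ge1$ variables is spinal if $f\notin V$ and $V$ is either $\{v_1,\dots,v_k\}$ or $\{0,v_1,\dots,v_k\}$ ($0$ the zero vector), where $v_j(j)\ne0$ for all $j\le k$ and $v_i(j)=0$ whenever $1\le i<j\le k$. A simple equation $[D]$ in $n$ variables is prespinal if it has a spinal equation as image under a monoid substitution, i.e. there are $k\ge1$ and a $k\times n$ matrix $\Sigma$ with entries in $\mathbb{N}$ (encoding $x_j\mapsto x_1^{\Sigma_{1j}}\cdots x_k^{\Sigma_{kj}}$) such that $[\Sigma\mathbf{1},\{\Sigma d:d\in D\}]$ is a spinal equation. A simple equation is spineless if it is not prespinal. Expansive: a simple equation is expansive if it has, as the image under a monoid substitution (each variable replaced by a product of variables), an equation of the form $x^n\le\bigvee_{j=1}^m x^{n+c_j}$ for some $n,m\ge1$ and $c_1,\dots,c_m\ge1$. *)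

theory Defs
  imports
    "HOL-Algebra.Group"
    "HOL-Library.Nat_Bijection"
    "HOL-Library.Countable_Set"
    "Jordan_Normal_Form.Matrix"
begin

section \<open>Decidable sets of natural numbers\<close>

datatype recf =
    RZero
  | RSucc
  | RProj nat
  | RComp recf "recf list"
  | RPrim recf recf
  | RMin recf

text \<open>\<open>computes p xs y\<close> says that the partial recursive function with program \<open>p\<close> is defined at
  the arguments \<open>xs\<close> with value \<open>y\<close>. The recursion variable of \<open>RPrim\<close> and the search variable
  of \<open>RMin\<close> are the first argument.\<close>

inductive computes :: "recf \<Rightarrow> nat list \<Rightarrow> nat \<Rightarrow> bool" where
  zero: "computes RZero xs 0"
| succ: "computes RSucc [x] (Suc x)"
| proj: "i < length xs \<Longrightarrow> computes (RProj i) xs (xs ! i)"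
| comp: "list_all2 (\<lambda>g z. computes g xs z) gs zs \<Longrightarrow> computes f zs y
         \<Longrightarrow> computes (RComp f gs) xs y"
| prim_0: "computes f xs y \<Longrightarrow> computes (RPrim f g) (0 # xs) y"
| prim_Suc: "computes (RPrim f g) (n # xs) z \<Longrightarrow> computes g (n # z # xs) y
         \<Longrightarrow> computes (RPrim f g) (Suc n # xs) y"
| min: "computes f (n # xs) 0 \<Longrightarrow> (\<And>m. m < n \<Longrightarrow> \<exists>z. computes f (m # xs) (Suc z))
         \<Longrightarrow> computes (RMin f) xs n"

definition decidable :: "nat set \<Rightarrow> bool" where
  "decidable A \<longleftrightarrow> (\<exists>p. \<forall>n. computes p [n] (if n \<in> A then 1 else 0))"

inductive_cases computes_elims:
  "computes RZero xs y" "computes RSucc xs y" "computes (RProj i) xs y" "computes (RComp f gs) xs y"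
  "computes (RPrim f g) (0 # xs) y" "computes (RPrim f g) (Suc n # xs) y" "computes (RMin f) xs y"

lemma computes_deterministic:
  "computes p xs y \<Longrightarrow> computes p xs y' \<Longrightarrow> y' = y"
proof (induction arbitrary: y' rule: computes.induct)
  case (comp xs gs zs f y)
  from comp.prems obtain zs' where
    zs': "list_all2 (\<lambda>g z. computes g xs z) gs zs'" "computes f zs' y'"
    by (rule computes_elims)
  have "zs' = zs"
  proof (rule nth_equalityI)
    show "length zs' = length zs"
      using list_all2_lengthD[OF comp.IH(1)] list_all2_lengthD[OF zs'(1)] by simp
    show "zs' ! i = zs ! i" if "i < length zs'" for i
    proof -
      have i: "i < length gs" using list_all2_lengthD[OF zs'(1)] that by simp
      show ?thesis
        using list_all2_nthD[OF comp.IH(1) i] list_all2_nthD[OF zs'(1) i] by blast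
    qed
  qed
  with zs'(2) have "computes f zs y'" by simp
  then show ?case by (rule comp.IH(2))
next
  case (min f n xs)
  from min.prems have *: "computes f (y' # xs) 0" "\<And>m. m < y' \<Longrightarrow> \<exists>z. computes f (m # xs) (Suc z)"
    by (auto elim!: computes_elims(7))
  have "\<not> n < y'"
  proof
    assume "n < y'"
    from *(2)[OF this] obtain z where "computes f (n # xs) (Suc z)" ..
    from min.IH(1)[OF this] show False by simp
  qed
  moreover have "\<not> y' < n"
  proof
    assume "y' < n"
    from min.IH(2)[OF this] *(1) show False by blast
  qed
  ultimately show ?case by simp
next
  case (prim_Suc f g n xs z y)
  from prim_Suc.prems obtain z' where
    "computes (RPrim f g) (n # xs) z'" "computes g (n # z' # xs) y'"
    by (rule computes_elims)
  then show ?case using prim_Suc.IH(1) prim_Suc.IH(2)[of y'] by simp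
next
  case (prim_0 f xs y g)
  from prim_0.prems have "computes f xs y'" by (rule computes_elims)
  then show ?case by (rule prim_0.IH)
qed (blast elim: computes_elims)+


section \<open>Terms and equations in the signature of residuated lattices\<close>

datatype trm =
    Var nat
  | One
  | Join trm trm
  | Meet trm trm
  | Mult trm trm
  | LDiv trm trm  \<comment> \<open>\<open>LDiv s t\<close> is \<open>s\<close> under \<open>t\<close>\<close>
  | RDiv trm trm  \<comment> \<open>\<open>RDiv s t\<close> is \<open>s\<close> over \<open>t\<close>\<close>

type_synonym eqn = "trm \<times> trm"

definition Ineq :: "trm \<Rightarrow> trm \<Rightarrow> eqn" where
  "Ineq s t = (Join s t, t)"

primrec trm_code :: "trm \<Rightarrow> nat" where
  "trm_code (Var i) = prod_encode (0, i)"
| "trm_code One = prod_encode (1, 0)"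
| "trm_code (Join s t) = prod_encode (2, prod_encode (trm_code s, trm_code t))"
| "trm_code (Meet s t) = prod_encode (3, prod_encode (trm_code s, trm_code t))"
| "trm_code (Mult s t) = prod_encode (4, prod_encode (trm_code s, trm_code t))"
| "trm_code (LDiv s t) = prod_encode (5, prod_encode (trm_code s, trm_code t))"
| "trm_code (RDiv s t) = prod_encode (6, prod_encode (trm_code s, trm_code t))"

definition eqn_code :: "eqn \<Rightarrow> nat" where
  "eqn_code e = prod_encode (trm_code (fst e), trm_code (snd e))"

lemma trm_code_inj: "trm_code s = trm_code t \<Longrightarrow> s = t"
  by (induction s arbitrary: t; case_tac t; simp)

lemma eqn_code_inj: "inj eqn_code"
  by (rule injI) (auto simp: eqn_code_def prod_eq_iff dest: trm_code_inj)


section \<open>Commutative residuated lattices\<close>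

record 'a rlat = "'a monoid" +
  rjoin :: "'a \<Rightarrow> 'a \<Rightarrow> 'a"
  rmeet :: "'a \<Rightarrow> 'a \<Rightarrow> 'a"
  ldiv :: "'a \<Rightarrow> 'a \<Rightarrow> 'a"
  rdiv :: "'a \<Rightarrow> 'a \<Rightarrow> 'a"

definition rle :: "('a, 'b) rlat_scheme \<Rightarrow> 'a \<Rightarrow> 'a \<Rightarrow> bool" where
  "rle R x y \<longleftrightarrow> rjoin R x y = y"

locale residuated_lattice = monoid R for R :: "('a, 'b) rlat_scheme" (structure) +
  assumes join_closed: "\<lbrakk>x \<in> carrier R; y \<in> carrier R\<rbrakk> \<Longrightarrow> rjoin R x y \<in> carrier R"
    and meet_closed: "\<lbrakk>x \<in> carrier R; y \<in> carrier R\<rbrakk> \<Longrightarrow> rmeet R x y \<in> carrier R"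
    and ldiv_closed: "\<lbrakk>x \<in> carrier R; y \<in> carrier R\<rbrakk> \<Longrightarrow> ldiv R x y \<in> carrier R"
    and rdiv_closed: "\<lbrakk>x \<in> carrier R; y \<in> carrier R\<rbrakk> \<Longrightarrow> rdiv R x y \<in> carrier R"
    and join_assoc: "\<lbrakk>x \<in> carrier R; y \<in> carrier R; z \<in> carrier R\<rbrakk>
          \<Longrightarrow> rjoin R (rjoin R x y) z = rjoin R x (rjoin R y z)"
    and meet_assoc: "\<lbrakk>x \<in> carrier R; y \<in> carrier R; z \<in> carrier R\<rbrakk>
          \<Longrightarrow> rmeet R (rmeet R x y) z = rmeet R x (rmeet R y z)"
    and join_comm: "\<lbrakk>x \<in> carrier R; y \<in> carrier R\<rbrakk> \<Longrightarrow> rjoin R x y = rjoin R y x"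
    and meet_comm: "\<lbrakk>x \<in> carrier R; y \<in> carrier R\<rbrakk> \<Longrightarrow> rmeet R x y = rmeet R y x"
    and join_meet_absorb: "\<lbrakk>x \<in> carrier R; y \<in> carrier R\<rbrakk> \<Longrightarrow> rjoin R x (rmeet R x y) = x"
    and meet_join_absorb: "\<lbrakk>x \<in> carrier R; y \<in> carrier R\<rbrakk> \<Longrightarrow> rmeet R x (rjoin R x y) = x"
    and residuation_rdiv: "\<lbrakk>x \<in> carrier R; y \<in> carrier R; z \<in> carrier R\<rbrakk>
          \<Longrightarrow> rle R (x \<otimes> y) z \<longleftrightarrow> rle R x (rdiv R z y)"
    and residuation_ldiv: "\<lbrakk>x \<in> carrier R; y \<in> carrier R; z \<in> carrier R\<rbrakk>
          \<Longrightarrow> rle R (x \<otimes> y) z \<longleftrightarrow> rle R y (ldiv R x z)"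

locale comm_residuated_lattice = residuated_lattice + comm_monoid R

primrec eval :: "('a, 'b) rlat_scheme \<Rightarrow> (nat \<Rightarrow> 'a) \<Rightarrow> trm \<Rightarrow> 'a" where
  "eval R h (Var i) = h i"
| "eval R h One = one R"
| "eval R h (Join s t) = rjoin R (eval R h s) (eval R h t)"
| "eval R h (Meet s t) = rmeet R (eval R h s) (eval R h t)"
| "eval R h (Mult s t) = mult R (eval R h s) (eval R h t)"
| "eval R h (LDiv s t) = ldiv R (eval R h s) (eval R h t)"
| "eval R h (RDiv s t) = rdiv R (eval R h s) (eval R h t)"

definition satisfies :: "('a, 'b) rlat_scheme \<Rightarrow> eqn \<Rightarrow> bool" where
  "satisfies R e \<longleftrightarrow>
     (\<forall>h. (\<forall>i. h i \<in> carrier R) \<longrightarrow> eval R h (fst e) = eval R h (snd e))"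

text \<open>The members of the variety \<open>CRL + E\<close> whose carrier is a subset of the type \<open>'a\<close>.\<close>

definition CRL_plus :: "eqn set \<Rightarrow> 'a rlat set" where
  "CRL_plus E = {R. comm_residuated_lattice R \<and> (\<forall>e\<in>E. satisfies R e)}"

definition equational_theory :: "'a itself \<Rightarrow> eqn set \<Rightarrow> eqn set" where
  "equational_theory (_ :: 'a itself) E = {e. \<forall>R \<in> (CRL_plus E :: 'a rlat set). satisfies R e}"

text \<open>HOL cannot quantify over all types inside a definition, so \<open>equational_theory\<close> refers to the
  algebras living on one type \<open>'a\<close>. As long as \<open>'a\<close> is infinite its choice is immaterial
  (lemma \<open>equational_theory_indep\<close> below), because an equation failing in some
  algebra already fails in a countable subalgebra.\<close>

context residuated_lattice
begin

lemma eval_closed: "(\<And>i. h i \<in> carrier R) \<Longrightarrow> eval R h t \<in> carrier R"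
  by (induction t) (auto simp: join_closed meet_closed ldiv_closed rdiv_closed)

end

lemma comm_residuated_lattice_transfer:
  fixes R :: "'b rlat" and Q :: "'a rlat" and g :: "'b \<Rightarrow> 'a"
  assumes R: "comm_residuated_lattice R"
    and inj: "inj_on g S" and SR: "S \<subseteq> carrier R" and car: "carrier Q = g ` S"
    and S1: "one R \<in> S"
    and Scl: "\<And>x y. \<lbrakk>x \<in> S; y \<in> S\<rbrakk> \<Longrightarrow> mult R x y \<in> S \<and> rjoin R x y \<in> S \<and> rmeet R x y \<in> S
               \<and> ldiv R x y \<in> S \<and> rdiv R x y \<in> S"
    and g1: "one Q = g (one R)"
    and gm: "\<And>x y. \<lbrakk>x \<in> S; y \<in> S\<rbrakk> \<Longrightarrow> mult Q (g x) (g y) = g (mult R x y)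
               \<and> rjoin Q (g x) (g y) = g (rjoin R x y) \<and> rmeet Q (g x) (g y) = g (rmeet R x y)
               \<and> ldiv Q (g x) (g y) = g (ldiv R x y) \<and> rdiv Q (g x) (g y) = g (rdiv R x y)"
  shows "comm_residuated_lattice Q"
    and "\<lbrakk>satisfies R e\<rbrakk> \<Longrightarrow> satisfies Q e"
    and "\<lbrakk>satisfies Q e; \<And>i. h i \<in> S\<rbrakk> \<Longrightarrow> eval R h (fst e) = eval R h (snd e)"
proof -
  interpret comm_residuated_lattice R by (rule R)
  have inS: "x \<in> carrier R" if "x \<in> S" for x using SR that by blast
  note geq = inj_on_eq_iff[OF inj]
  show "comm_residuated_lattice Q"
  proof unfold_locales
    note tr = car g1 gm S1 Scl geq inS rle_def
    show "\<And>x y z. \<lbrakk>x \<in> carrier Q; y \<in> carrier Q; z \<in> carrier Q\<rbrakk>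
            \<Longrightarrow> rle Q (mult Q x y) z \<longleftrightarrow> rle Q x (rdiv Q z y)"
      by (auto simp: tr residuation_rdiv[unfolded rle_def])
    show "\<And>x y z. \<lbrakk>x \<in> carrier Q; y \<in> carrier Q; z \<in> carrier Q\<rbrakk>
            \<Longrightarrow> rle Q (mult Q x y) z \<longleftrightarrow> rle Q y (ldiv Q x z)"
      by (auto simp: tr residuation_ldiv[unfolded rle_def])
  qed (auto simp: car g1 gm S1 Scl geq inS m_assoc join_assoc meet_assoc
         join_meet_absorb meet_join_absorb intro!: join_comm meet_comm m_comm)
  have ev: "eval R h t \<in> S \<and> eval Q (\<lambda>i. g (h i)) t = g (eval R h t)" if "\<And>i. h i \<in> S" for h t
    using that by (induction t) (auto simp: g1 gm S1 Scl)
  show "satisfies Q e" if e: "satisfies R e"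
    unfolding satisfies_def
  proof (intro allI impI)
    fix k :: "nat \<Rightarrow> 'a" assume "\<forall>i. k i \<in> carrier Q"
    then have "\<forall>i. \<exists>x. x \<in> S \<and> k i = g x" by (auto simp: car)
    then obtain h where h: "\<And>i. h i \<in> S" "\<And>i. k i = g (h i)" by metis
    then have k: "k = (\<lambda>i. g (h i))" by auto
    show "eval Q k (fst e) = eval Q k (snd e)"
      using e h(1) inS ev[of h] unfolding k satisfies_def by auto
  qed
  show "eval R h (fst e) = eval R h (snd e)" if "satisfies Q e" "\<And>i. h i \<in> S"
  proof -
    have "eval Q (\<lambda>i. g (h i)) (fst e) = eval Q (\<lambda>i. g (h i)) (snd e)"
      using that car by (auto simp: satisfies_def)
    then show ?thesis using ev[of h] that(2) geq by auto
  qed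
qed

lemma equational_theory_subset:
  assumes "infinite (UNIV :: 'a set)"
  shows "equational_theory TYPE('a) E \<subseteq> equational_theory TYPE('b) E"
proof
  fix e assume e: "e \<in> equational_theory TYPE('a) E"
  have "satisfies R e" if R: "R \<in> CRL_plus E" for R :: "'b rlat"
    unfolding satisfies_def
  proof (intro allI impI)
    fix h :: "nat \<Rightarrow> 'b" assume h: "\<forall>i. h i \<in> carrier R"
    from R interpret comm_residuated_lattice R by (simp add: CRL_plus_def)
    define S where "S = range (eval R h)"
    have "countable (UNIV :: trm set)"
      by (rule countableI[of trm_code], rule injI, rule trm_code_inj)
    then have "countable S" unfolding S_def by (rule countable_image)
    obtain u :: "nat \<Rightarrow> 'a" where "inj u"
      using infinite_countable_subset[OF assms] by (elim exE conjE)
    obtain g :: "'b \<Rightarrow> 'a" where g: "inj_on g S"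
    proof -
      from \<open>countable S\<close> obtain f :: "'b \<Rightarrow> nat" where "inj_on f S" by (rule countableE)
      then have "inj_on (u \<circ> f) S"
        using \<open>inj u\<close> by (intro comp_inj_on) (auto intro: inj_on_subset)
      then show ?thesis by (rule that)
    qed
    define g' where "g' = inv_into S g"
    have g': "g' (g x) = x" if "x \<in> S" for x using g that by (simp add: g'_def)
    define Q :: "'a rlat" where "Q = \<lparr>carrier = g ` S, mult = \<lambda>x y. g (mult R (g' x) (g' y)),
      one = g (one R), rjoin = \<lambda>x y. g (rjoin R (g' x) (g' y)), rmeet = \<lambda>x y. g (rmeet R (g' x) (g' y)),
      ldiv = \<lambda>x y. g (ldiv R (g' x) (g' y)), rdiv = \<lambda>x y. g (rdiv R (g' x) (g' y))\<rparr>"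
    have SR: "S \<subseteq> carrier R" using h eval_closed by (auto simp: S_def)
    have S1: "one R \<in> S" using rangeI[of "eval R h" One] unfolding S_def by simp
    have Scl: "mult R x y \<in> S \<and> rjoin R x y \<in> S \<and> rmeet R x y \<in> S \<and> ldiv R x y \<in> S \<and> rdiv R x y \<in> S"
      if "x \<in> S" "y \<in> S" for x y
    proof -
      from that obtain a b where "x = eval R h a" "y = eval R h b" by (auto simp: S_def)
      then show ?thesis
        using rangeI[of "eval R h" "Mult a b"] rangeI[of "eval R h" "Join a b"]
          rangeI[of "eval R h" "Meet a b"] rangeI[of "eval R h" "LDiv a b"]
          rangeI[of "eval R h" "RDiv a b"]
        unfolding S_def by simp
    qed
    have Sh: "h i \<in> S" for i using rangeI[of "eval R h" "Var i"] unfolding S_def by simp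
    have Q: "carrier Q = g ` S" "one Q = g (one R)" by (simp_all add: Q_def)
    have gm: "mult Q (g x) (g y) = g (mult R x y)
        \<and> rjoin Q (g x) (g y) = g (rjoin R x y) \<and> rmeet Q (g x) (g y) = g (rmeet R x y)
        \<and> ldiv Q (g x) (g y) = g (ldiv R x y) \<and> rdiv Q (g x) (g y) = g (rdiv R x y)"
      if "x \<in> S" "y \<in> S" for x y
      using that by (simp add: Q_def g')
    note tr = comm_residuated_lattice_transfer
      [OF comm_residuated_lattice_axioms g SR Q(1) S1 Scl Q(2) gm]
    have "Q \<in> CRL_plus E"
      using tr(1,2) R by (simp add: CRL_plus_def)
    then have "satisfies Q e"
      using e by (simp add: equational_theory_def)
    from tr(3)[OF _ _ _ _ this, of h] Sh show "eval R h (fst e) = eval R h (snd e)"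
      by simp
  qed
  then show "e \<in> equational_theory TYPE('b) E" by (simp add: equational_theory_def)
qed

lemma equational_theory_indep:
  assumes "infinite (UNIV :: 'a set)" "infinite (UNIV :: 'b set)"
  shows "equational_theory TYPE('a) E = equational_theory TYPE('b) E"
  by (intro equalityI equational_theory_subset assms)


section \<open>Simple and basic equations\<close>

text \<open>Vectors in \<open>\<nat>\<^sup>n\<close> are elements of \<open>carrier_vec n\<close>, with entries indexed from 0.
  The simple equation \<open>[D]\<close> in \<open>n\<close> variables is represented by \<open>n\<close> and \<open>D\<close>,
  the basic equation \<open>[f, A]\<close> in \<open>k\<close> variables by \<open>k\<close>, \<open>f\<close> and \<open>A\<close>.\<close>

definition ones_vec :: "nat \<Rightarrow> nat vec" where
  "ones_vec n = vec n (\<lambda>_. 1)"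

definition simple :: "nat \<Rightarrow> nat vec set \<Rightarrow> bool" where
  "simple n D \<longleftrightarrow> n \<ge> 1 \<and> D \<subseteq> carrier_vec n \<and> finite D \<and> D \<noteq> {} \<and>
     (\<forall>i<n. \<exists>d\<in>D. d $ i \<noteq> 0)"

definition basic :: "nat \<Rightarrow> nat vec \<Rightarrow> nat vec set \<Rightarrow> bool" where
  "basic k f A \<longleftrightarrow> f \<in> carrier_vec k \<and> (\<forall>i<k. f $ i \<ge> 1) \<and>
     A \<subseteq> carrier_vec k \<and> finite A \<and> A \<noteq> {} \<and> (\<forall>i<k. \<exists>a\<in>A. a $ i \<noteq> 0)"

primrec power_trm :: "trm \<Rightarrow> nat \<Rightarrow> trm" where
  "power_trm t 0 = One"
| "power_trm t (Suc m) = Mult t (power_trm t m)"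

definition monomial :: "nat vec \<Rightarrow> trm" where
  "monomial d = foldr (\<lambda>i t. Mult (power_trm (Var i) (d $ i)) t) [0..<dim_vec d] One"

definition join_list :: "trm list \<Rightarrow> trm" where
  "join_list ts = foldr Join (butlast ts) (last ts)"

text \<open>As an identity between terms \<open>[D]\<close> depends on the order in which the join over \<open>D\<close> is
  written. All these identities are equivalent in lattices, and we take all of them.\<close>

definition simple_eqns :: "nat \<Rightarrow> nat vec set \<Rightarrow> eqn set" where
  "simple_eqns n D = {Ineq (monomial (ones_vec n)) (join_list (map monomial ds)) | ds.
     distinct ds \<and> set ds = D}"

definition spinal :: "nat \<Rightarrow> nat vec \<Rightarrow> nat vec set \<Rightarrow> bool" where
  "spinal k f V \<longleftrightarrow> k \<ge> 1 \<and> basic k f V \<and> f \<notin> V \<and>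
     (\<exists>v :: nat \<Rightarrow> nat vec.
        (V = v ` {..<k} \<or> V = insert (0\<^sub>v k) (v ` {..<k})) \<and>
        (\<forall>j<k. v j $ j \<noteq> 0) \<and> (\<forall>j<k. \<forall>i<j. v i $ j = 0))"

text \<open>A \<open>k \<times> n\<close> matrix \<open>\<Sigma>\<close> encodes the monoid substitution replacing the \<open>j\<close>-th variable by the
  monomial whose exponent vector is the \<open>j\<close>-th column of \<open>\<Sigma>\<close>; thus a monomial with exponent
  vector \<open>d\<close> becomes the one with exponent vector \<open>\<Sigma> d\<close>.\<close>

definition prespinal :: "nat \<Rightarrow> nat vec set \<Rightarrow> bool" where
  "prespinal n D \<longleftrightarrow> (\<exists>k \<ge> 1. \<exists>\<Sigma> \<in> carrier_mat k n.
     spinal k (\<Sigma> *\<^sub>v ones_vec n) ((\<lambda>d. \<Sigma> *\<^sub>v d) ` D))"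

definition spineless :: "nat \<Rightarrow> nat vec set \<Rightarrow> bool" where
  "spineless n D \<longleftrightarrow> simple n D \<and> \<not> prespinal n D"

text \<open>The target is an equation in the single variable \<open>x\<close>, so the substitution is a
  \<open>1 \<times> n\<close> matrix.\<close>

definition expansive :: "nat \<Rightarrow> nat vec set \<Rightarrow> bool" where
  "expansive n D \<longleftrightarrow> simple n D \<and> (\<exists>\<Sigma> \<in> carrier_mat 1 n. \<exists>p \<ge> 1. \<exists>m \<ge> 1. \<exists>c :: nat \<Rightarrow> nat.
     (\<forall>j\<in>{1..m}. c j \<ge> 1) \<and>
     \<Sigma> *\<^sub>v ones_vec n = vec 1 (\<lambda>_. p) \<and>
     (\<lambda>d. \<Sigma> *\<^sub>v d) ` D = (\<lambda>j. vec 1 (\<lambda>_. p + c j)) ` {1..m})"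

end

theory Submission
  imports Defs "HOL-Computational_Algebra.Primes"
begin

text \<open>A commutative and-branching rewriting system on finite multisets of letters is written into a
  single inequality \<open>\<theta>\<^sup>p \<cdot> u \<le> y\<close>, where \<open>u\<close> is the initial word, \<open>y\<close> the final letter and \<open>\<theta>\<close> the meet of
  \<open>1\<close> with the residuals expressing the rules. The expansive equation gives \<open>\<theta>\<^sup>p \<le> \<theta>\<^sup>p\<^sup>+\<^sup>1\<close>, so that a
  fixed power of \<open>\<theta>\<close> pays for any number of rule applications.

  The difficulty is that the equations in \<open>\<Gamma>\<close> act as additional rules. They do no harm if the set of
  accepted words is closed under them, because the polarity of that set then yields an algebra of the
  variety. The accepted words are described by two linear functionals of the letter counts taking
  values in a sparse set (\<open>0\<close> and the powers of a large \<open>K\<close>). If an instance of \<open>[D]\<close> had all its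
  right-hand sides but not its left-hand side in such a set, then the different orders of magnitude of
  the values would make the substitution, decomposed along a Hilbert basis, a spinal image of \<open>[D]\<close>.

  Two powers of \<open>K\<close> are a two-counter machine with its counters in the exponents; and-branching serves
  as zero test. Such machines evaluate all recursive functions, and a diagonal argument concludes.\<close>

section \<open>Sparse sets and spineless equations\<close>

text \<open>That the argument works for two functionals but not for three fixes the machine model.
  With two counters only, all registers of a recursive function are packed into one of them as
  exponents of a prime factorization, and this counter is itself an exponent of \<open>K\<close>; an
  input \<open>c\<close> enters the inequality as \<open>K ^ (nth_prime 0 ^ c)\<close> copies of a
  letter. While a counter is being transferred, the two letters involved enter through one weighted
  sum, so that no third value arises.

  The size of \<open>K\<close> comes from Hilbert bases of monoids of those exponent rows that
  identify prescribed monomials. There are finitely many such prescriptions, so the generators have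
  bounded size although the substitutions have not. Hence \<open>K\<close> depends on \<Gamma> alone
  and serves all machines, as the diagonal argument requires: the equations for all programs are
  instances of one scheme \<open>test_eqn\<close>, differing in a single term
  \<open>C\<close>.\<close>

lemma ex_mono_subseq:
  fixes f :: "nat \<Rightarrow> nat"
  shows "\<exists>r :: nat \<Rightarrow> nat. strict_mono r \<and> (\<forall>i j. i \<le> j \<longrightarrow> f (r i) \<le> f (r j))"
proof -
  have ex: "\<exists>m\<ge>k. \<forall>j\<ge>k. f m \<le> f j" for k
    using ex_has_least_nat[of "\<lambda>m. m \<ge> k" k f] by auto
  define m where "m k = (SOME m. m \<ge> k \<and> (\<forall>j\<ge>k. f m \<le> f j))" for k
  have m: "m k \<ge> k \<and> (\<forall>j\<ge>k. f (m k) \<le> f j)" for k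
    unfolding m_def using ex[of k] by (intro someI_ex[of "\<lambda>m. m \<ge> k \<and> (\<forall>j\<ge>k. f m \<le> f j)"]) auto
  \<comment> \<open>\<open>r\<close> jumps to the place of a minimum of \<open>f\<close> over what
    lies ahead; minima over shrinking tails cannot decrease.\<close>
  define r where "r = rec_nat (m 0) (\<lambda>_ x. m (Suc x))"
  have r: "r 0 = m 0" "\<And>i. r (Suc i) = m (Suc (r i))" by (simp_all add: r_def)
  have sm: "strict_mono r" unfolding strict_mono_Suc_iff by (simp add: r(2) Suc_le_lessD m)
  have least: "f (r i) \<le> f j" if "r i \<le> j" for i j
  proof (cases i)
    case 0
    then show ?thesis using m r by simp
  next
    case (Suc i')
    have "Suc (r i') \<le> r i" using m r Suc by simp
    then show ?thesis using m[of "Suc (r i')"] r(2)[of i'] Suc that by simp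
  qed
  have "f (r i) \<le> f (r j)" if "i \<le> j" for i j
    by (rule least) (simp add: strict_mono_less_eq[OF sm] that)
  then show ?thesis using sm by blast
qed

lemma ex_mono_subseq_coords:
  fixes f :: "nat \<Rightarrow> nat \<Rightarrow> nat"
  shows "\<exists>r :: nat \<Rightarrow> nat. strict_mono r \<and> (\<forall>c<n. \<forall>i j. i \<le> j \<longrightarrow> f (r i) c \<le> f (r j) c)"
proof (induction n)
  case 0
  show ?case by (intro exI[of _ "\<lambda>i. i"]) (auto simp: strict_mono_def)
next
  case (Suc n)
  then obtain r :: "nat \<Rightarrow> nat"
    where r: "strict_mono r" "\<forall>c<n. \<forall>i j. i \<le> j \<longrightarrow> f (r i) c \<le> f (r j) c" by blast
  obtain q :: "nat \<Rightarrow> nat" where q: "strict_mono q" "\<forall>i j. i \<le> j \<longrightarrow> f (r (q i)) n \<le> f (r (q j)) n"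
    using ex_mono_subseq[of "\<lambda>i. f (r i) n"] by blast
  have "f (r (q i)) c \<le> f (r (q j)) c" if "c < Suc n" "i \<le> j" for c i j
    using that r(2) q strict_mono_less_eq[OF q(1)] by (cases "c = n") auto
  then show ?case using r(1) q(1)
    by (intro exI[of _ "r \<circ> q"]) (auto simp: strict_mono_def)
qed

text \<open>An infinite \<open>A\<close> would contain a sequence of distinct elements; a
  subsequence ascending in the first \<open>n\<close> coordinates makes two of them comparable and
  therefore equal.\<close>

lemma Dickson:
  fixes A :: "(nat \<Rightarrow> nat) set"
  assumes anti: "\<And>p q. \<lbrakk>p \<in> A; q \<in> A; \<forall>c<n. p c \<le> q c\<rbrakk> \<Longrightarrow> p = q"
  shows "finite A"
proof (rule ccontr)
  assume "infinite A"
  then obtain f :: "nat \<Rightarrow> nat \<Rightarrow> nat" where f: "inj f" "range f \<subseteq> A"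
    using infinite_countable_subset by blast
  obtain r :: "nat \<Rightarrow> nat"
    where r: "strict_mono r" "\<forall>c<n. \<forall>i j. i \<le> j \<longrightarrow> f (r i) c \<le> f (r j) c"
    using ex_mono_subseq_coords[of n f] by blast
  have "f (r 0) = f (r 1)" using r(2) f(2) by (intro anti) auto
  then have "r 0 = r 1" using f(1) by (simp add: inj_eq)
  then show False using r(1) by (simp add: strict_mono_eq)
qed

text \<open>The minimal nonzero elements form an antichain, finite by Dickson's lemma. Every nonzero
  element has one of them below it; subtracting that one stays in \<open>M\<close> and lowers the
  coordinate sum.\<close>

lemma Hilbert_basis:
  fixes M :: "(nat \<Rightarrow> nat) set"
  assumes supp: "\<And>p j. \<lbrakk>p \<in> M; j \<ge> n\<rbrakk> \<Longrightarrow> p j = 0"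
    and sub: "\<And>p q. \<lbrakk>p \<in> M; q \<in> M; \<forall>j. p j \<le> q j\<rbrakk> \<Longrightarrow> (\<lambda>j. q j - p j) \<in> M"
  shows "\<exists>G. finite G \<and> G \<subseteq> M \<and> (\<forall>s\<in>M. \<exists>l. \<forall>j. s j = (\<Sum>g\<in>G. l g * g j))"
proof -
  define N where "N = {p \<in> M. p \<noteq> (\<lambda>_. 0)}"
  define G where "G = {p \<in> N. \<forall>q\<in>N. (\<forall>j. q j \<le> p j) \<longrightarrow> q = p}"
  have le: "\<forall>j. p j \<le> q j" if "p \<in> M" "\<forall>c<n. p c \<le> q c" for p q
    using supp[OF that(1)] that(2) by (metis le0 not_le)
  have fin: "finite G"
  proof (rule Dickson[of _ n])
    fix p q assume pq: "p \<in> G" "q \<in> G" "\<forall>c<n. p c \<le> q c"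
    then have "p \<in> M" by (auto simp: G_def N_def)
    from le[OF this pq(3)] pq show "p = q" unfolding G_def by blast
  qed
  have below: "\<exists>g\<in>G. \<forall>j. g j \<le> s j" if "s \<in> N" for s
    using that
  proof (induction "\<Sum>j<n. s j" arbitrary: s rule: less_induct)
    case less
    show ?case
    proof (cases "s \<in> G")
      case False
      then obtain q where q: "q \<in> N" "\<forall>j. q j \<le> s j" "q \<noteq> s"
        using less.prems by (auto simp: G_def)
      then obtain i where i: "q i < s i" by (metis ext le_neq_implies_less)
      then have "i < n" using less.prems supp[of s i] by (force simp: N_def)
      then have "(\<Sum>j<n. q j) < (\<Sum>j<n. s j)"
        using q(2) i by (intro sum_strict_mono_ex1) auto
      from less.hyps[OF this q(1)] q(2) show ?thesis by (meson le_trans)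
    qed auto
  qed
  have "\<exists>l. \<forall>j. s j = (\<Sum>g\<in>G. l g * g j)" if "s \<in> M" for s
    using that
  proof (induction "\<Sum>j<n. s j" arbitrary: s rule: less_induct)
    case less
    show ?case
    proof (cases "s = (\<lambda>_. 0)")
      case True
      then show ?thesis by (intro exI[of _ "\<lambda>_. 0"]) auto
    next
      case False
      then have "s \<in> N" using less.prems by (simp add: N_def)
      then obtain g where g: "g \<in> G" "\<forall>j. g j \<le> s j" using below by blast
      have gM: "g \<in> M" "g \<noteq> (\<lambda>_. 0)" using g(1) by (auto simp: G_def N_def)
      then obtain i where i: "g i > 0" by fastforce
      then have "i < n" using supp[OF gM(1), of i] by (cases "i < n") auto
      then have "(\<Sum>j<n. s j - g j) < (\<Sum>j<n. s j)"
        using g(2) i by (intro sum_strict_mono_ex1) (auto intro!: bexI[of _ i] diff_less dest: spec[of _ i])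
      from less.hyps[OF this sub[OF gM(1) less.prems g(2)]]
      obtain l where l: "\<forall>j. s j - g j = (\<Sum>h\<in>G. l h * h j)" by blast
      have "s j = (\<Sum>h\<in>G. (l(g := Suc (l g))) h * h j)" for j
      proof -
        have "(\<Sum>h\<in>G. (l(g := Suc (l g))) h * h j) = (\<Sum>h\<in>G. l h * h j + (if h = g then g j else 0))"
          by (intro sum.cong) auto
        also have "\<dots> = (s j - g j) + g j" using l g(1) fin by (simp add: sum.distrib)
        finally show ?thesis using g(2) by simp
      qed
      then show ?thesis by blast
    qed
  qed
  moreover have "G \<subseteq> M" by (auto simp: G_def N_def)
  ultimately show ?thesis using fin by blast
qed

section \<open>Rows of substitutions and their decomposition\<close>

definition lin :: "(nat \<Rightarrow> nat) \<Rightarrow> nat vec \<Rightarrow> nat" where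
  "lin s d = (\<Sum>j<dim_vec d. s j * d $ j)"

text \<open>With \<open>s\<close> a row of a substitution matrix \<Sigma>, \<open>lin s d\<close> is
  an entry of \<Sigma> d. The rows that treat the two monomials of each pair in \<open>E\<close>
  alike solve a homogeneous linear system, hence are closed under the differences required for a
  Hilbert basis.\<close>

definition fibre_mon :: "nat \<Rightarrow> (nat vec \<times> nat vec) set \<Rightarrow> (nat \<Rightarrow> nat) set" where
  "fibre_mon n E = {p. (\<forall>j\<ge>n. p j = 0) \<and> (\<forall>(d, e)\<in>E. lin p d = lin p e)}"

lemma lin_diff: "(\<And>j. p j \<le> q j) \<Longrightarrow> lin (\<lambda>j. q j - p j) d = lin q d - lin p d"
  unfolding lin_def by (simp add: diff_mult_distrib sum_subtractf_nat)

lemma lin_sum: "lin (\<lambda>j. \<Sum>g\<in>G. l g * g j) d = (\<Sum>g\<in>G. l g * lin g d)"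
  unfolding lin_def
  by (simp add: sum_distrib_left sum_distrib_right mult.assoc sum.swap[of _ _ G])

text \<open>\<open>B\<close> is the constant lost when a combination of generators is replaced by
  its largest summand: if \<open>g\<close> gives that summand,
  \<open>lin s d \<le> card G * l g * lin g d \<le> B * l g\<close>.\<close>

definition gens :: "(nat vec \<times> nat vec) set \<Rightarrow> nat \<Rightarrow> nat vec set \<Rightarrow> nat \<Rightarrow> (nat \<Rightarrow> nat) set \<Rightarrow> bool" where
  "gens E n D B G \<longleftrightarrow> finite G \<and> G \<subseteq> fibre_mon n E \<and> (\<forall>g\<in>G. \<forall>d\<in>D. card G * lin g d \<le> B) \<and>
     (\<forall>s\<in>fibre_mon n E. \<exists>l. \<forall>j. s j = (\<Sum>g\<in>G. l g * g j))"

lemma ex_gens_uniform: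
  assumes "finite D"
  shows "\<exists>B. \<forall>E \<subseteq> D \<times> D. \<exists>G. gens E n D B G"
proof -
  have "\<forall>E. \<exists>G. finite G \<and> G \<subseteq> fibre_mon n E \<and>
     (\<forall>s\<in>fibre_mon n E. \<exists>l. \<forall>j. s j = (\<Sum>g\<in>G. l g * g j))"
    by (intro allI Hilbert_basis[of _ n]) (auto simp: fibre_mon_def lin_diff, force)
  then obtain G where G: "\<And>E. finite (G E)" "\<And>E. G E \<subseteq> fibre_mon n E"
     "\<And>E. \<forall>s\<in>fibre_mon n E. \<exists>l. \<forall>j. s j = (\<Sum>g\<in>G E. l g * g j)"
    by metis
  define V where "V = (\<Union>E\<in>Pow (D \<times> D). (\<lambda>(g, d). card (G E) * lin g d) ` (G E \<times> D))"
  have "finite V" unfolding V_def using assms G(1) by auto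
  then obtain B where B: "\<And>v. v \<in> V \<Longrightarrow> v \<le> B" by (meson finite_nat_set_iff_bounded_le)
  have "gens E n D B (G E)" if "E \<subseteq> D \<times> D" for E
  proof -
    have "card (G E) * lin g d \<le> B" if "g \<in> G E" "d \<in> D" for g d
      using that \<open>E \<subseteq> D \<times> D\<close> by (intro B) (force simp: V_def intro: bexI[of _ E])
    then show ?thesis unfolding gens_def using G(1,2,3)[of E] by blast
  qed
  then show ?thesis by blast
qed

definition sparse :: "nat \<Rightarrow> nat set \<Rightarrow> bool" where
  "sparse K X \<longleftrightarrow> (\<forall>x\<in>X. \<forall>y\<in>X. x < y \<longrightarrow> K * x \<le> y)"

text \<open>A summand with the largest contribution to \<open>lin s d\<close> carries a fixed fraction of it, hence too much to
  contribute anything to a value that is smaller by the factor \<open>K\<close>.\<close>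

lemma dominant:
  assumes G: "gens E n D B G" and s: "\<And>j. s j = (\<Sum>g\<in>G. l g * g j)"
    and X: "sparse K X" and K: "K > B" and d: "d \<in> D" "lin s d > 0" "u + lin s d \<in> X"
  shows "\<exists>g\<in>G. l g > 0 \<and> lin g d > 0 \<and>
     (\<forall>d'. u + lin s d' \<in> X \<longrightarrow> lin s d' < lin s d \<longrightarrow> lin g d' = 0)"
proof -
  have fin: "finite G" and bnd: "\<And>g. g \<in> G \<Longrightarrow> card G * lin g d \<le> B"
    using G d(1) by (auto simp: gens_def)
  have s': "s = (\<lambda>j. \<Sum>g\<in>G. l g * g j)" using s by auto
  have ls: "lin s e = (\<Sum>g\<in>G. l g * lin g e)" for e unfolding s' by (rule lin_sum)
  have ne: "G \<noteq> {}" using d(2) ls by auto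
  have "Max ((\<lambda>h. l h * lin h d) ` G) \<in> (\<lambda>h. l h * lin h d) ` G"
    using fin ne by (intro Max_in) auto
  then obtain g where g: "g \<in> G" "l g * lin g d = Max ((\<lambda>h. l h * lin h d) ` G)" by auto
  then have g: "g \<in> G" "\<And>h. h \<in> G \<Longrightarrow> l h * lin h d \<le> l g * lin g d"
    using fin by auto
  have "lin s d \<le> card G * (l g * lin g d)"
    unfolding ls using sum_bounded_above[of G "\<lambda>h. l h * lin h d"] g(2) by simp
  also have "\<dots> \<le> B * l g" using mult_right_mono[OF bnd[OF g(1)], of "l g"] by (simp add: ac_simps)
  finally have le: "lin s d \<le> B * l g" .
  have pos: "l g > 0" using le d(2) by (cases "l g") auto
  have gpos: "lin g d > 0"
  proof (rule ccontr)
    assume "\<not> lin g d > 0"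
    then have "(\<Sum>h\<in>G. l h * lin h d) = 0" using g(2) by (intro sum.neutral) force
    then show False using d(2) unfolding ls by simp
  qed
  have "lin g d' = 0" if "u + lin s d' \<in> X" "lin s d' < lin s d" for d'
  proof (rule ccontr)
    assume nz: "lin g d' \<noteq> 0"
    have "l g * lin g d' \<le> lin s d'"
      unfolding ls using member_le_sum[of g G "\<lambda>h. l h * lin h d'"] g(1) fin by simp
    moreover have "l g \<le> l g * lin g d'" using nz by simp
    ultimately have lg: "l g \<le> lin s d'" by linarith
    \<comment> \<open>Sparsity speaks of the totals with the offset \<open>u\<close>. The offset
      does no harm, as it is multiplied by \<open>K\<close> on the smaller side; what remains
      contradicts \<open>K > B\<close>.\<close>
    have "K * (u + lin s d') \<le> u + lin s d"
      using X that d(3) by (auto simp: sparse_def)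
    also have "\<dots> \<le> u + B * lin s d'" using le lg by (meson add_left_mono le_trans mult_le_mono2)
    finally have "K * u + K * lin s d' \<le> u + B * lin s d'" by (simp add: distrib_left)
    moreover have "K * u \<ge> u" using K by simp
    moreover have "K * lin s d' > B * lin s d'" using K lg pos by simp
    ultimately show False by linarith
  qed
  then show ?thesis using g(1) pos gpos by blast
qed

lemma dim_ones_vec [simp]: "dim_vec (ones_vec n) = n" by (simp add: ones_vec_def)

lemma ones_vec_carrier [simp]: "ones_vec n \<in> carrier_vec n" by (simp add: ones_vec_def)

lemma lin_ones: "lin s (ones_vec n) = (\<Sum>j<n. s j)" by (simp add: lin_def ones_vec_def)

lemma mult_mat_vec_lin:
  assumes "d \<in> carrier_vec n"
  shows "mat k n (\<lambda>(i, j). r i j) *\<^sub>v d = vec k (\<lambda>i. lin (r i) d)"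
  using assms by (intro eq_vecI) (auto simp: lin_def scalar_prod_def lessThan_atLeast0 intro!: sum.cong)

lemma lin_nonzeroD:
  assumes "d \<in> carrier_vec n" "lin s d \<noteq> 0"
  shows "\<exists>j<n. s j * d $ j \<noteq> 0"
proof (rule ccontr)
  assume "\<not> ?thesis"
  then have "lin s d = 0" unfolding lin_def using assms(1) by (intro sum.neutral) auto
  then show False using assms(2) by simp
qed

lemma lin_pos_ones:
  assumes "d \<in> carrier_vec n" "lin s d \<noteq> 0"
  shows "lin s (ones_vec n) > 0"
proof -
  obtain j where "j < n" "s j * d $ j \<noteq> 0"
    using lin_nonzeroD[OF assms] by blast
  then show ?thesis unfolding lin_ones by (intro sum_pos2[of _ j]) auto
qed

lemma simple_lin_pos:
  assumes "simple n D" "d \<in> carrier_vec n" "lin s d \<noteq> 0"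
  shows "\<exists>e\<in>D. lin s e > 0"
proof -
  obtain j where j: "j < n" "s j * d $ j \<noteq> 0"
    using lin_nonzeroD[OF assms(2,3)] by blast
  then obtain e where e: "e \<in> D" "e $ j \<noteq> 0" using assms(1) by (auto simp: simple_def)
  then have "dim_vec e = n" using assms(1) by (auto simp: simple_def)
  then have "lin s e > 0" unfolding lin_def using j e by (intro sum_pos2[of _ j]) auto
  then show ?thesis using e(1) by blast
qed

text \<open>The rows \<open>r\<close> form the matrix, and the monomials \<open>rep i\<close>, in
  the order of \<open>i\<close>, provide the vectors of a spinal equation. The left-hand exponents
  are positive because a row that is nonzero at \<open>rep j\<close> has a nonzero entry.\<close>

lemma prespinalI:
  fixes k :: nat and r :: "nat \<Rightarrow> nat \<Rightarrow> nat" and rep :: "nat \<Rightarrow> nat vec"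
  assumes D: "simple n D" and k: "k \<ge> 1"
    and rep: "\<And>i. i < k \<Longrightarrow> rep i \<in> D"
    and cases: "\<And>d. d \<in> D \<Longrightarrow> (\<exists>i<k. \<forall>j<k. lin (r j) d = lin (r j) (rep i)) \<or> (\<forall>j<k. lin (r j) d = 0)"
    and diag: "\<And>j. j < k \<Longrightarrow> lin (r j) (rep j) \<noteq> 0"
    and tri: "\<And>i j. \<lbrakk>j < k; i < j\<rbrakk> \<Longrightarrow> lin (r j) (rep i) = 0"
    and f: "\<And>d. d \<in> D \<Longrightarrow> \<exists>j<k. lin (r j) d \<noteq> lin (r j) (ones_vec n)"
  shows "prespinal n D"
proof -
  define w where "w d = vec k (\<lambda>i. lin (r i) d)" for d
  have Dn: "D \<subseteq> carrier_vec n" and finD: "finite D" "D \<noteq> {}" using D by (auto simp: simple_def)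
  have w_eq: "w d = w e \<longleftrightarrow> (\<forall>i<k. lin (r i) d = lin (r i) e)" for d e
    by (auto simp: w_def vec_eq_iff)
  have V: "w ` D = (\<lambda>i. w (rep i)) ` {..<k} \<or> w ` D = insert (0\<^sub>v k) ((\<lambda>i. w (rep i)) ` {..<k})"
  proof (cases "\<exists>d\<in>D. \<not> (\<exists>i<k. w d = w (rep i))")
    case True
    then obtain d where d: "d \<in> D" "\<not> (\<exists>i<k. w d = w (rep i))" by blast
    with cases[OF d(1)] have "w d = 0\<^sub>v k" by (auto simp: w_def vec_eq_iff)
    moreover have "w e \<in> insert (0\<^sub>v k) ((\<lambda>i. w (rep i)) ` {..<k})" if "e \<in> D" for e
      using cases[OF that] unfolding w_eq[symmetric] by (auto simp: w_def vec_eq_iff)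
    ultimately show ?thesis using d(1) rep by (intro disjI2) (force intro: image_eqI[of _ w d])
  next
    case False
    then show ?thesis using rep by (intro disjI1) auto
  qed
  have "spinal k (w (ones_vec n)) (w ` D)"
    unfolding spinal_def basic_def
  proof (intro conjI)
    show "\<forall>i<k. 1 \<le> w (ones_vec n) $ i"
      using lin_pos_ones[OF _ diag] rep Dn by (force simp: w_def)
    show "\<forall>i<k. \<exists>a\<in>w ` D. a $ i \<noteq> 0" using diag rep by (force simp: w_def)
    show "w (ones_vec n) \<notin> w ` D"
      using f unfolding image_iff w_eq by metis
    show "\<exists>v. (w ` D = v ` {..<k} \<or> w ` D = insert (0\<^sub>v k) (v ` {..<k})) \<and>
        (\<forall>j<k. v j $ j \<noteq> 0) \<and> (\<forall>j<k. \<forall>i<j. v i $ j = 0)"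
      using V diag tri by (intro exI[of _ "\<lambda>i. w (rep i)"]) (auto simp: w_def)
  qed (use finD k in \<open>auto simp: w_def\<close>)
  moreover have "mat k n (\<lambda>(i, j). r i j) *\<^sub>v d = w d" if "d \<in> carrier_vec n" for d
    using mult_mat_vec_lin[OF that] by (simp add: w_def)
  then have "mat k n (\<lambda>(i, j). r i j) *\<^sub>v ones_vec n = w (ones_vec n)"
    "(\<lambda>d. mat k n (\<lambda>(i, j). r i j) *\<^sub>v d) ` D = w ` D"
    using Dn by (auto intro!: image_cong simp: ones_vec_def)
  ultimately show ?thesis
    unfolding prespinal_def using k by (intro exI[of _ k]) (force intro!: bexI[of _ "mat k n (\<lambda>(i, j). r i j)"])
qed

text \<open>The substitution with spinal image has one row for each positive value of \<open>lin s\<close> on \<open>D\<close>: the sum of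
  those summands of \<open>s\<close> for which this value is the smallest one they contribute to.\<close>

lemma sparse_row_closed:
  assumes D: "spineless n D" and gens: "\<And>E. E \<subseteq> D' \<times> D' \<Longrightarrow> \<exists>G. gens E n D' B G"
    and DD': "D \<subseteq> D'" and K: "K > B" and X: "sparse K X" and supp: "\<And>j. j \<ge> n \<Longrightarrow> s j = 0"
    and sX: "\<And>d. d \<in> D \<Longrightarrow> u + lin s d \<in> X"
  shows "\<exists>d\<in>D. lin s d = lin s (ones_vec n)"
proof (rule ccontr)
  assume contr: "\<not> ?thesis"
  have simp: "simple n D" using D by (simp add: spineless_def)
  then have Dn: "D \<subseteq> carrier_vec n" and finD: "finite D" "D \<noteq> {}" by (auto simp: simple_def)
  \<comment> \<open>Generators for this \<open>E\<close> are constant wherever \<open>s\<close> is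
    constant on \<open>D\<close>, so the image of a right-hand side depends only on its value under
    \<open>s\<close>.\<close>
  define E where "E = {(d, e). d \<in> D \<and> e \<in> D \<and> lin s d = lin s e}"
  obtain G where G: "gens E n D' B G" using gens[of E] DD' by (auto simp: E_def)
  have finG: "finite G" and GM: "G \<subseteq> fibre_mon n E" using G by (auto simp: gens_def)
  have "s \<in> fibre_mon n E" using supp by (auto simp: fibre_mon_def E_def)
  then obtain l where l: "\<And>j. s j = (\<Sum>g\<in>G. l g * g j)" using G unfolding gens_def by blast
  have s_eq: "s = (\<lambda>j. \<Sum>g\<in>G. l g * g j)" using l by auto
  have ls: "lin s d = (\<Sum>g\<in>G. l g * lin g d)" for d unfolding s_eq by (rule lin_sum)
  have const: "lin g d = lin g e" if "g \<in> G" "d \<in> D" "e \<in> D" "lin s d = lin s e" for g d e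
    using that GM by (auto simp: fibre_mon_def E_def)
  define C where "C = sorted_list_of_set (lin s ` D - {0})"
  have setC: "set C = lin s ` D - {0}" and distC: "distinct C" and sortC: "sorted C"
    using finD by (auto simp: C_def)
  define k where "k = length C"
  define t where "t g = Min (lin s ` {d \<in> D. lin g d > 0})" for g
  define row where "row i j = (\<Sum>g\<in>G. (if t g = C ! i then l g else 0) * g j)" for i j
  have row: "lin (row i) d = (\<Sum>g\<in>G. (if t g = C ! i then l g else 0) * lin g d)" for i d
    unfolding row_def by (rule lin_sum)
  have t_le: "t g \<le> lin s d" if "d \<in> D" "lin g d > 0" for g d
    unfolding t_def using that finD by (intro Min_le) auto
  have zero: "lin (row i) d = 0" if "d \<in> D" "lin s d < C ! i" for i d
  proof -
    have "(if t g = C ! i then l g else 0) * lin g d = 0" for g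
      using t_le[OF that(1), of g] that(2) by (cases "lin g d = 0") auto
    then show ?thesis unfolding row by (intro sum.neutral ballI)
  qed
  have pos: "lin (row i) d > 0" if d: "d \<in> D" "lin s d = C ! i" and i: "i < k" for i d
  proof -
    have "C ! i \<in> set C" using i by (simp add: k_def)
    then have sd: "lin s d > 0" using d(2) setC by auto
    obtain g where g: "g \<in> G" "l g > 0" "lin g d > 0"
      and low: "\<And>e. u + lin s e \<in> X \<Longrightarrow> lin s e < lin s d \<Longrightarrow> lin g e = 0"
      using dominant[OF G l X K _ sd sX[OF d(1)]] d(1) DD' by blast
    have "t g = C ! i" unfolding t_def d(2)[symmetric]
    proof (rule Min_eqI)
      fix y assume "y \<in> lin s ` {d \<in> D. 0 < lin g d}"
      then show "lin s d \<le> y" using low sX by (auto simp: not_less[symmetric]) 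
    next
      show "lin s d \<in> lin s ` {d \<in> D. 0 < lin g d}" using d g by blast
    qed (use finD in auto)
    then show ?thesis unfolding row using g finG by (intro sum_pos2[of _ g]) auto
  qed
  have rep: "\<exists>d\<in>D. lin s d = C ! i" if "i < k" for i
    using that setC nth_mem[of i C] by (auto simp: k_def)
  have sum_rows: "(\<Sum>i<k. lin (row i) d) = lin s d" if d: "d \<in> carrier_vec n" for d
  proof -
    have *: "(\<Sum>i<k. (if t g = C ! i then l g else 0) * lin g d) = l g * lin g d" if g: "g \<in> G" for g
    proof (cases "l g * lin g d = 0")
      case False
      \<comment> \<open>Every variable of a simple equation occurs on its right, so a generator
        contributing to any monomial contributes to some element of \<open>D\<close>: the minimum in
        \<open>t\<close> is taken over a nonempty set.\<close>
      then obtain e where e: "e \<in> D" "lin g e > 0" using simple_lin_pos[OF simp d] by auto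
      have "t g \<in> lin s ` {d \<in> D. lin g d > 0}"
        unfolding t_def using e finD by (intro Min_in) auto
      then obtain e where e: "e \<in> D" "lin g e > 0" "t g = lin s e" by auto
      have "l g * lin g e \<le> lin s e" unfolding ls using g finG
        by (intro member_le_sum[of g G "\<lambda>h. l h * lin h e"]) auto
      then have "lin s e \<noteq> 0" using e(2) False by (cases "lin s e") auto
      then have "t g \<in> set C" using e(1,3) unfolding setC by simp
      then obtain i where i: "i < k" "C ! i = t g" by (auto simp: in_set_conv_nth k_def)
      have "(\<Sum>i<k. (if t g = C ! i then l g else 0) * lin g d) = (\<Sum>j<k. if j = i then l g * lin g d else 0)"
        using i distC by (intro sum.cong) (auto simp: nth_eq_iff_index_eq k_def)
      then show ?thesis using i by simp
    qed auto
    have "(\<Sum>i<k. lin (row i) d) = (\<Sum>g\<in>G. \<Sum>i<k. (if t g = C ! i then l g else 0) * lin g d)"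
      unfolding row by (rule sum.swap)
    then show ?thesis unfolding ls using * by simp
  qed
  obtain rp where rp: "\<And>i. i < k \<Longrightarrow> rp i \<in> D" "\<And>i. i < k \<Longrightarrow> lin s (rp i) = C ! i"
    using rep by metis
  have "k \<ge> 1"
  proof (rule ccontr)
    assume "\<not> k \<ge> 1"
    then have "C = []" by (cases C) (simp_all add: k_def)
    then have 0: "lin s d = 0" if "d \<in> D" for d using that setC by auto
    then have "lin s (ones_vec n) = 0" using simple_lin_pos[OF simp, of "ones_vec n" s] by (force simp: ones_vec_def)
    then show False using 0 finD contr by auto
  qed
  have "prespinal n D"
  proof (rule prespinalI[OF simp \<open>k \<ge> 1\<close>, where r = row and rep = rp])
    fix d assume d: "d \<in> D"
    show "(\<exists>i<k. \<forall>j<k. lin (row j) d = lin (row j) (rp i)) \<or> (\<forall>j<k. lin (row j) d = 0)"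
    proof (cases "lin s d = 0")
      case True
      have "lin (row j) d = 0" if "j < k" for j
      proof -
        have "C ! j \<in> set C" using that by (simp add: k_def)
        then show ?thesis using True zero[OF d, of j] setC by simp
      qed
      then show ?thesis by blast
    next
      case False
      then have "lin s d \<in> set C" using d setC by auto
      then obtain i where i: "i < k" "C ! i = lin s d" by (auto simp: in_set_conv_nth k_def)
      have "lin (row j) d = lin (row j) (rp i)" for j
        unfolding row using const[OF _ d rp(1)[OF i(1)]] rp(2)[OF i(1)] i(2) by (intro sum.cong) auto
      then show ?thesis using i by blast
    qed
    show "\<exists>j<k. lin (row j) d \<noteq> lin (row j) (ones_vec n)"
    proof (rule ccontr)
      assume "\<not> ?thesis"
      then have "(\<Sum>i<k. lin (row i) d) = (\<Sum>i<k. lin (row i) (ones_vec n))" by auto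
      then have "lin s d = lin s (ones_vec n)" using sum_rows d Dn by (auto simp: ones_vec_def)
      then show False using contr d by blast
    qed
  next
    fix j assume "j < k"
    then show "lin (row j) (rp j) \<noteq> 0" using pos[OF rp(1,2)] by force
  next
    fix i j assume ij: "j < k" "i < j"
    then have "C ! i \<le> C ! j" "C ! i \<noteq> C ! j"
      using sortC distC by (auto simp: k_def sorted_nth_mono nth_eq_iff_index_eq)
    then show "lin (row j) (rp i) = 0" using ij rp by (intro zero) auto
  qed (use rp in auto)
  then show False using D by (simp add: spineless_def)
qed

text \<open>By the one-row case both left-hand sides occur among the values. A dominant generator for each of
  them gives an image whose right-hand sides are among \<open>(q, 0)\<close>, \<open>(0, q')\<close> and \<open>(0, 0)\<close>. The analogue for three
  rows is false: \<open>xyz \<le> xy \<or> yz \<or> xz \<or> x \<or> 1\<close> is spineless.\<close>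

lemma sparse_pair_closed_aux:
  assumes D: "spineless n D" and gens: "\<And>E. E \<subseteq> D' \<times> D' \<Longrightarrow> \<exists>G. gens E n D' B G"
    and D': "D' = insert (ones_vec n) D" and K: "K > B" "K > m" and X: "sparse K X"
    and m: "\<And>d i. \<lbrakk>d \<in> D; i < n\<rbrakk> \<Longrightarrow> d $ i \<le> m"
    and supp: "\<And>i j. j \<ge> n \<Longrightarrow> s i j = 0"
    and sX: "\<And>d (i :: bool). d \<in> D \<Longrightarrow> u i + lin (s i) d \<in> X"
  shows "\<exists>d\<in>D. \<forall>i. lin (s i) d = lin (s i) (ones_vec n)"
proof (rule ccontr)
  let ?o = "ones_vec n"
  assume contr: "\<not> ?thesis"
  have simp: "simple n D" using D by (simp add: spineless_def)
  then have Dn: "D \<subseteq> carrier_vec n" and finD: "finite D" "D \<noteq> {}" by (auto simp: simple_def)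
  have on: "?o \<in> carrier_vec n" by (simp add: ones_vec_def)
  have top: "\<exists>d\<in>D. lin (s i) d = lin (s i) ?o" for i
    using D' by (intro sparse_row_closed[OF D gens _ K(1) X supp sX]) auto
  have pos: "lin (s i) ?o > 0" for i
  proof (rule ccontr)
    assume "\<not> lin (s i) ?o > 0"
    then have "lin (s i) d = lin (s i) ?o" if "d \<in> D" for d
      using lin_pos_ones[of d n "s i"] that Dn by fastforce
    moreover obtain d where d: "d \<in> D" "lin (s (\<not> i)) d = lin (s (\<not> i)) ?o" using top by blast
    ultimately have "lin (s j) d = lin (s j) ?o" for j by (cases "j = i") auto
    then show False using contr d(1) by blast
  qed
  \<comment> \<open>The left-hand side has the largest value: exponents in \<open>D\<close> are at
    most \<open>m\<close>, so a larger value would exceed it by a factor of at most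
    \<open>m\<close>, while sparsity demands the factor \<open>K > m\<close>.\<close>
  have le: "lin (s i) d \<le> lin (s i) ?o" if d: "d \<in> D" for d i
  proof (rule ccontr)
    assume less: "\<not> ?thesis"
    have dim: "dim_vec d = n" using d Dn by auto
    have "lin (s i) d \<le> (\<Sum>j<n. s i j * m)"
      unfolding lin_def dim using m[OF d] by (intro sum_mono mult_left_mono) auto
    then have dm: "lin (s i) d \<le> m * lin (s i) ?o" by (simp add: lin_ones sum_distrib_left mult.commute)
    obtain e where e: "e \<in> D" "lin (s i) e = lin (s i) ?o" using top by blast
    then have "K * (u i + lin (s i) ?o) \<le> u i + lin (s i) d"
      using X sX[OF e(1), of i] sX[OF d, of i] less unfolding sparse_def by auto
    then have "K * u i + K * lin (s i) ?o \<le> u i + m * lin (s i) ?o"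
      using dm by (simp add: distrib_left)
    moreover have "K * u i \<ge> u i" using K by simp
    moreover have "K * lin (s i) ?o > m * lin (s i) ?o" using K pos by simp
    ultimately show False by linarith
  qed
  define Q where "Q i g e \<longleftrightarrow> e \<in> D \<and> lin g e \<noteq> 0 \<and> lin g ?o = lin g e \<and> lin (s i) e = lin (s i) ?o \<and>
      (\<forall>d\<in>D. lin g d = (if lin (s i) d = lin (s i) ?o then lin g e else 0))" for i g e
  have "\<exists>g e. Q i g e" for i
  proof -
    \<comment> \<open>The right-hand sides that attain the left-hand value are tied to the left-hand
      side itself; this is why \<open>D'\<close> contains the all-ones vector. The other right-hand
      sides have smaller values, so the dominant generator vanishes on them.\<close>
    define E where "E = {(d, o'). d \<in> D \<and> o' = ?o \<and> lin (s i) d = lin (s i) ?o}"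
    obtain G where G: "gens E n D' B G" using gens[of E] D' by (auto simp: E_def)
    have GM: "G \<subseteq> fibre_mon n E" using G by (auto simp: gens_def)
    have "s i \<in> fibre_mon n E" using supp by (auto simp: fibre_mon_def E_def)
    then obtain l where l: "\<And>j. s i j = (\<Sum>g\<in>G. l g * g j)" using G unfolding gens_def by blast
    obtain e where e: "e \<in> D" "lin (s i) e = lin (s i) ?o" using top by blast
    have "lin (s i) e > 0" using pos e by simp
    from dominant[OF G l X K(1) _ this sX[OF e(1)]] e(1)
    obtain g where g: "g \<in> G" "lin g e > 0"
      and low: "\<And>d. u i + lin (s i) d \<in> X \<Longrightarrow> lin (s i) d < lin (s i) e \<Longrightarrow> lin g d = 0"
      using D' by blast
    have same: "lin g d = lin g ?o" if "d \<in> D" "lin (s i) d = lin (s i) ?o" for d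
      using that GM g(1) by (auto simp: fibre_mon_def E_def)
    have vals: "lin g d = (if lin (s i) d = lin (s i) ?o then lin g e else 0)" if "d \<in> D" for d
    proof (cases "lin (s i) d = lin (s i) ?o")
      case True
      then show ?thesis using same[OF that True] same[OF e] by simp
    next
      case False
      then have "lin (s i) d < lin (s i) e" using le[OF that, of i] e(2) by simp
      then show ?thesis using low[OF sX[OF that]] False by simp
    qed
    have "Q i g e" unfolding Q_def
      by (intro conjI ballI e vals) (simp_all add: g(2) same[OF e, symmetric] less_imp_neq[OF g(2), symmetric])
    then show ?thesis by blast
  qed
  then obtain g e where Q: "\<And>i. Q i (g i) (e i)" by metis
  have ge: "\<And>i. e i \<in> D" "\<And>i. lin (g i) (e i) \<noteq> 0" "\<And>i. lin (g i) ?o = lin (g i) (e i)"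
      "\<And>i. lin (s i) (e i) = lin (s i) ?o"
      "\<And>i d. d \<in> D \<Longrightarrow> lin (g i) d = (if lin (s i) d = lin (s i) ?o then lin (g i) (e i) else 0)"
    using Q unfolding Q_def by blast+
  define t where "t i d \<longleftrightarrow> lin (s i) d = lin (s i) ?o" for i d
  define q where "q i = lin (g i) (e i)" for i
  have q: "lin (g i) ?o = q i" "q i \<noteq> 0" "e i \<in> D" "t i (e i)" for i
    using ge(1-4) unfolding q_def t_def by blast+
  have val: "lin (g i) d = (if t i d then q i else 0)" if "d \<in> D" for i d
    using ge(5)[OF that] unfolding q_def t_def by blast
  \<comment> \<open>No right-hand side attains both left-hand values, whereas the image of the
    left-hand side has both entries \<open>q i\<close> nonzero; hence it is not among the images of
    \<open>D\<close>.\<close>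
  have excl: "\<not> (t True d \<and> t False d)" if "d \<in> D" for d
    using contr that unfolding t_def by (metis (full_types))
  then have excl2: "\<not> t True (e False)" "\<not> t False (e True)"
    using q by blast+
  have lt2: "(\<exists>i<2. P i) \<longleftrightarrow> P 0 \<or> P 1" "(\<forall>i<2. P i) \<longleftrightarrow> P 0 \<and> P 1" for P :: "nat \<Rightarrow> bool"
    by (auto simp: less_2_cases_iff)
  have "prespinal n D"
  proof (rule prespinalI[OF simp, where k = 2 and r = "\<lambda>i. g (i = 1)" and rep = "\<lambda>i. e (i = 1)"])
    fix d assume d: "d \<in> D"
    show "(\<exists>i<2::nat. \<forall>j<2::nat. lin (g (j = 1)) d = lin (g (j = 1)) (e (i = 1))) \<or> (\<forall>j<2::nat. lin (g (j = 1)) d = 0)"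
      unfolding lt2 using excl[OF d] excl2 q by (auto simp: val d)
    show "\<exists>j<2::nat. lin (g (j = 1)) d \<noteq> lin (g (j = 1)) ?o"
      unfolding lt2 using excl[OF d] q by (auto simp: val d)
  next
    fix i j :: nat assume "j < 2" "i < j"
    then have "i = 0" "j = 1" by auto
    then show "lin (g (j = 1)) (e (i = 1)) = 0" using excl2 q by (simp add: val)
  qed (use q in \<open>auto simp: q_def\<close>)
  then show False using D by (simp add: spineless_def)
qed

lemma sparse_pair_closed:
  assumes D: "spineless n D"
  shows "\<exists>K0. \<forall>K\<ge>K0. \<forall>X u s. sparse K X \<longrightarrow>
    (\<forall>d\<in>D. \<forall>i :: bool. u i + lin (s i) d \<in> X) \<longrightarrow>
    (\<exists>d\<in>D. \<forall>i. lin (s i) d = lin (s i) (ones_vec n))"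
proof -
  have Dn: "D \<subseteq> carrier_vec n" and fin: "finite D" using D by (auto simp: spineless_def simple_def)
  define D' where "D' = insert (ones_vec n) D"
  obtain B where B: "\<And>E. E \<subseteq> D' \<times> D' \<Longrightarrow> \<exists>G. gens E n D' B G"
    using ex_gens_uniform[of D' n] fin by (auto simp: D'_def)
  have "finite ((\<lambda>(d, i). d $ i) ` (D \<times> {..<n}))" using fin by auto
  then obtain m where m: "\<And>v. v \<in> (\<lambda>(d, i). d $ i) ` (D \<times> {..<n}) \<Longrightarrow> v \<le> m"
    by (meson finite_nat_set_iff_bounded_le)
  have "\<exists>d\<in>D. \<forall>i. lin (s i) d = lin (s i) (ones_vec n)"
    if K: "K \<ge> Suc (B + m)" and X: "sparse K X" and sX: "\<forall>d\<in>D. \<forall>i. u i + lin (s i) d \<in> X"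
    for K X and u :: "bool \<Rightarrow> nat" and s
  proof -
    define s' where "s' i j = (if j < n then s i j else 0)" for i j
    have s': "lin (s' i) d = lin (s i) d" if "d \<in> carrier_vec n" for i d
      using that by (auto simp: lin_def s'_def intro!: sum.cong)
    have "\<exists>d\<in>D. \<forall>i. lin (s' i) d = lin (s' i) (ones_vec n)"
      by (rule sparse_pair_closed_aux[OF D B D'_def _ _ X, where m = m and u = u])
        (use K m sX s' Dn in \<open>auto simp: s'_def\<close>)
    then obtain d where "d \<in> D" "\<forall>i. lin (s' i) d = lin (s' i) (ones_vec n)" by blast
    moreover from this(1) have "d \<in> carrier_vec n" using Dn by blast
    ultimately show ?thesis using s' ones_vec_carrier by (intro bexI[of _ d]) simp_all
  qed
  then show ?thesis by blast
qed

section \<open>Rewriting in commutative residuated lattices\<close>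

context comm_residuated_lattice
begin

lemma join_idem: "x \<in> carrier R \<Longrightarrow> rjoin R x x = x"
  by (metis join_meet_absorb meet_join_absorb join_closed)

lemma rle_refl: "x \<in> carrier R \<Longrightarrow> rle R x x"
  by (simp add: rle_def join_idem)

lemma rle_trans:
  "\<lbrakk>rle R x y; rle R y z; x \<in> carrier R; y \<in> carrier R; z \<in> carrier R\<rbrakk> \<Longrightarrow> rle R x z"
  unfolding rle_def by (metis join_assoc)

lemma rle_antisym: "\<lbrakk>rle R x y; rle R y x; x \<in> carrier R; y \<in> carrier R\<rbrakk> \<Longrightarrow> x = y"
  unfolding rle_def by (metis join_comm)

lemma rle_join1: "\<lbrakk>x \<in> carrier R; y \<in> carrier R\<rbrakk> \<Longrightarrow> rle R x (rjoin R x y)"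
  unfolding rle_def by (simp add: join_assoc[symmetric] join_idem)

lemma rle_join2: "\<lbrakk>x \<in> carrier R; y \<in> carrier R\<rbrakk> \<Longrightarrow> rle R y (rjoin R x y)"
  by (metis rle_join1 join_comm)

lemma join_least:
  "\<lbrakk>rle R x z; rle R y z; x \<in> carrier R; y \<in> carrier R; z \<in> carrier R\<rbrakk> \<Longrightarrow> rle R (rjoin R x y) z"
  unfolding rle_def by (simp add: join_assoc)

lemma rle_meet: "\<lbrakk>x \<in> carrier R; y \<in> carrier R\<rbrakk> \<Longrightarrow> rle R x y \<longleftrightarrow> rmeet R x y = x"
  unfolding rle_def by (metis join_comm meet_comm join_meet_absorb meet_join_absorb)

lemma meet_lower1: "\<lbrakk>x \<in> carrier R; y \<in> carrier R\<rbrakk> \<Longrightarrow> rle R (rmeet R x y) x"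
  unfolding rle_def by (metis join_comm meet_closed join_meet_absorb)

lemma meet_lower2: "\<lbrakk>x \<in> carrier R; y \<in> carrier R\<rbrakk> \<Longrightarrow> rle R (rmeet R x y) y"
  by (metis meet_comm meet_lower1)

lemma meet_greatest:
  "\<lbrakk>rle R z x; rle R z y; x \<in> carrier R; y \<in> carrier R; z \<in> carrier R\<rbrakk> \<Longrightarrow> rle R z (rmeet R x y)"
  by (simp add: rle_meet meet_closed meet_assoc[symmetric])

lemma mult_mono_left:
  assumes "rle R x y" "x \<in> carrier R" "y \<in> carrier R" "z \<in> carrier R"
  shows "rle R (x \<otimes> z) (y \<otimes> z)"
proof -
  have "rle R y (rdiv R (y \<otimes> z) z)"
    using assms by (subst residuation_rdiv[symmetric]) (auto intro: rle_refl)
  then have "rle R x (rdiv R (y \<otimes> z) z)"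
    using rle_trans[OF assms(1)] assms by (simp add: rdiv_closed)
  then show ?thesis using assms by (subst residuation_rdiv) auto
qed

lemma mult_mono_right:
  "\<lbrakk>rle R x y; x \<in> carrier R; y \<in> carrier R; z \<in> carrier R\<rbrakk> \<Longrightarrow> rle R (z \<otimes> x) (z \<otimes> y)"
  using mult_mono_left by (simp add: m_comm)

lemma mult_ldiv: "\<lbrakk>x \<in> carrier R; y \<in> carrier R\<rbrakk> \<Longrightarrow> rle R (x \<otimes> ldiv R x y) y"
  using residuation_ldiv[of x "ldiv R x y" y] by (simp add: ldiv_closed rle_refl)

lemma eval_power_trm:
  assumes "\<And>i. h i \<in> carrier R"
  shows "eval R h (power_trm t k) = eval R h t [^] k"
  using eval_closed[of h t, OF assms]
  by (induction k) (simp_all add: m_comm nat_pow_closed)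

lemma join_list_Cons: "ts \<noteq> [] \<Longrightarrow> join_list (t # ts) = Join t (join_list ts)"
  by (simp add: join_list_def)

lemma join_list_upper:
  assumes "\<And>i. h i \<in> carrier R"
  shows "t \<in> set ts \<Longrightarrow> rle R (eval R h t) (eval R h (join_list ts))"
proof (induction ts)
  case (Cons u us)
  have c: "eval R h s \<in> carrier R" for s using eval_closed assms by blast
  show ?case
  proof (cases "us = []")
    case True
    then show ?thesis using Cons.prems c by (simp add: join_list_def rle_refl)
  next
    case False
    have "rle R (eval R h (join_list us)) (eval R h (join_list (u # us)))"
      using c False by (simp add: join_list_Cons rle_join2)
    moreover have "rle R (eval R h u) (eval R h (join_list (u # us)))"
      using c False by (simp add: join_list_Cons rle_join1)
    ultimately show ?thesis using Cons c rle_trans by (metis set_ConsD)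
  qed
qed simp

lemma join_list_least:
  assumes h: "\<And>i. h i \<in> carrier R" and z: "z \<in> carrier R"
  shows "\<lbrakk>ts \<noteq> []; \<And>t. t \<in> set ts \<Longrightarrow> rle R (eval R h t) z\<rbrakk> \<Longrightarrow> rle R (eval R h (join_list ts)) z"
proof (induction ts)
  case (Cons u us)
  have c: "eval R h s \<in> carrier R" for s using eval_closed h by blast
  show ?case
  proof (cases "us = []")
    case True
    then show ?thesis using Cons.prems by (simp add: join_list_def)
  next
    case False
    then show ?thesis using Cons c z by (simp add: join_list_Cons join_least)
  qed
qed simp

lemma negative_pow_antimono:
  assumes t: "t \<in> carrier R" "rle R t \<one>"
  shows "rle R (t [^] (i + k :: nat)) (t [^] i)"
proof (induction k)
  case (Suc k)
  have "rle R (t [^] (i + k) \<otimes> t) (t [^] (i + k) \<otimes> \<one>)"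
    using t by (intro mult_mono_right) auto
  then have "rle R (t [^] (i + Suc k)) (t [^] (i + k))" using t by simp
  then show ?case using Suc t by (meson rle_trans nat_pow_closed)
qed (use t in \<open>simp add: rle_refl\<close>)

lemma eval_monomial_pow:
  assumes t: "t \<in> carrier R" and h: "\<And>i. h i = t [^] (a i :: nat)"
  shows "eval R h (monomial d) = t [^] (lin a d)"
proof -
  have hc: "h i \<in> carrier R" for i using t h by simp
  have "eval R h (foldr (\<lambda>i t. Mult (power_trm (Var i) (d $ i)) t) js One) = t [^] (\<Sum>i\<leftarrow>js. a i * d $ i)" for js
    using t by (induction js) (simp_all add: eval_power_trm[OF hc] h nat_pow_pow nat_pow_mult)
  then show ?thesis
    by (simp add: monomial_def lin_def interv_sum_list_conv_sum_set_nat lessThan_atLeast0)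
qed

end

text \<open>Valuing the variables at powers of \<open>t\<close> according to the substitution turns
  \<open>[D]\<close> into \<open>t^p \<le> \<Or> t^(p + c_j)\<close>, and \<open>t \<le> 1\<close>
  puts each joinand below \<open>t^(p + 1)\<close>. The exponent depends on \<open>D\<close> only,
  so it can be written into a term before the algebra is known.\<close>

lemma expansive_pow_le:
  assumes "expansive n D"
  shows "\<exists>p. \<forall>(R :: 'a rlat) t. comm_residuated_lattice R \<longrightarrow> (\<forall>e\<in>simple_eqns n D. satisfies R e) \<longrightarrow>
    t \<in> carrier R \<longrightarrow> rle R t (one R) \<longrightarrow> rle R (t [^]\<^bsub>R\<^esub> (p :: nat)) (t [^]\<^bsub>R\<^esub> (p + 1))"
proof -
  from assms obtain \<Sigma> p m and c :: "nat \<Rightarrow> nat" where S: "\<Sigma> \<in> carrier_mat 1 n"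
    and c: "\<forall>j\<in>{1..m}. c j \<ge> 1" and p: "\<Sigma> *\<^sub>v ones_vec n = vec 1 (\<lambda>_. p)"
    and im: "(\<lambda>d. \<Sigma> *\<^sub>v d) ` D = (\<lambda>j. vec 1 (\<lambda>_. p + c j)) ` {1..m}" and D: "simple n D"
    unfolding expansive_def by blast
  define a where "a i = (if i < n then \<Sigma> $$ (0, i) else 0)" for i
  have lin: "(\<Sigma> *\<^sub>v d) $ 0 = lin a d" if "d \<in> carrier_vec n" for d
    using S that by (auto simp: lin_def a_def scalar_prod_def lessThan_atLeast0 intro!: sum.cong)
  have Dn: "D \<subseteq> carrier_vec n" and "finite D" "D \<noteq> {}" using D by (auto simp: simple_def)
  obtain ds where ds: "distinct ds" "set ds = D" using finite_distinct_list[OF \<open>finite D\<close>] by blast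
  have la: "lin a d \<ge> p + 1" if d: "d \<in> D" for d
  proof -
    from d im obtain j where j: "j \<in> {1..m}" "\<Sigma> *\<^sub>v d = vec 1 (\<lambda>_. p + c j)" by blast
    have "(\<Sigma> *\<^sub>v d) $ 0 = p + c j" unfolding j(2) by simp
    then have "lin a d = p + c j" using lin d Dn by auto
    then show ?thesis using c j(1) by simp
  qed
  have "ones_vec n \<in> carrier_vec n" by (simp add: ones_vec_def)
  from lin[OF this] have lo: "lin a (ones_vec n) = p" unfolding p by simp
  show ?thesis
  proof (intro exI[of _ p] allI impI)
    fix R :: "'a rlat" and t
    assume "comm_residuated_lattice R" and sat: "\<forall>e\<in>simple_eqns n D. satisfies R e"
      and t: "t \<in> carrier R" "rle R t (one R)"
    then interpret comm_residuated_lattice R by simp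
    define h where "h i = t [^]\<^bsub>R\<^esub> a i" for i
    have h: "h i \<in> carrier R" for i using t by (simp add: h_def)
    have ev: "eval R h (monomial d) = t [^]\<^bsub>R\<^esub> lin a d" for d
      using eval_monomial_pow[OF t(1), of h a] h_def by simp
    let ?e = "Ineq (monomial (ones_vec n)) (join_list (map monomial ds))"
    let ?J = "eval R h (join_list (map monomial ds))"
    have "?e \<in> simple_eqns n D" using ds by (auto simp: simple_eqns_def)
    then have "satisfies R ?e" using sat by blast
    then have 1: "rle R (t [^]\<^bsub>R\<^esub> p) ?J"
    proof -
      have "eval R h (fst ?e) = eval R h (snd ?e)"
        using \<open>satisfies R ?e\<close> h unfolding satisfies_def by blast
      then show ?thesis by (simp add: Ineq_def rle_def ev lo)
    qed
    have 2: "rle R ?J (t [^]\<^bsub>R\<^esub> (p + 1))"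
    proof (rule join_list_least[OF h])
      fix s assume "s \<in> set (map monomial ds)"
      then obtain d where d: "d \<in> D" "s = monomial d" using ds by auto
      then show "rle R (eval R h s) (t [^]\<^bsub>R\<^esub> (p + 1))"
        using negative_pow_antimono[OF t, of "p + 1" "lin a d - (p + 1)"] la[OF d(1)] ev by simp
    qed (use t ds \<open>D \<noteq> {}\<close> in auto)
    show "rle R (t [^]\<^bsub>R\<^esub> p) (t [^]\<^bsub>R\<^esub> (p + 1))"
      by (rule rle_trans[OF 1 2]) (use t eval_closed h in auto)
  qed
qed

section \<open>And-branching rewriting on multisets of letters\<close>

type_synonym 'l arule = "'l list \<times> 'l list list"

inductive derivable :: "'l arule set \<Rightarrow> 'l \<Rightarrow> 'l multiset \<Rightarrow> bool" for P y where
  derivable_final: "derivable P y {#y#}"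
| derivable_step: "\<lbrakk>(u, vs) \<in> P; \<forall>v\<in>set vs. derivable P y (mset v + w)\<rbrakk> \<Longrightarrow> derivable P y (mset u + w)"

definition word_trm :: "'l :: countable list \<Rightarrow> trm" where
  "word_trm us = foldr (\<lambda>l. Mult (Var (to_nat l))) us One"

definition rule_trm :: "'l :: countable arule \<Rightarrow> trm" where
  "rule_trm r = LDiv (word_trm (fst r)) (join_list (map word_trm (snd r)))"

definition rules_trm :: "'l :: countable arule list \<Rightarrow> trm" where
  "rules_trm rs = foldr (\<lambda>r. Meet (rule_trm r)) rs One"

context comm_residuated_lattice
begin

lemma eval_word_append:
  assumes h: "\<And>i. h i \<in> carrier R"
  shows "eval R h (word_trm (us @ vs)) = eval R h (word_trm us) \<otimes> eval R h (word_trm vs)"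
proof -
  have c: "eval R h s \<in> carrier R" for s using eval_closed h by blast
  show ?thesis using c h by (induction us) (auto simp: word_trm_def m_assoc)
qed

lemma eval_word_mset:
  fixes us vs :: "'l :: countable list"
  assumes h: "\<And>i. h i \<in> carrier R"
  shows "mset us = mset vs \<Longrightarrow> eval R h (word_trm us) = eval R h (word_trm vs)"
proof (induction us arbitrary: vs)
  case (Cons u us)
  have c: "eval R h s \<in> carrier R" for s using eval_closed h by blast
  from Cons.prems have "u \<in> set vs" by (metis list.set_intros(1) set_mset_mset)
  then obtain xs ys where vs: "vs = xs @ u # ys" by (metis split_list)
  then have "mset us = mset (xs @ ys)" using Cons.prems by simp
  from Cons.IH[OF this] have us: "eval R h (word_trm us) = eval R h (word_trm xs) \<otimes> eval R h (word_trm ys)"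
    by (simp add: eval_word_append[OF h])
  have "eval R h (word_trm (x # zs)) = h (to_nat x) \<otimes> eval R h (word_trm zs)" for x :: 'l and zs by (simp add: word_trm_def)
  then show ?case using h c by (simp add: vs us eval_word_append[OF h] m_lcomm)
qed (simp add: word_trm_def)

lemma rules_trm_le:
  fixes rs :: "'l :: countable arule list"
  assumes h: "\<And>i. h i \<in> carrier R"
  shows "rle R (eval R h (rules_trm rs)) \<one>"
    and "r \<in> set rs \<Longrightarrow> rle R (eval R h (rules_trm rs)) (eval R h (rule_trm r))"
proof -
  have c: "eval R h s \<in> carrier R" for s using eval_closed h by blast
  have rules_Cons: "eval R h (rules_trm (r # rs)) = rmeet R (eval R h (rule_trm r)) (eval R h (rules_trm rs))" for r :: "'l arule" and rs
    by (simp add: rules_trm_def)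
  show "rle R (eval R h (rules_trm rs)) \<one>"
  proof (induction rs)
    case (Cons r rs)
    then show ?case unfolding rules_Cons using c by (meson meet_lower2 meet_closed rle_trans one_closed)
  qed (simp add: rules_trm_def rle_refl)
  show "r \<in> set rs \<Longrightarrow> rle R (eval R h (rules_trm rs)) (eval R h (rule_trm r))"
  proof (induction rs)
    case (Cons q rs)
    then show ?case unfolding rules_Cons using c
      by (metis meet_lower1 meet_lower2 meet_closed rle_trans set_ConsD)
  qed simp
qed

text \<open>The hypothesis \<open>p\<close> supplies a fresh copy of \<theta> for every step; the
  copy turns \<open>u\<close> into the join of the \<open>vs\<close>, and the power of \<theta>
  stays intact for the branches. At the final letter it is discarded, being below
  \<open>1\<close>.\<close>

lemma derivable_sound:
  fixes y :: "'l :: countable"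
  assumes h: "\<And>i. h i \<in> carrier R" and ne: "\<And>u. (u, []) \<notin> set rs"
    and p: "rle R (eval R h (rules_trm rs) [^] (p :: nat)) (eval R h (rules_trm rs) [^] (p + 1))"
  shows "derivable (set rs) y M \<Longrightarrow> mset us = M \<Longrightarrow>
    rle R (eval R h (rules_trm rs) [^] p \<otimes> eval R h (word_trm us)) (h (to_nat y))"
proof (induction arbitrary: us rule: derivable.induct)
  case derivable_final
  let ?t = "eval R h (rules_trm rs)"
  have c: "eval R h s \<in> carrier R" for s using eval_closed h by blast
  have us: "us = [y]" using derivable_final by (metis mset_single_iff_right)
  have "rle R (?t [^] p) (?t [^] (0 :: nat))"
    using negative_pow_antimono[OF c rules_trm_le(1)[OF h], where i = 0 and k = p] by simp
  then have "rle R (?t [^] p \<otimes> h (to_nat y)) (\<one> \<otimes> h (to_nat y))"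
    using h c by (intro mult_mono_left) auto
  then show ?case using h c us by (simp add: word_trm_def)
next
  case (derivable_step u vs w)
  let ?t = "eval R h (rules_trm rs)"
  have c: "eval R h s \<in> carrier R" for s using eval_closed h by blast
  obtain ws where ws: "mset ws = w" using ex_mset by blast
  have "mset us = mset (u @ ws)" using derivable_step.prems ws by simp
  then have us: "eval R h (word_trm us) = eval R h (word_trm u) \<otimes> eval R h (word_trm ws)"
    by (simp add: eval_word_mset[OF h, of us "u @ ws"] eval_word_append[OF h])
  define T U W J where "T = ?t [^] p" and "U = eval R h (word_trm u)" and "W = eval R h (word_trm ws)"
    and "J = eval R h (join_list (map word_trm vs))"
  have cc: "T \<in> carrier R" "U \<in> carrier R" "W \<in> carrier R" "J \<in> carrier R" "?t \<in> carrier R" "h (to_nat y) \<in> carrier R"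
    using c h by (auto simp: T_def U_def W_def J_def)
  have "rle R (U \<otimes> ?t) (U \<otimes> ldiv R U J)"
    using rules_trm_le(2)[OF h derivable_step.hyps(1)] cc ldiv_closed
    by (intro mult_mono_right) (auto simp: rule_trm_def U_def J_def)
  then have "rle R (U \<otimes> ?t) J" using mult_ldiv[of U J] cc by (meson rle_trans m_closed ldiv_closed)
  then have 1: "rle R ((U \<otimes> ?t) \<otimes> (T \<otimes> W)) (J \<otimes> (T \<otimes> W))"
    using cc by (intro mult_mono_left) auto
  have "vs \<noteq> []" using ne derivable_step.hyps(1) by blast
  \<comment> \<open>Bounding \<open>J\<close> by a residual treats the branches separately; this
    replaces distributivity of the product over the join.\<close>
  have 2: "rle R J (rdiv R (h (to_nat y)) (T \<otimes> W))"
    unfolding J_def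
  proof (rule join_list_least[OF h])
    fix s assume "s \<in> set (map word_trm vs)"
    then obtain v where v: "v \<in> set vs" "s = word_trm v" by auto
    have "rle R (T \<otimes> eval R h (word_trm (v @ ws))) (h (to_nat y))"
      unfolding T_def using derivable_step.IH v(1) ws by auto
    then have "rle R (eval R h s \<otimes> (T \<otimes> W)) (h (to_nat y))"
      using cc c by (simp add: v(2) eval_word_append[OF h] W_def[symmetric] m_lcomm)
    then show "rle R (eval R h s) (rdiv R (h (to_nat y)) (T \<otimes> W))"
      using cc c residuation_rdiv by auto
  qed (use cc rdiv_closed \<open>vs \<noteq> []\<close> in auto)
  then have 3: "rle R (J \<otimes> (T \<otimes> W)) (h (to_nat y))" using cc residuation_rdiv by auto
  have 4: "rle R (T \<otimes> (U \<otimes> W)) ((T \<otimes> ?t) \<otimes> (U \<otimes> W))"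
    using p cc by (intro mult_mono_left) (auto simp: T_def)
  have e: "(T \<otimes> ?t) \<otimes> (U \<otimes> W) = (U \<otimes> ?t) \<otimes> (T \<otimes> W)" using cc by (simp add: m_ac)
  have "rle R (T \<otimes> (U \<otimes> W)) (J \<otimes> (T \<otimes> W))"
    using rle_trans[OF 4[unfolded e] 1] cc by simp
  from rle_trans[OF this 3] have "rle R (T \<otimes> (U \<otimes> W)) (h (to_nat y))" using cc by simp
  then show ?case unfolding us T_def U_def W_def .
qed

end

section \<open>The algebra of a polarity\<close>

text \<open>In a commutative monoid the relation \<open>x + c \<in> S\<close> has the same polar on
  both sides, so a single operator serves as both halves of the Galois connection.\<close>

definition polar :: "'m :: comm_monoid_add set \<Rightarrow> 'm set \<Rightarrow> 'm set" where
  "polar S X = {c. \<forall>x\<in>X. x + c \<in> S}"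

definition clos :: "'m :: comm_monoid_add set \<Rightarrow> 'm set \<Rightarrow> 'm set" where
  "clos S X = polar S (polar S X)"

definition sumset :: "'m :: comm_monoid_add set \<Rightarrow> 'm set \<Rightarrow> 'm set" where
  "sumset X Y = {x + y | x y. x \<in> X \<and> y \<in> Y}"

definition resid :: "'m :: comm_monoid_add set \<Rightarrow> 'm set \<Rightarrow> 'm set" where
  "resid X Y = {z. \<forall>x\<in>X. x + z \<in> Y}"

text \<open>The image of the powerset of the monoid under the nucleus \<open>clos S\<close>:
  products and joins have to be closed up, intersections and residuals of closed sets are closed
  already.\<close>

definition polar_alg :: "'m :: comm_monoid_add set \<Rightarrow> 'm set rlat" where
  "polar_alg S = \<lparr>carrier = {X. clos S X = X}, mult = \<lambda>X Y. clos S (sumset X Y), one = clos S {0},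
     rjoin = \<lambda>X Y. clos S (X \<union> Y), rmeet = (\<inter>), ldiv = resid, rdiv = \<lambda>Y X. resid X Y\<rparr>"

lemma subset_clos: "X \<subseteq> clos S X"
  by (auto simp: clos_def polar_def add.commute)

lemma clos_mono: "X \<subseteq> Y \<Longrightarrow> clos S X \<subseteq> clos S Y"
  by (auto simp: clos_def polar_def)

lemma polar_clos: "polar S (clos S X) = polar S X"
proof (intro equalityI subsetI)
  fix c assume "c \<in> polar S (clos S X)"
  then show "c \<in> polar S X" using subset_clos[of X S] unfolding polar_def by blast
next
  fix c assume c: "c \<in> polar S X"
  have "x + c \<in> S" if "x \<in> clos S X" for x
  proof -
    have "c + x \<in> S" using c that by (simp add: clos_def polar_def[of S "polar S X"])
    then show ?thesis by (simp add: add.commute)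
  qed
  then show "c \<in> polar S (clos S X)" by (simp add: polar_def[of S "clos S X"])
qed

lemma clos_idem [simp]: "clos S (clos S X) = clos S X"
  by (simp add: clos_def[of S "clos S X"] polar_clos) (simp add: clos_def)

lemma clos_polar [simp]: "clos S (polar S X) = polar S X"
  using polar_clos[of S X] by (simp add: clos_def)

lemma clos_subset_iff: "clos S Y = Y \<Longrightarrow> clos S X \<subseteq> Y \<longleftrightarrow> X \<subseteq> Y"
  using subset_clos[of X S] clos_mono[of X Y S] by auto

lemma resid_closed:
  assumes "clos S Y = Y"
  shows "clos S (resid X Y) = resid X Y"
proof -
  have *: "x + z \<in> Y \<longleftrightarrow> (\<forall>p\<in>polar S Y. x + p + z \<in> S)" for x z
  proof -
    have "x + z \<in> Y \<longleftrightarrow> x + z \<in> polar S (polar S Y)" using assms by (simp add: clos_def)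
    also have "\<dots> \<longleftrightarrow> (\<forall>p\<in>polar S Y. x + p + z \<in> S)"
      unfolding polar_def[of S "polar S Y"] by (simp add: add.assoc add.left_commute)
    finally show ?thesis .
  qed
  have "resid X Y = {z. \<forall>x\<in>X. \<forall>p\<in>polar S Y. x + p + z \<in> S}" by (simp add: resid_def *)
  also have "\<dots> = polar S (sumset X (polar S Y))"
    by (subst polar_def[of S "sumset X (polar S Y)"]) (auto simp: sumset_def; blast)
  finally have "resid X Y = polar S (sumset X (polar S Y))" .
  then show ?thesis by simp
qed

lemma sumset_subset_iff: "sumset X Y \<subseteq> Z \<longleftrightarrow> Y \<subseteq> resid X Z"
  by (auto simp: sumset_def resid_def)

lemma sumset_comm: "sumset X Y = sumset Y X"
  unfolding sumset_def by (intro Collect_cong) (metis add.commute)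

lemma sumset_assoc: "sumset (sumset X Y) Z = sumset X (sumset Y Z)"
  unfolding sumset_def by (auto simp: add.assoc) (metis add.assoc)+

lemma sumset_left_commute: "sumset X (sumset Y Z) = sumset Y (sumset X Z)"
  by (metis sumset_assoc sumset_comm)

lemma sumset_zero [simp]: "sumset {0} X = X"
  by (auto simp: sumset_def)

lemma sumset_zero_right [simp]: "sumset X {0} = X"
  by (auto simp: sumset_def)

text \<open>That \<open>clos S\<close> is a nucleus: moving \<open>X\<close> across by residuation
  leaves \<open>Y\<close> below a closed set, which then contains the closure of
  \<open>Y\<close>.\<close>

lemma clos_sumset_right [simp]: "clos S (sumset X (clos S Y)) = clos S (sumset X Y)"
proof
  have "sumset X Y \<subseteq> clos S (sumset X Y)" by (rule subset_clos)
  then have "Y \<subseteq> resid X (clos S (sumset X Y))" by (simp add: sumset_subset_iff)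
  then have "clos S Y \<subseteq> resid X (clos S (sumset X Y))"
    by (simp add: clos_subset_iff resid_closed)
  then show "clos S (sumset X (clos S Y)) \<subseteq> clos S (sumset X Y)"
    by (simp add: clos_subset_iff sumset_subset_iff)
  show "clos S (sumset X Y) \<subseteq> clos S (sumset X (clos S Y))"
    using subset_clos[of Y S] by (intro clos_mono) (auto simp: sumset_def)
qed

lemma clos_sumset_left [simp]: "clos S (sumset (clos S X) Y) = clos S (sumset X Y)"
  using clos_sumset_right[of S Y X] by (simp add: sumset_comm)

lemma clos_un_right [simp]: "clos S (X \<union> clos S Y) = clos S (X \<union> Y)"
proof
  have "Y \<subseteq> clos S (X \<union> Y)" "X \<subseteq> clos S (X \<union> Y)" using subset_clos[of "X \<union> Y" S] by auto
  then have "X \<union> clos S Y \<subseteq> clos S (X \<union> Y)" by (simp add: clos_subset_iff)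
  then show "clos S (X \<union> clos S Y) \<subseteq> clos S (X \<union> Y)" by (simp add: clos_subset_iff)
  show "clos S (X \<union> Y) \<subseteq> clos S (X \<union> clos S Y)"
    using subset_clos[of Y S] by (intro clos_mono) auto
qed

lemma clos_inter: "\<lbrakk>clos S X = X; clos S Y = Y\<rbrakk> \<Longrightarrow> clos S (X \<inter> Y) = X \<inter> Y"
  using clos_mono[of "X \<inter> Y" X S] clos_mono[of "X \<inter> Y" Y S] subset_clos[of "X \<inter> Y" S] by auto

lemma carrier_polar_alg: "X \<in> carrier (polar_alg S) \<longleftrightarrow> clos S X = X"
  by (simp add: polar_alg_def)

lemma rle_polar_alg: "Y \<in> carrier (polar_alg S) \<Longrightarrow> rle (polar_alg S) X Y \<longleftrightarrow> X \<subseteq> Y"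
  using subset_clos[of "X \<union> Y" S]
  by (auto simp: rle_def polar_alg_def sup.absorb2)

lemma polar_alg_CRL: "comm_residuated_lattice (polar_alg S)"
proof unfold_locales
  fix x y z assume c: "x \<in> carrier (polar_alg S)" "y \<in> carrier (polar_alg S)" "z \<in> carrier (polar_alg S)"
  have r: "resid y z \<in> carrier (polar_alg S)" "resid x z \<in> carrier (polar_alg S)"
    using c by (simp_all add: carrier_polar_alg resid_closed)
  have "mult (polar_alg S) x y = clos S (sumset x y)" "rdiv (polar_alg S) z y = resid y z"
    "ldiv (polar_alg S) x z = resid x z" by (simp_all add: polar_alg_def)
  then show "rle (polar_alg S) (mult (polar_alg S) x y) z \<longleftrightarrow> rle (polar_alg S) x (rdiv (polar_alg S) z y)"
    "rle (polar_alg S) (mult (polar_alg S) x y) z \<longleftrightarrow> rle (polar_alg S) y (ldiv (polar_alg S) x z)"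
    using c r by (simp_all add: rle_polar_alg carrier_polar_alg clos_subset_iff
        sumset_subset_iff[of y x z, symmetric] sumset_subset_iff[of x y z, symmetric] sumset_comm[of y x])
next
  fix x y assume c: "x \<in> carrier (polar_alg S)" "y \<in> carrier (polar_alg S)"
  then show "rjoin (polar_alg S) x (rmeet (polar_alg S) x y) = x"
    by (simp add: polar_alg_def sup.absorb1)
  show "rmeet (polar_alg S) x (rjoin (polar_alg S) x y) = x"
    using c subset_clos[of "x \<union> y" S] by (auto simp: polar_alg_def)
qed (simp_all add: polar_alg_def sumset_assoc resid_closed clos_inter Un_assoc Un_commute Int_assoc
       Int_commute sumset_comm sumset_left_commute Un_left_commute Int_left_commute)

section \<open>Simple equations in the algebra of a polarity\<close>

definition resp_simple :: "'l multiset set \<Rightarrow> nat \<Rightarrow> nat vec set \<Rightarrow> bool" where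
  "resp_simple S n D \<longleftrightarrow> (\<forall>w x. (\<forall>d\<in>D. w + (\<Sum>j<n. repeat_mset (d $ j) (x j)) \<in> S) \<longrightarrow>
     w + (\<Sum>j<n. x j) \<in> S)"

context
  fixes S :: "'l multiset set" and h :: "nat \<Rightarrow> 'l multiset set"
  assumes h: "\<And>i. h i \<in> carrier (polar_alg S)"
begin

interpretation comm_residuated_lattice "polar_alg S" by (rule polar_alg_CRL)

lemma eval_Mult_polar:
  "eval (polar_alg S) h (Mult s t) = clos S (sumset (eval (polar_alg S) h s) (eval (polar_alg S) h t))"
  by (simp add: polar_alg_def)

lemma eval_Mult_memI:
  "\<lbrakk>a \<in> eval (polar_alg S) h s; b \<in> eval (polar_alg S) h t\<rbrakk> \<Longrightarrow> a + b \<in> eval (polar_alg S) h (Mult s t)"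
  unfolding eval_Mult_polar
  using subset_clos[of "sumset (eval (polar_alg S) h s) (eval (polar_alg S) h t)" S]
  by (auto simp: sumset_def)

lemma zero_mem_One: "{#} \<in> eval (polar_alg S) h One"
  using subset_clos[of "{{#}}" S] by (simp add: polar_alg_def)

lemma eval_power_memI:
  "a \<in> eval (polar_alg S) h t \<Longrightarrow> repeat_mset k a \<in> eval (polar_alg S) h (power_trm t k)"
  using zero_mem_One by (induction k) (auto intro: eval_Mult_memI simp del: eval.simps)

lemma eval_monomial_memI:
  assumes "\<And>i. i < dim_vec d \<Longrightarrow> x i \<in> h i"
  shows "(\<Sum>j<dim_vec d. repeat_mset (d $ j) (x j)) \<in> eval (polar_alg S) h (monomial d)"
proof -
  have "(\<Sum>j\<leftarrow>js. repeat_mset (d $ j) (x j))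
      \<in> eval (polar_alg S) h (foldr (\<lambda>i. Mult (power_trm (Var i) (d $ i))) js One)"
    if "set js \<subseteq> {..<dim_vec d}" for js
    using that
  proof (induction js)
    case (Cons j js)
    have "repeat_mset (d $ j) (x j) \<in> eval (polar_alg S) h (power_trm (Var j) (d $ j))"
      using assms Cons.prems by (intro eval_power_memI) simp
    then show ?case using Cons by (simp add: eval_Mult_memI del: eval.simps)
  qed (use zero_mem_One in simp)
  from this[of "[0..<dim_vec d]"] show ?thesis
    by (simp add: monomial_def interv_sum_list_conv_sum_set_nat lessThan_atLeast0)
qed

text \<open>Residuation peels off one factor at a time: the remaining product has to lie in
  \<open>resid (h j) T\<close>, again a closed set. Hence sums of representatives, one from each
  \<open>h i\<close>, suffice.\<close>

lemma eval_monomial_ones_subset: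
  assumes T: "clos S T = T" and x: "\<And>x. (\<And>i. i < n \<Longrightarrow> x i \<in> h i) \<Longrightarrow> (\<Sum>j<n. x j) \<in> T"
  shows "eval (polar_alg S) h (monomial (ones_vec n)) \<subseteq> T"
proof -
  have "eval (polar_alg S) h (foldr (\<lambda>i. Mult (power_trm (Var i) 1)) js One) \<subseteq> T"
    if "clos S T = T" "distinct js" "\<And>x. (\<And>i. i \<in> set js \<Longrightarrow> x i \<in> h i) \<Longrightarrow> (\<Sum>j\<leftarrow>js. x j) \<in> T" for js T
    using that
  proof (induction js arbitrary: T)
    case Nil
    then show ?case using Nil(3)[of undefined] by (simp add: polar_alg_def clos_subset_iff)
  next
    case (Cons j js)
    define F where "F = eval (polar_alg S) h (foldr (\<lambda>i. Mult (power_trm (Var i) 1)) js One)"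
    have 1: "eval (polar_alg S) h (power_trm (Var j) 1) = h j" using h r_one by simp
    have "F \<subseteq> resid (h j) T"
      unfolding F_def
    proof (rule Cons.IH)
      fix x assume x: "\<And>i. i \<in> set js \<Longrightarrow> x i \<in> h i"
      have "a + (\<Sum>j\<leftarrow>js. x j) \<in> T" if "a \<in> h j" for a
      proof -
        have "(\<Sum>i\<leftarrow>j # js. (x(j := a)) i) \<in> T" using x that by (intro Cons.prems(3)) auto
        moreover have "(\<Sum>i\<leftarrow>js. (x(j := a)) i) = (\<Sum>i\<leftarrow>js. x i)"
          using Cons.prems(2) by (intro arg_cong[where f = sum_list] map_cong) auto
        ultimately show ?thesis by simp
      qed
      then show "(\<Sum>j\<leftarrow>js. x j) \<in> resid (h j) T" by (simp add: resid_def)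
    qed (use Cons.prems in \<open>simp_all add: resid_closed\<close>)
    then have "clos S (sumset (h j) F) \<subseteq> T" using Cons.prems(1) by (simp add: clos_subset_iff sumset_subset_iff)
    then show ?case unfolding F_def foldr.simps comp_def eval_Mult_polar 1 .
  qed
  moreover have "foldr (\<lambda>i. Mult (power_trm (Var i) (ones_vec n $ i))) [0..<n] One
      = foldr (\<lambda>i. Mult (power_trm (Var i) 1)) [0..<n] One"
    by (intro foldr_cong) (auto simp: ones_vec_def)
  moreover have "(\<Sum>j\<leftarrow>[0..<n]. x j) \<in> T" if "\<And>i. i \<in> set [0..<n] \<Longrightarrow> x i \<in> h i" for x
    using x[of x] that by (simp add: interv_sum_list_conv_sum_set_nat lessThan_atLeast0)
  ultimately show ?thesis using T by (simp add: monomial_def ones_vec_def[THEN arg_cong[where f = dim_vec]])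
qed

end

text \<open>The left-hand side contains each variable once, so one word \<open>x i\<close> per
  variable represents it, and the same words, repeated, lie in the values of the right-hand
  monomials. A context in the polar of the right-hand value accepts all of these, hence also the
  left-hand word.\<close>

lemma polar_alg_satisfies_simple:
  assumes D: "simple n D" and S: "resp_simple S n D" and e: "e \<in> simple_eqns n D"
  shows "satisfies (polar_alg S) e"
  unfolding satisfies_def
proof (intro allI impI)
  interpret comm_residuated_lattice "polar_alg S" by (rule polar_alg_CRL)
  fix h :: "nat \<Rightarrow> 'a multiset set" assume h: "\<forall>i. h i \<in> carrier (polar_alg S)"
  note h' = h[rule_format]
  from e obtain ds where ds: "set ds = D" "e = Ineq (monomial (ones_vec n)) (join_list (map monomial ds))"
    by (auto simp: simple_eqns_def)
  define T where "T = eval (polar_alg S) h (join_list (map monomial ds))"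
  have T: "T \<in> carrier (polar_alg S)" unfolding T_def by (rule eval_closed[of h, OF h'])
  have "eval (polar_alg S) h (monomial (ones_vec n)) \<subseteq> T"
  proof (rule eval_monomial_ones_subset[of h S, OF h'])
    show cT: "clos S T = T" using T carrier_polar_alg by blast
    fix x assume x: "\<And>i. i < n \<Longrightarrow> x i \<in> h i"
    have "(\<Sum>j<n. x j) + c \<in> S" if c: "c \<in> polar S T" for c
    proof -
      have "c + (\<Sum>j<n. repeat_mset (d $ j) (x j)) \<in> S" if d: "d \<in> D" for d
      proof -
        have dim: "dim_vec d = n" using d D by (auto simp: simple_def)
        have "(\<Sum>j<n. repeat_mset (d $ j) (x j)) \<in> eval (polar_alg S) h (monomial d)"
          using eval_monomial_memI[of h S, OF h', of d x] x dim by simp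
        moreover have "eval (polar_alg S) h (monomial d) \<subseteq> T"
          using join_list_upper[of h, OF h', of "monomial d" "map monomial ds"] d ds(1) rle_polar_alg[OF T]
          by (auto simp: T_def)
        ultimately show ?thesis using c by (auto simp: polar_def add.commute)
      qed
      then have "c + (\<Sum>j<n. x j) \<in> S" using S unfolding resp_simple_def by blast
      then show ?thesis by (simp add: add.commute)
    qed
    then have "(\<Sum>j<n. x j) \<in> clos S T" by (simp add: clos_def polar_def add.commute)
    then show "(\<Sum>j<n. x j) \<in> T" using cT by simp
  qed
  then show "eval (polar_alg S) h (fst e) = eval (polar_alg S) h (snd e)"
    using rle_polar_alg[OF T, of "eval (polar_alg S) h (monomial (ones_vec n))"]
    by (simp add: ds(2) Ineq_def rle_def T_def)
qed

section \<open>Recursive functions by counter operations\<close>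

text \<open>A formula describes a set of valuations of registers. \<open>Inc i \<phi>\<close> and \<open>Dec i \<phi>\<close> evaluate \<open>\<phi>\<close> after changing
  register \<open>i\<close>. \<open>Cal p ins out b\<close> states that \<open>p\<close> maps the registers \<open>ins\<close> to the register \<open>out\<close>, with the
  registers from \<open>b\<close> on as scratch space. In \<open>PLoop\<close> the registers \<open>b\<close>, \<open>b + 1\<close>, \<open>b + 2\<close>, \<open>b + 3\<close> hold the
  recursion index, the current value, the next value and the number of iterations left; in \<open>MLoop\<close> the
  registers \<open>b\<close>, \<open>b + 1\<close>, \<open>b + 2\<close> hold the index, the value at it and the number of iterations left.\<close>

datatype fm =
    Zr nat
  | Inc nat fm
  | Dec nat fm
  | Con fm fm
  | Dis fm fm
  | Exi nat fm
  | Equ nat nat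
  | Bot
  | Cal recf "nat list" nat nat
  | PLoop recf "nat list" nat nat
  | MLoop recf "nat list" nat

text \<open>The formula checks a guessed output instead of producing it; \<open>Exi\<close> guesses
  intermediate values. For \<open>RMin\<close> the output itself serves as the argument at which
  \<open>f\<close> is \<open>0\<close>, and the loop runs over all smaller arguments.\<close>

primrec body :: "recf \<Rightarrow> nat list \<Rightarrow> nat \<Rightarrow> nat \<Rightarrow> fm" where
  "body RZero ins out b = Zr out"
| "body RSucc ins out b = (case ins of [i] \<Rightarrow> Dec out (Equ i out) | _ \<Rightarrow> Bot)"
| "body (RProj k) ins out b = (if k < length ins then Equ (ins ! k) out else Bot)"
| "body (RComp f gs) ins out b = (let k = length gs in
     foldr Exi [b..<b + k] (foldr (\<lambda>(g, z). Con (Cal g ins z (b + k))) (zip gs [b..<b + k])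
       (Cal f [b..<b + k] out (b + k))))"
| "body (RPrim f g) ins out b = (case ins of [] \<Rightarrow> Bot | i # js \<Rightarrow>
     Exi b (Con (Zr b) (Exi (b + 1) (Con (Cal f js (b + 1) (b + 4))
       (Exi (b + 3) (Con (Equ (b + 3) i) (PLoop g js out b)))))))"
| "body (RMin f) ins out b =
     Con (Exi b (Con (Zr b) (Cal f (out # ins) b (b + 1))))
       (Exi b (Con (Zr b) (Exi (b + 2) (Con (Equ (b + 2) out) (MLoop f ins b)))))"

text \<open>Only \<open>Zr\<close>, \<open>Inc\<close>, \<open>Dec\<close> and \<open>Con\<close>
  are primitive; everything else is a choice among finitely many formulas. \<open>Exi\<close>
  reaches each value in unit steps, \<open>Equ\<close> counts both registers down together, a loop
  unfolds one iteration.\<close>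

fun alts :: "fm \<Rightarrow> fm list" where
  "alts (Dis \<phi> \<psi>) = [\<phi>, \<psi>]"
| "alts (Exi i \<phi>) = [\<phi>, Inc i (Exi i \<phi>), Dec i (Exi i \<phi>)]"
| "alts (Equ i j) = [Con (Zr i) (Zr j), Dec i (Dec j (Equ i j))]"
| "alts (Cal p ins out b) = [body p ins out b]"
| "alts (PLoop g js out b) = [Dis (Con (Zr (b + 3)) (Equ (b + 1) out))
     (Exi (b + 2) (Con (Cal g (b # (b + 1) # js) (b + 2) (b + 4))
       (Exi (b + 1) (Con (Equ (b + 1) (b + 2)) (Inc b (Dec (b + 3) (PLoop g js out b)))))))]"
| "alts (MLoop f ins b) = [Dis (Zr (b + 2))
     (Exi (b + 1) (Inc (b + 1) (Con (Cal f (b # ins) (b + 1) (b + 3))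
       (Inc b (Dec (b + 2) (MLoop f ins b))))))]"
| "alts _ = []"

text \<open>A least fixed point: an unfolding that goes on forever proves nothing, just as a machine
  that does not stop does not accept.\<close>

inductive holds :: "fm \<Rightarrow> (nat \<Rightarrow> nat) \<Rightarrow> bool" where
  holds_Zr: "x i = 0 \<Longrightarrow> holds (Zr i) x"
| holds_Inc: "holds \<phi> (x(i := Suc (x i))) \<Longrightarrow> holds (Inc i \<phi>) x"
| holds_Dec: "x i = Suc n \<Longrightarrow> holds \<phi> (x(i := n)) \<Longrightarrow> holds (Dec i \<phi>) x"
| holds_Con: "holds \<phi> x \<Longrightarrow> holds \<psi> x \<Longrightarrow> holds (Con \<phi> \<psi>) x"
| holds_alt: "\<psi> \<in> set (alts \<phi>) \<Longrightarrow> holds \<psi> x \<Longrightarrow> holds \<phi> x"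

lemma holds_Zr_iff [simp]: "holds (Zr i) x \<longleftrightarrow> x i = 0"
  by (auto elim: holds.cases intro: holds_Zr)

lemma holds_Inc_iff [simp]: "holds (Inc i \<phi>) x \<longleftrightarrow> holds \<phi> (x(i := Suc (x i)))"
  by (auto elim: holds.cases intro: holds_Inc)

lemma holds_Dec_iff [simp]: "holds (Dec i \<phi>) x \<longleftrightarrow> (\<exists>n. x i = Suc n \<and> holds \<phi> (x(i := n)))"
  by (auto elim: holds.cases intro: holds_Dec)

lemma holds_Con_iff [simp]: "holds (Con \<phi> \<psi>) x \<longleftrightarrow> holds \<phi> x \<and> holds \<psi> x"
  by (auto elim: holds.cases intro: holds_Con)

lemma holds_Bot_iff [simp]: "\<not> holds Bot x"
  by (auto elim: holds.cases)

lemma holds_alts: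
  assumes "alts \<phi> \<noteq> []"
  shows "holds \<phi> x \<longleftrightarrow> (\<exists>\<psi>\<in>set (alts \<phi>). holds \<psi> x)"
proof
  assume "holds \<phi> x"
  then show "\<exists>\<psi>\<in>set (alts \<phi>). holds \<psi> x" by cases (use assms in auto)
qed (auto intro: holds_alt)

lemma holds_Dis_iff [simp]: "holds (Dis \<phi> \<psi>) x \<longleftrightarrow> holds \<phi> x \<or> holds \<psi> x"
  by (subst holds_alts) auto

text \<open>Before \<open>\<phi>\<close> is reached only register \<open>i\<close> changes.
  Conversely, unit steps lead from \<open>x i\<close> down to \<open>0\<close> and from there up to
  any witness.\<close>

lemma holds_Exi_iff [simp]: "holds (Exi i \<phi>) x \<longleftrightarrow> (\<exists>v. holds \<phi> (x(i := v)))"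
proof
  have "\<theta> = Exi i \<phi> \<or> \<theta> = Inc i (Exi i \<phi>) \<or> \<theta> = Dec i (Exi i \<phi>) \<Longrightarrow> \<exists>v. holds \<phi> (x(i := v))"
    if "holds \<theta> x" for \<theta>
    using that
  proof induction
    case (holds_alt \<psi> \<theta> x)
    then have "\<theta> = Exi i \<phi>" by auto
    then have "\<psi> = \<phi> \<or> \<psi> = Inc i (Exi i \<phi>) \<or> \<psi> = Dec i (Exi i \<phi>)"
      using holds_alt.hyps(1) by simp
    moreover have "holds \<psi> (x(i := x i))" using holds_alt.hyps(2) by simp
    ultimately show ?case using holds_alt.IH by blast
  qed auto
  then show "holds (Exi i \<phi>) x \<Longrightarrow> \<exists>v. holds \<phi> (x(i := v))" by blast
next
  have down: "holds (Exi i \<phi>) y \<Longrightarrow> holds (Exi i \<phi>) (y(i := Suc (y i)))" for y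
    by (rule holds_alt[of "Dec i (Exi i \<phi>)"]) auto
  have up: "holds (Exi i \<phi>) (y(i := Suc (y i))) \<Longrightarrow> holds (Exi i \<phi>) y" for y
    by (rule holds_alt[of "Inc i (Exi i \<phi>)"]) auto
  assume "\<exists>v. holds \<phi> (x(i := v))"
  then obtain v where "holds \<phi> (x(i := v))" by blast
  then have "holds (Exi i \<phi>) (x(i := v))" by (rule holds_alt[rotated]) simp
  then have "holds (Exi i \<phi>) (x(i := 0))"
  proof (induction v)
    case (Suc v)
    have "(x(i := v))(i := Suc ((x(i := v)) i)) = x(i := Suc v)" by simp
    with up[of "x(i := v)"] Suc show ?case by metis
  qed
  then have "holds (Exi i \<phi>) (x(i := w))" for w
  proof (induction w)
    case (Suc w)
    have "(x(i := w))(i := Suc ((x(i := w)) i)) = x(i := Suc w)" by simp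
    with down[of "x(i := w)"] Suc show ?case by metis
  qed
  from this[of "x i"] show "holds (Exi i \<phi>) x" by simp
qed

lemma holds_Equ_iff [simp]: "i \<noteq> j \<Longrightarrow> holds (Equ i j) x \<longleftrightarrow> x i = x j"
proof (induction "x i" arbitrary: x)
  case 0
  then show ?case by (subst holds_alts) auto
next
  case (Suc n)
  then have h: "holds (Equ i j) (x(i := n, j := m)) \<longleftrightarrow> n = m" for m
    by (subst Suc.hyps(1)) auto
  show ?case using Suc.prems by (subst holds_alts) (auto simp: Suc.hyps(2)[symmetric] h)
qed

lemma holds_Cal_iff: "holds (Cal p ins out b) x \<longleftrightarrow> holds (body p ins out b) x"
  by (subst holds_alts) auto

definition upds :: "(nat \<Rightarrow> nat) \<Rightarrow> nat \<Rightarrow> nat list \<Rightarrow> nat \<Rightarrow> nat" where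
  "upds x b zs r = (if b \<le> r \<and> r < b + length zs then zs ! (r - b) else x r)"

lemma holds_foldr_Exi_iff:
  "holds (foldr Exi [b..<b + k] \<phi>) x \<longleftrightarrow> (\<exists>zs. length zs = k \<and> holds \<phi> (upds x b zs))"
proof (induction k arbitrary: b x)
  case 0
  have "upds x b [] = x" by (auto simp: upds_def)
  then show ?case by simp
next
  case (Suc k)
  have *: "[b..<b + Suc k] = b # [Suc b..<Suc b + k]" by (simp add: upt_rec)
  have u: "upds (x(b := v)) (Suc b) zs = upds x b (v # zs)" for v zs
    by (auto simp: upds_def fun_eq_iff nth_Cons diff_Suc split: nat.splits)
  have "holds (foldr Exi [b..<b + Suc k] \<phi>) x
      \<longleftrightarrow> (\<exists>v zs. length zs = k \<and> holds \<phi> (upds x b (v # zs)))"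
    unfolding * foldr.simps o_apply holds_Exi_iff Suc u by blast
  also have "\<dots> \<longleftrightarrow> (\<exists>zs. length zs = Suc k \<and> holds \<phi> (upds x b zs))"
    by (auto simp: length_Suc_conv)
  finally show ?case .
qed

lemma holds_foldr_Con_iff:
  "holds (foldr (\<lambda>a. Con (F a)) as \<phi>) x \<longleftrightarrow> (\<forall>a\<in>set as. holds (F a) x) \<and> holds \<phi> x"
  by (induction as) auto

section \<open>Correctness of the loops and of program calls\<close>

primrec steps :: "recf \<Rightarrow> nat list \<Rightarrow> nat \<Rightarrow> nat \<Rightarrow> nat \<Rightarrow> nat \<Rightarrow> bool" where
  "steps g xs 0 c z y \<longleftrightarrow> z = y"
| "steps g xs (Suc k) c z y \<longleftrightarrow> (\<exists>z'. computes g (c # z # xs) z' \<and> steps g xs k (Suc c) z' y)"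

text \<open>\<open>RPrim\<close> recurses from the last iteration backwards, \<open>PLoop\<close>
  runs forwards; splitting off the last iteration reconciles the two.\<close>

lemma steps_snoc:
  "steps g xs (Suc k) c z y \<longleftrightarrow> (\<exists>w. steps g xs k c z w \<and> computes g ((c + k) # w # xs) y)"
proof (induction k arbitrary: c z)
  case (Suc k)
  have "steps g xs (Suc (Suc k)) c z y
      \<longleftrightarrow> (\<exists>z'. computes g (c # z # xs) z' \<and> steps g xs (Suc k) (Suc c) z' y)"
    by (rule steps.simps(2))
  also have "\<dots> \<longleftrightarrow> (\<exists>w. steps g xs (Suc k) c z w \<and> computes g ((c + Suc k) # w # xs) y)"
    unfolding Suc.IH by auto
  finally show ?case .
qed simp

lemma computes_RPrim_iff:
  "computes (RPrim f g) (n # xs) y \<longleftrightarrow> (\<exists>z. computes f xs z \<and> steps g xs n 0 z y)"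
proof (induction n arbitrary: y)
  case 0
  then show ?case by (auto elim: computes_elims intro: computes.intros)
next
  case (Suc n)
  have "computes (RPrim f g) (Suc n # xs) y
      \<longleftrightarrow> (\<exists>w. computes (RPrim f g) (n # xs) w \<and> computes g (n # w # xs) y)"
    by (auto elim: computes_elims intro: computes.intros)
  also have "\<dots> \<longleftrightarrow> (\<exists>z. computes f xs z \<and> steps g xs (Suc n) 0 z y)"
    unfolding Suc steps_snoc by auto
  finally show ?case .
qed

lemma holds_PLoop:
  assumes g: "\<And>ins out b x. \<lbrakk>set ins \<subseteq> {..<b}; out < b; out \<notin> set ins\<rbrakk> \<Longrightarrow>
      holds (Cal g ins out b) x \<longleftrightarrow> computes g (map x ins) (x out)"
    and js: "set js \<subseteq> {..<b}" and out: "out < b"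
  shows "holds (PLoop g js out b) x \<longleftrightarrow> steps g (map x js) (x (b + 3)) (x b) (x (b + 1)) (x out)"
proof (induction "x (b + 3)" arbitrary: x)
  case 0
  then show ?case using out by (subst holds_alts) auto
next
  case (Suc k)
  have ns: "r \<notin> set js" if "r \<ge> b" for r using js that by auto
  have le: "set js \<subseteq> {..<c}" if "c \<ge> b" for c using js that by auto
  have m: "map (x(b := u, Suc b := v, Suc (Suc b) := v', b + 3 := w)) js = map x js" for u v v' w
    by (simp add: ns)
  have c: "holds (Cal g (b # Suc b # js) (Suc (Suc b)) (b + 4)) (x(Suc (Suc b) := v))
      \<longleftrightarrow> computes g (x b # x (Suc b) # map x js) v" for v
    by (subst g) (simp_all add: ns le)
  have IH: "holds (PLoop g js out b) (x(b := Suc (x b), Suc b := v, Suc (Suc b) := v, b + 3 := k))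
      \<longleftrightarrow> steps g (map x js) k (Suc (x b)) v (x out)" for v
    using Suc.hyps(1)[of "x(b := Suc (x b), Suc b := v, Suc (Suc b) := v, b + 3 := k)"] out m by simp
  have tw: "x(Suc (Suc b) := v, Suc b := v, b := Suc (x b), b + 3 := k) =
      x(b := Suc (x b), Suc b := v, Suc (Suc b) := v, b + 3 := k)" for v
    by (auto simp: fun_eq_iff)
  show ?case unfolding Suc.hyps(2)[symmetric] steps.simps
    using out by (subst holds_alts) (auto simp: c IH tw Suc.hyps(2)[symmetric])
qed

lemma holds_MLoop:
  assumes f: "\<And>ins out b x. \<lbrakk>set ins \<subseteq> {..<b}; out < b; out \<notin> set ins\<rbrakk> \<Longrightarrow>
      holds (Cal f ins out b) x \<longleftrightarrow> computes f (map x ins) (x out)"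
    and ins: "set ins \<subseteq> {..<b}"
  shows "holds (MLoop f ins b) x \<longleftrightarrow>
    (\<forall>m. x b \<le> m \<and> m < x b + x (b + 2) \<longrightarrow> (\<exists>z. computes f (m # map x ins) (Suc z)))"
proof (induction "x (b + 2)" arbitrary: x)
  case 0
  then show ?case by (subst holds_alts) auto
next
  case (Suc k)
  have ns: "r \<notin> set ins" if "r \<ge> b" for r using ins that by auto
  have le: "set ins \<subseteq> {..<c}" if "c \<ge> b" for c using ins that by auto
  have c: "holds (Cal f (b # ins) (Suc b) (b + 3)) (x(Suc b := Suc v))
      \<longleftrightarrow> computes f (x b # map x ins) (Suc v)" for v
    by (subst f) (simp_all add: ns le)
  have IH: "holds (MLoop f ins b) (x(Suc b := Suc v, b := Suc (x b), Suc (Suc b) := k)) \<longleftrightarrow>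
      (\<forall>m. Suc (x b) \<le> m \<and> m < Suc (x b) + k \<longrightarrow> (\<exists>z. computes f (m # map x ins) (Suc z)))" for v
  proof -
    have m: "map (x(Suc b := Suc v, b := Suc (x b), Suc (Suc b) := k)) ins = map x ins"
      by (simp add: ns)
    show ?thesis
      using Suc.hyps(1)[of "x(Suc b := Suc v, b := Suc (x b), Suc (Suc b) := k)"] by (simp add: m)
  qed
  have split: "(\<forall>m. x b \<le> m \<and> m < x b + Suc k \<longrightarrow> P m) \<longleftrightarrow>
      P (x b) \<and> (\<forall>m. Suc (x b) \<le> m \<and> m < Suc (x b) + k \<longrightarrow> P m)" for P
    by (auto simp: le_less_Suc_eq Suc_le_eq dest: le_neq_implies_less) 
  have x2: "x (Suc (Suc b)) = Suc k" using Suc.hyps(2) by simp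
  show ?case unfolding Suc.hyps(2)[symmetric] split
    by (subst holds_alts) (auto simp: c IH x2)
qed

text \<open>Induction on the program. The side conditions keep inputs, output and scratch space
  apart, so guessing in scratch registers alters neither arguments nor result.\<close>

lemma holds_Cal:
  "\<lbrakk>set ins \<subseteq> {..<b}; out < b; out \<notin> set ins\<rbrakk> \<Longrightarrow>
    holds (Cal p ins out b) x \<longleftrightarrow> computes p (map x ins) (x out)"
proof (induction p arbitrary: ins out b x)
  case RZero
  then show ?case unfolding holds_Cal_iff by (auto elim: computes_elims intro: computes.intros)
next
  case RSucc
  have *: "computes RSucc xs y \<longleftrightarrow> (\<exists>a. xs = [a] \<and> y = Suc a)" for xs y
    by (auto elim: computes_elims intro: computes.intros)
  show ?case unfolding holds_Cal_iff *
  proof (cases ins rule: list.exhaust[case_names Nil Cons])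
    case (Cons i js)
    then show "holds (body RSucc ins out b) x \<longleftrightarrow> (\<exists>a. map x ins = [a] \<and> x out = Suc a)"
      using RSucc by (cases js) auto
  qed auto
next
  case (RProj k)
  have *: "computes (RProj k) xs y \<longleftrightarrow> k < length xs \<and> y = xs ! k" for xs y
    by (auto elim: computes_elims intro: computes.intros)
  have "ins ! k \<noteq> out" if "k < length ins" using RProj.prems(3) that by auto
  then show ?case unfolding holds_Cal_iff * by auto
next
  case (RComp f gs)
  let ?k = "length gs"
  have ne: "i < b" if "i \<in> set ins" for i using RComp.prems that by auto
  have "holds (Cal f [b..<b + ?k] out (b + ?k)) (upds x b zs) \<longleftrightarrow> computes f zs (x out)"
    if "length zs = ?k" for zs
  proof -
    have "map (upds x b zs) [b..<b + ?k] = zs"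
      using that by (intro nth_equalityI) (auto simp: upds_def)
    moreover have "upds x b zs out = x out" using RComp.prems by (auto simp: upds_def)
    ultimately show ?thesis using RComp.prems by (subst RComp.IH(1)) auto
  qed
  moreover have "holds (Cal (gs ! j) ins (b + j) (b + ?k)) (upds x b zs) \<longleftrightarrow>
      computes (gs ! j) (map x ins) (zs ! j)"
    if "length zs = ?k" "j < ?k" for zs j
  proof -
    have m: "map (upds x b zs) ins = map x ins" by (auto simp: upds_def dest: ne)
    have "b + j \<notin> set ins" using ne by force
    moreover have "set ins \<subseteq> {..<b + ?k}" using ne by force
    ultimately show ?thesis using that by (subst RComp.IH(2)) (simp_all add: upds_def m)
  qed
  moreover have "(\<forall>a\<in>set (zip gs [b..<b + ?k]). P a) \<longleftrightarrow> (\<forall>j<?k. P (gs ! j, b + j))" for P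
    by (simp add: all_set_conv_all_nth)
  ultimately have "holds (body (RComp f gs) ins out b) x \<longleftrightarrow>
      (\<exists>zs. length zs = ?k \<and> (\<forall>j<?k. computes (gs ! j) (map x ins) (zs ! j)) \<and> computes f zs (x out))"
    by (auto simp: Let_def holds_foldr_Exi_iff holds_foldr_Con_iff case_prod_beta')
  also have "\<dots> \<longleftrightarrow> computes (RComp f gs) (map x ins) (x out)"
  proof
    assume "computes (RComp f gs) (map x ins) (x out)"
    then show "\<exists>zs. length zs = ?k \<and> (\<forall>j<?k. computes (gs ! j) (map x ins) (zs ! j)) \<and> computes f zs (x out)"
      by (rule computes_elims) (auto simp: list_all2_conv_all_nth)
  qed (auto intro!: computes.comp simp: list_all2_conv_all_nth)
  finally show ?case unfolding holds_Cal_iff .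
next
  case (RPrim f g)
  show ?case
  proof (cases ins)
    case Nil
    then show ?thesis unfolding holds_Cal_iff by (auto elim: computes.cases)
  next
    case (Cons i js)
    have ns: "r \<notin> set js" if "r \<ge> b" for r using RPrim.prems that Cons by auto
    have le: "set js \<subseteq> {..<c}" if "c \<ge> b" for c using RPrim.prems that Cons by auto
    have i: "i < b" using RPrim.prems Cons by auto
    have out: "out < b" using RPrim.prems by auto
    have m: "map (x(b := 0, Suc b := z)) js = map x js"
      "map (x(b := 0, Suc b := z, b + 3 := w)) js = map x js" for z w
      by (simp_all add: ns)
    have f: "holds (Cal f js (Suc b) (b + 4)) (x(b := 0, Suc b := z)) \<longleftrightarrow> computes f (map x js) z" for z
      by (subst RPrim.IH(1)) (simp_all add: ns le)
    have g: "holds (PLoop g js out b) (x(b := 0, Suc b := z, b + 3 := x i)) \<longleftrightarrow>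
        steps g (map x js) (x i) 0 z (x out)" for z
      using out by (subst holds_PLoop[OF RPrim.IH(2)]) (simp_all add: ns le)
    have "holds (body (RPrim f g) ins out b) x \<longleftrightarrow>
        (\<exists>z. computes f (map x js) z \<and> steps g (map x js) (x i) 0 z (x out))"
      using Cons i by (auto simp: f g)
    then show ?thesis unfolding holds_Cal_iff Cons by (simp add: computes_RPrim_iff)
  qed
next
  case (RMin f)
  have ns: "r \<notin> set ins" if "r \<ge> b" for r using RMin.prems that by auto
  have le: "set ins \<subseteq> {..<c}" if "c \<ge> b" for c using RMin.prems that by auto
  have out: "out < b" using RMin.prems by auto
  have m: "map (x(b := 0)) ins = map x ins"
      "map (x(b := 0, Suc (Suc b) := w)) ins = map x ins" for w
      by (simp_all add: ns)
  have f: "holds (Cal f (out # ins) b (Suc b)) (x(b := 0)) \<longleftrightarrow> computes f (x out # map x ins) 0"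
    using out by (subst RMin.IH) (simp_all add: ns le)
  have g: "holds (MLoop f ins b) (x(b := 0, Suc (Suc b) := x out)) \<longleftrightarrow>
      (\<forall>m<x out. \<exists>z. computes f (m # map x ins) (Suc z))"
    by (subst holds_MLoop[OF RMin.IH]) (simp_all add: ns le)
  have "holds (body (RMin f) ins out b) x \<longleftrightarrow> computes f (x out # map x ins) 0 \<and>
      (\<forall>m<x out. \<exists>z. computes f (m # map x ins) (Suc z))"
    using out by (auto simp: f g)
  also have "\<dots> \<longleftrightarrow> computes (RMin f) (map x ins) (x out)"
    by (auto elim!: computes_elims(7) intro: computes.min)
  finally show ?case unfolding holds_Cal_iff .
qed

section \<open>Finitely many formulas for each program\<close>

fun subs :: "fm \<Rightarrow> fm set" where
  "subs (Inc i \<phi>) = {\<phi>}"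
| "subs (Dec i \<phi>) = {\<phi>}"
| "subs (Con \<phi> \<psi>) = {\<phi>, \<psi>}"
| "subs \<phi> = set (alts \<phi>)"

text \<open>\<open>Q\<close> will supply the control states of a machine. Loops and
  \<open>Exi\<close> unfold into formulas containing themselves, so finiteness is not evident from
  the structure of a formula.\<close>

definition finitary :: "fm \<Rightarrow> bool" where
  "finitary \<phi> \<longleftrightarrow> (\<exists>Q. finite Q \<and> \<phi> \<in> Q \<and> (\<forall>\<psi>\<in>Q. subs \<psi> \<subseteq> Q))"

lemma finitaryI:
  assumes A: "finite A" and step: "\<And>\<phi> \<psi>. \<lbrakk>\<phi> \<in> A; \<psi> \<in> subs \<phi>\<rbrakk> \<Longrightarrow> \<psi> \<in> A \<or> finitary \<psi>" and "\<phi> \<in> A"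
  shows "finitary \<phi>"
proof -
  have fin: "finite (subs \<psi>)" for \<psi> by (cases \<psi>) auto
  define N where "N = {\<psi>. finitary \<psi> \<and> (\<exists>\<theta>\<in>A. \<psi> \<in> subs \<theta>)}"
  have "finite N"
    by (rule finite_subset[of _ "\<Union>\<theta>\<in>A. subs \<theta>"]) (use A fin in \<open>auto simp: N_def\<close>)
  have "\<exists>Q. \<forall>\<psi>. finitary \<psi> \<longrightarrow> finite (Q \<psi>) \<and> \<psi> \<in> Q \<psi> \<and> (\<forall>\<theta>\<in>Q \<psi>. subs \<theta> \<subseteq> Q \<psi>)"
    by (intro choice) (auto simp: finitary_def)
  then obtain Q where Q: "\<And>\<psi>. finitary \<psi> \<Longrightarrow> finite (Q \<psi>) \<and> \<psi> \<in> Q \<psi> \<and> (\<forall>\<theta>\<in>Q \<psi>. subs \<theta> \<subseteq> Q \<psi>)" by blast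
  have "finite (A \<union> (\<Union>\<psi>\<in>N. Q \<psi>))" using A \<open>finite N\<close> Q by (auto simp: N_def)
  moreover have "\<theta> \<in> A \<union> (\<Union>\<psi>\<in>N. Q \<psi>)" if "\<psi> \<in> A \<union> (\<Union>\<psi>\<in>N. Q \<psi>)" "\<theta> \<in> subs \<psi>" for \<psi> \<theta>
    using that
  proof (elim UnE)
    assume "\<psi> \<in> A"
    then show ?thesis using step[OF _ that(2)] that(2) Q[of \<theta>] by (auto simp: N_def)
  next
    assume "\<psi> \<in> (\<Union>\<psi>\<in>N. Q \<psi>)"
    then show ?thesis using that(2) Q by (auto simp: N_def) blast
  qed
  ultimately show ?thesis unfolding finitary_def using \<open>\<phi> \<in> A\<close>
    by (intro exI[of _ "A \<union> (\<Union>\<psi>\<in>N. Q \<psi>)"]) blast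
qed

lemma finitary_subs: "(\<And>\<psi>. \<psi> \<in> subs \<phi> \<Longrightarrow> finitary \<psi>) \<Longrightarrow> finitary \<phi>"
  by (rule finitaryI[of "{\<phi>}"]) auto

lemma finitary_simps [simp]: "finitary (Zr i)" "finitary Bot" "finitary (Equ i j)"
  "finitary \<phi> \<Longrightarrow> finitary (Inc i \<phi>)" "finitary \<phi> \<Longrightarrow> finitary (Dec i \<phi>)"
  "\<lbrakk>finitary \<phi>; finitary \<psi>\<rbrakk> \<Longrightarrow> finitary (Con \<phi> \<psi>)" "\<lbrakk>finitary \<phi>; finitary \<psi>\<rbrakk> \<Longrightarrow> finitary (Dis \<phi> \<psi>)"
  "finitary \<phi> \<Longrightarrow> finitary (Exi i \<phi>)"
proof -
  show "finitary (Equ i j)"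
    by (rule finitaryI[of "{Equ i j, Con (Zr i) (Zr j), Zr i, Zr j, Dec i (Dec j (Equ i j)), Dec j (Equ i j)}"]) auto
  show "finitary (Exi i \<phi>)" if "finitary \<phi>"
    by (rule finitaryI[of "{Exi i \<phi>, Inc i (Exi i \<phi>), Dec i (Exi i \<phi>)}"]) (use that in auto)
qed (auto intro: finitary_subs)

lemma finitary_PLoop:
  assumes "\<And>ins out b. finitary (Cal g ins out b)"
  shows "finitary (PLoop g js out b)"
proof -
  define l1 where "l1 = PLoop g js out b"
  define l2 where "l2 = Inc b (Dec (b + 3) l1)"
  define l3 where "l3 = Con (Equ (b + 1) (b + 2)) l2"
  define l4 where "l4 = Con (Cal g (b # (b + 1) # js) (b + 2) (b + 4)) (Exi (b + 1) l3)"
  define l5 where "l5 = Dis (Con (Zr (b + 3)) (Equ (b + 1) out)) (Exi (b + 2) l4)"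
  have s: "subs l1 = {l5}" "subs l2 = {Dec (b + 3) l1}" "subs l3 = {Equ (b + 1) (b + 2), l2}"
    "subs l4 = {Cal g (b # (b + 1) # js) (b + 2) (b + 4), Exi (b + 1) l3}"
    "subs l5 = {Con (Zr (b + 3)) (Equ (b + 1) out), Exi (b + 2) l4}"
    by (simp_all add: l1_def l2_def l3_def l4_def l5_def)
  show ?thesis unfolding l1_def[symmetric]
    by (rule finitaryI[of "{l1, l2, Dec (b + 3) l1, l3, l4, l5, Exi (b + 1) l3, Inc (b + 1) (Exi (b + 1) l3),
        Dec (b + 1) (Exi (b + 1) l3), Exi (b + 2) l4, Inc (b + 2) (Exi (b + 2) l4), Dec (b + 2) (Exi (b + 2) l4)}"])
      (auto simp: s assms)
qed

lemma finitary_MLoop: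
  assumes "\<And>ins out b. finitary (Cal f ins out b)"
  shows "finitary (MLoop f ins b)"
proof -
  define l1 where "l1 = MLoop f ins b"
  define l2 where "l2 = Inc b (Dec (b + 2) l1)"
  define l3 where "l3 = Con (Cal f (b # ins) (b + 1) (b + 3)) l2"
  define l4 where "l4 = Inc (b + 1) l3"
  define l5 where "l5 = Dis (Zr (b + 2)) (Exi (b + 1) l4)"
  have s: "subs l1 = {l5}" "subs l2 = {Dec (b + 2) l1}" "subs l3 = {Cal f (b # ins) (b + 1) (b + 3), l2}"
    "subs l4 = {l3}" "subs l5 = {Zr (b + 2), Exi (b + 1) l4}"
    by (simp_all add: l1_def l2_def l3_def l4_def l5_def)
  show ?thesis unfolding l1_def[symmetric]
    by (rule finitaryI[of "{l1, l2, Dec (b + 2) l1, l3, l4, l5, Exi (b + 1) l4, Inc (b + 1) (Exi (b + 1) l4),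
        Dec (b + 1) (Exi (b + 1) l4)}"])
      (auto simp: s assms)
qed

lemma finitary_CalI: "finitary (body p ins out b) \<Longrightarrow> finitary (Cal p ins out b)"
  by (rule finitary_subs) simp

lemma finitary_Cal: "finitary (Cal p ins out b)"
proof (induction p arbitrary: ins out b)
  case RZero
  show ?case by (rule finitary_subs) simp
next
  case RSucc
  show ?case by (rule finitary_subs) (simp split: list.splits)
next
  case (RProj k)
  show ?case by (rule finitary_subs) simp
next
  case (RComp f gs)
  have E: "finitary (foldr Exi js \<phi>)" if "finitary \<phi>" for js \<phi> using that by (induction js) auto
  have C: "finitary (foldr (\<lambda>(g, z). Con (Cal g ins z c)) as \<phi>)"
    if "finitary \<phi>" "fst ` set as \<subseteq> set gs" for as \<phi> c
    using that RComp(2) by (induction as) auto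
  have z: "fst ` set (zip gs zs) \<subseteq> set gs" for zs :: "nat list" by (auto dest: set_zip_leftD)
  have "finitary (body (RComp f gs) ins out b)"
    unfolding body.simps Let_def by (rule E[OF C[OF RComp(1) z]])
  then show ?case by (simp del: body.simps add: finitary_CalI)
next
  case (RPrim f g)
  have "finitary (body (RPrim f g) ins out b)"
    using RPrim by (simp add: finitary_PLoop split: list.splits)
  then show ?case by (simp del: body.simps add: finitary_CalI)
next
  case (RMin f)
  then have "finitary (body (RMin f) ins out b)" by (simp add: finitary_MLoop)
  then show ?case by (simp del: body.simps add: finitary_CalI)
qed

section \<open>Two-counter systems\<close>

text \<open>\<open>Upd i m n q'\<close> subtracts \<open>m\<close> from counter \<open>i\<close> and
  adds \<open>n\<close>. There is no zero test: one branch of a \<open>Frk\<close> drains the other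
  counter and reaches \<open>Halt\<close>, which accepts only if both counters are
  \<open>0\<close>.\<close>

datatype 's op = Upd bool nat nat 's | Frk 's 's | Halt

inductive accepts :: "('s \<times> 's op) set \<Rightarrow> 's \<Rightarrow> (bool \<Rightarrow> nat) \<Rightarrow> bool" for P where
  accepts_Halt: "\<lbrakk>(q, Halt) \<in> P; \<And>i. c i = 0\<rbrakk> \<Longrightarrow> accepts P q c"
| accepts_Frk: "\<lbrakk>(q, Frk q1 q2) \<in> P; accepts P q1 c; accepts P q2 c\<rbrakk> \<Longrightarrow> accepts P q c"
| accepts_Upd: "\<lbrakk>(q, Upd i m n q') \<in> P; c i = a + m; accepts P q' (c(i := a + n))\<rbrakk> \<Longrightarrow> accepts P q c"

section \<open>Registers as exponents of primes\<close>

definition nth_prime :: "nat \<Rightarrow> nat" where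
  "nth_prime = enumerate {p. prime p}"

lemma prime_nth_prime [simp]: "prime (nth_prime i)"
  using enumerate_in_set[OF primes_infinite, of i] by (simp add: nth_prime_def)

lemma nth_prime_eq_iff [simp]: "nth_prime i = nth_prime j \<longleftrightarrow> i = j"
  using strict_mono_eq[OF strict_mono_enumerate[OF primes_infinite]] by (simp add: nth_prime_def)

lemma nth_prime_pos [simp]: "nth_prime i > 0"
  using prime_nth_prime prime_gt_0_nat by blast

definition reg :: "nat \<Rightarrow> nat \<Rightarrow> nat" where
  "reg a i = multiplicity (nth_prime i) a"

lemma reg_mult_prime: "a > 0 \<Longrightarrow> reg (nth_prime i * a) = (reg a)(i := Suc (reg a i))"
proof
  fix j assume "a > 0"
  then have "reg (nth_prime i * a) j = multiplicity (nth_prime j) (nth_prime i) + reg a j"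
    unfolding reg_def using prime_gt_0_nat[OF prime_nth_prime[of i]]
    by (intro prime_elem_multiplicity_mult_distrib) auto
  then show "reg (nth_prime i * a) j = ((reg a)(i := Suc (reg a i))) j"
    using prime_multiplicity_other[of "nth_prime j" "nth_prime i"] by (cases "i = j") auto
qed

lemma reg_zero_iff: "a > 0 \<Longrightarrow> reg a i = 0 \<longleftrightarrow> \<not> nth_prime i dvd a"
  unfolding reg_def using prime_multiplicity_gt_zero_iff[of "nth_prime i" a] by auto

lemma reg_prime_power: "reg (nth_prime i ^ n) = (\<lambda>_. 0)(i := n)"
proof (induction n)
  case 0
  then show ?case by (auto simp: reg_def)
next
  case (Suc n)
  then show ?case using reg_mult_prime[of "nth_prime i ^ n" i] by (auto simp: fun_eq_iff)
qed

text \<open>Every power of every prime divides \<open>0\<close>, so \<open>0\<close> encodes no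
  register contents and is excluded.\<close>

definition holdsN :: "fm \<Rightarrow> nat \<Rightarrow> bool" where
  "holdsN \<phi> a \<longleftrightarrow> a > 0 \<and> holds \<phi> (reg a)"

datatype st = Main fm | Sub fm | Back fm | Back2 fm | ZeroA | ZeroB

definition back_rules :: "fm \<Rightarrow> (st \<times> st op) set" where
  "back_rules \<phi> = {(Back \<phi>, Upd True 1 0 (Back2 \<phi>)), (Back2 \<phi>, Upd False 0 1 (Back \<phi>)),
     (Back \<phi>, Frk ZeroB (Main \<phi>))}"

text \<open>Exchanging \<open>m\<close> in the first counter for \<open>m'\<close> in the second
  until the first is empty divides by \<open>m\<close> and multiplies by \<open>m'\<close>, and
  fails unless \<open>m\<close> is a divisor; with a prime and \<open>1\<close> this increments or
  decrements a register.\<close>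

definition mul_rules :: "fm \<Rightarrow> nat \<Rightarrow> nat \<Rightarrow> fm \<Rightarrow> (st \<times> st op) set" where
  "mul_rules \<phi> m m' \<psi> = {(Main \<phi>, Upd False m 0 (Sub \<phi>)), (Sub \<phi>, Upd True 0 m' (Main \<phi>)),
     (Main \<phi>, Frk ZeroA (Back \<psi>))}"

text \<open>\<open>Zr i\<close> means that the prime does not divide the counter: it is subtracted
  repeatedly, and a nonzero remainder must end at \<open>0\<close>. The contents need not be
  restored, since \<open>Con\<close> hands each branch its own copy of the counters.\<close>

fun fm_rules :: "fm \<Rightarrow> (st \<times> st op) set" where
  "fm_rules (Zr i) = insert (Main (Zr i), Upd False (nth_prime i) 0 (Main (Zr i)))
     ((\<lambda>r. (Main (Zr i), Upd False r 0 ZeroA)) ` {0<..<nth_prime i})"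
| "fm_rules (Inc i \<psi>) = mul_rules (Inc i \<psi>) 1 (nth_prime i) \<psi>"
| "fm_rules (Dec i \<psi>) = mul_rules (Dec i \<psi>) (nth_prime i) 1 \<psi>"
| "fm_rules (Con \<phi> \<psi>) = {(Main (Con \<phi> \<psi>), Frk (Main \<phi>) (Main \<psi>))}"
| "fm_rules \<phi> = (\<lambda>\<psi>. (Main \<phi>, Upd False 0 0 (Main \<psi>))) ` set (alts \<phi>)"

definition prog :: "fm set \<Rightarrow> (st \<times> st op) set" where
  "prog Q = {(ZeroA, Upd True 1 0 ZeroA), (ZeroA, Halt), (ZeroB, Upd False 1 0 ZeroB), (ZeroB, Halt)} \<union>
     (\<Union>\<phi>\<in>Q. back_rules \<phi> \<union> fm_rules \<phi>)"

lemma finite_prog: "finite Q \<Longrightarrow> finite (prog Q)"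
proof -
  have "finite (fm_rules \<phi>)" for \<phi> by (cases \<phi>) (auto simp: mul_rules_def)
  then show "finite Q \<Longrightarrow> finite (prog Q)" by (auto simp: prog_def back_rules_def)
qed

text \<open>Essential once counters are exponents: the weighted sum only controls the difference of
  the exponents before and after, and with \<open>m\<close> and \<open>n\<close> both positive it
  would admit updates where too little is left to subtract.\<close>

lemma prog_Upd: "(q, Upd i m n q') \<in> prog Q \<Longrightarrow> m = 0 \<or> n = 0"
proof -
  have "(q, Upd i m n q') \<in> fm_rules \<phi> \<Longrightarrow> m = 0 \<or> n = 0" for \<phi> by (cases \<phi>) (auto simp: mul_rules_def)
  then show "(q, Upd i m n q') \<in> prog Q \<Longrightarrow> m = 0 \<or> n = 0" by (auto simp: prog_def back_rules_def)
qed

text \<open>\<open>k\<close> is \<open>1\<close> between the two halves of a transfer step, when \<open>m\<close> has been subtracted from the first counter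
  but \<open>m'\<close> not yet added to the second one.\<close>

definition mul_inv :: "nat \<Rightarrow> nat \<Rightarrow> fm \<Rightarrow> nat \<Rightarrow> nat \<Rightarrow> nat \<Rightarrow> bool" where
  "mul_inv m m' \<psi> k a b \<longleftrightarrow>
     (\<exists>a'. a = m * a' \<and> (\<forall>b'. b = m' * b' \<longrightarrow> holdsN \<psi> (m' * (a' + b' + k))))"

text \<open>Necessary conditions for acceptance at arbitrary counter contents, including those that
  no regular run reaches; hence premises such as \<open>b = 0\<close> or
  \<open>b = m' * b'\<close>.\<close>

fun invar :: "st \<Rightarrow> nat \<Rightarrow> nat \<Rightarrow> bool" where
  "invar (Main (Inc i \<psi>)) a b = mul_inv 1 (nth_prime i) \<psi> 0 a b"
| "invar (Main (Dec i \<psi>)) a b = mul_inv (nth_prime i) 1 \<psi> 0 a b"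
| "invar (Main \<phi>) a b = (b = 0 \<longrightarrow> holdsN \<phi> a)"
| "invar (Sub (Inc i \<psi>)) a b = mul_inv 1 (nth_prime i) \<psi> 1 a b"
| "invar (Sub (Dec i \<psi>)) a b = mul_inv (nth_prime i) 1 \<psi> 1 a b"
| "invar (Sub \<phi>) a b = True"
| "invar (Back \<psi>) a b = holdsN \<psi> (a + b)"
| "invar (Back2 \<psi>) a b = holdsN \<psi> (a + b + 1)"
| "invar ZeroA a b = (a = 0)"
| "invar ZeroB a b = (b = 0)"

lemma invar_MainD: "invar (Main \<phi>) a 0 \<Longrightarrow> holdsN \<phi> a"
proof (cases \<phi>)
  case (Inc i \<psi>)
  assume "invar (Main \<phi>) a 0"
  then have "holdsN \<psi> (nth_prime i * a)" by (auto simp: Inc mul_inv_def)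
  then show ?thesis by (auto simp: holdsN_def Inc reg_mult_prime)
next
  case (Dec i \<psi>)
  assume "invar (Main \<phi>) a 0"
  then obtain a' where "a = nth_prime i * a'" "holdsN \<psi> a'" by (auto simp: Dec mul_inv_def)
  then show ?thesis by (auto simp: holdsN_def Dec reg_mult_prime)
qed auto

lemma mul_inv_rules:
  "mul_inv m m' \<psi> 1 a b \<Longrightarrow> mul_inv m m' \<psi> 0 (a + m) b"
  "m' > 0 \<Longrightarrow> mul_inv m m' \<psi> 0 a (b + m') \<Longrightarrow> mul_inv m m' \<psi> 1 a b"
  "holdsN \<psi> b \<Longrightarrow> mul_inv m m' \<psi> 0 0 b"
proof -
  assume "mul_inv m m' \<psi> 1 a b"
  then obtain a' where "a = m * a'" "\<forall>b'. b = m' * b' \<longrightarrow> holdsN \<psi> (m' * (a' + b' + 1))"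
    by (auto simp: mul_inv_def)
  then show "mul_inv m m' \<psi> 0 (a + m) b"
    unfolding mul_inv_def by (intro exI[of _ "a' + 1"]) (auto simp: algebra_simps)
next
  assume "m' > 0" "mul_inv m m' \<psi> 0 a (b + m')"
  then obtain a' where a: "a = m * a'" "\<And>b'. b + m' = m' * b' \<Longrightarrow> holdsN \<psi> (m' * (a' + b'))"
    by (auto simp: mul_inv_def)
  have "holdsN \<psi> (m' * (a' + b' + 1))" if "b = m' * b'" for b'
    using a(2)[of "b' + 1"] that by (simp add: algebra_simps)
  then show "mul_inv m m' \<psi> 1 a b" unfolding mul_inv_def using a(1) by blast
next
  assume "holdsN \<psi> b"
  then show "mul_inv m m' \<psi> 0 0 b" unfolding mul_inv_def by (intro exI[of _ 0]) auto
qed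

lemma fm_rules_Upd_invar:
  assumes "(q, Upd i m n q') \<in> fm_rules \<phi>" "c i = k + m" "invar q' ((c(i := k + n)) False) ((c(i := k + n)) True)"
  shows "invar q (c False) (c True)"
proof -
  have alt: ?thesis if r: "fm_rules \<phi> = (\<lambda>\<psi>. (Main \<phi>, Upd False 0 0 (Main \<psi>))) ` set (alts \<phi>)"
    and I: "\<And>a b. invar (Main \<phi>) a b = (b = 0 \<longrightarrow> holdsN \<phi> a)"
  proof -
    from assms(1) r obtain \<psi> where \<psi>: "\<psi> \<in> set (alts \<phi>)" "q = Main \<phi>" "\<not> i" "m = 0" "n = 0" "q' = Main \<psi>"
      by auto
    then have "invar (Main \<psi>) (c False) (c True)" using assms(2,3) by simp
    then have "c True = 0 \<Longrightarrow> holdsN \<psi> (c False)" using invar_MainD by simp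
    then have "c True = 0 \<Longrightarrow> holdsN \<phi> (c False)" using \<psi>(1) holds_alt by (auto simp: holdsN_def)
    then show ?thesis using \<psi>(2) I by simp
  qed
  show ?thesis
  proof (cases \<phi>)
    case (Zr j)
    have "\<not> nth_prime j dvd r" if "0 < r" "r < nth_prime j" for r using that by (simp add: nat_dvd_not_less)
    then have "holdsN (Zr j) r" if "0 < r" "r < nth_prime j" for r
      using that reg_zero_iff[of r j] by (simp add: holdsN_def)
    moreover have "holdsN (Zr j) (a + nth_prime j)" if "holdsN (Zr j) a" for a
      using that reg_zero_iff[of a j] reg_zero_iff[of "a + nth_prime j" j] by (simp add: holdsN_def)
    ultimately show ?thesis using assms by (auto simp: Zr)
  next
    case (Inc j \<psi>)
    then show ?thesis using assms mul_inv_rules(1)[of 1 "nth_prime j" \<psi> k] mul_inv_rules(2)[of "nth_prime j" 1 \<psi> _ k]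
      by (auto simp: mul_rules_def)
  next
    case (Dec j \<psi>)
    then show ?thesis using assms mul_inv_rules(1)[of "nth_prime j" 1 \<psi> k] mul_inv_rules(2)[of 1 "nth_prime j" \<psi> _ k]
      by (auto simp: mul_rules_def)
  next
    case (Con \<phi>1 \<phi>2)
    then show ?thesis using assms by simp
  qed (rule alt; simp)+
qed

lemma accepts_prog_invar: "accepts (prog Q) q c \<Longrightarrow> invar q (c False) (c True)"
proof (induction rule: accepts.induct)
  case (accepts_Halt q c)
  have "(q, Halt) \<notin> fm_rules \<phi>" for \<phi> by (cases \<phi>) (auto simp: mul_rules_def)
  then show ?case using accepts_Halt by (auto simp: prog_def back_rules_def)
next
  case (accepts_Frk q q1 q2 c)
  have "invar q (c False) (c True)" if "(q, Frk q1 q2) \<in> fm_rules \<phi>" for \<phi>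
    using that accepts_Frk.IH
    by (cases \<phi>) (auto simp: mul_rules_def holdsN_def mul_inv_rules(3) dest!: invar_MainD)
  then show ?case using accepts_Frk by (auto simp: prog_def back_rules_def dest: invar_MainD)
next
  case (accepts_Upd q i m n q' c a)
  from accepts_Upd.hyps(1) consider \<phi> where "(q, Upd i m n q') \<in> fm_rules \<phi>"
    | "q = ZeroA" "i" "q' = ZeroA" | "q = ZeroB" "\<not> i" "q' = ZeroB"
    | \<phi> where "q = Back \<phi>" "i" "m = 1" "n = 0" "q' = Back2 \<phi>"
    | \<phi> where "q = Back2 \<phi>" "\<not> i" "m = 0" "n = 1" "q' = Back \<phi>"
    by (auto simp: prog_def back_rules_def)
  then show ?case
  proof cases
    case 1
    then show ?thesis using fm_rules_Upd_invar accepts_Upd by blast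
  qed (use accepts_Upd in \<open>auto simp: add.commute add.left_commute\<close>)
qed

definition counters :: "nat \<Rightarrow> nat \<Rightarrow> bool \<Rightarrow> nat" where
  "counters a b i = (if i then b else a)"

lemma counters_simps [simp]: "counters a b False = a" "counters a b True = b" "(counters a b)(False := a') = counters a' b"
  "(counters a b)(True := b') = counters a b'"
  by (auto simp: counters_def fun_eq_iff)

lemma accepts_UpdA: "\<lbrakk>(q, Upd False m n q') \<in> P; accepts P q' (counters (a + n) b)\<rbrakk> \<Longrightarrow> accepts P q (counters (a + m) b)"
  by (rule accepts_Upd[of q False m n q' P "counters (a + m) b" a]) auto

lemma accepts_UpdB: "\<lbrakk>(q, Upd True m n q') \<in> P; accepts P q' (counters a (b + n))\<rbrakk> \<Longrightarrow> accepts P q (counters a (b + m))"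
  by (rule accepts_Upd[of q True m n q' P "counters a (b + m)" b]) auto

lemma accepts_ZeroA: "accepts (prog Q) ZeroA (counters 0 b)"
proof (induction b)
  case 0
  show ?case by (rule accepts_Halt) (auto simp: prog_def counters_def)
next
  case (Suc b)
  then show ?case using accepts_UpdB[of ZeroA 1 0 ZeroA "prog Q" 0 b] by (simp add: prog_def)
qed

lemma accepts_ZeroB: "accepts (prog Q) ZeroB (counters a 0)"
proof (induction a)
  case 0
  show ?case by (rule accepts_Halt) (auto simp: prog_def counters_def)
next
  case (Suc a)
  then show ?case using accepts_UpdA[of ZeroB 1 0 ZeroB "prog Q" a 0] by (simp add: prog_def)
qed

lemma accepts_Back:
  assumes Q: "\<psi> \<in> Q" and acc: "accepts (prog Q) (Main \<psi>) (counters N 0)"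
  shows "a + b = N \<Longrightarrow> accepts (prog Q) (Back \<psi>) (counters a b)"
proof (induction b arbitrary: a)
  case 0
  have "(Back \<psi>, Frk ZeroB (Main \<psi>)) \<in> prog Q" using Q by (auto simp: prog_def back_rules_def)
  from accepts_Frk[OF this accepts_ZeroB] acc 0 show ?case by simp
next
  case (Suc b)
  have r: "(Back \<psi>, Upd True 1 0 (Back2 \<psi>)) \<in> prog Q" "(Back2 \<psi>, Upd False 0 1 (Back \<psi>)) \<in> prog Q"
    using Q by (auto simp: prog_def back_rules_def)
  have "accepts (prog Q) (Back \<psi>) (counters (a + 1) b)" using Suc by simp
  from accepts_UpdA[OF r(2) this] have "accepts (prog Q) (Back2 \<psi>) (counters a (b + 0))" by simp
  from accepts_UpdB[OF r(1) this] show ?case by simp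
qed

lemma accepts_mul:
  assumes Q: "\<psi> \<in> Q" "mul_rules \<phi> m m' \<psi> \<subseteq> prog Q" and acc: "accepts (prog Q) (Main \<psi>) (counters (m' * N) 0)"
  shows "a + b = N \<Longrightarrow> accepts (prog Q) (Main \<phi>) (counters (m * a) (m' * b))"
proof (induction a arbitrary: b)
  case 0
  have "(Main \<phi>, Frk ZeroA (Back \<psi>)) \<in> prog Q" using Q by (auto simp: mul_rules_def)
  moreover have "accepts (prog Q) (Back \<psi>) (counters 0 (m' * b))"
    using accepts_Back[OF Q(1) acc, of 0 "m' * b"] 0 by simp
  ultimately show ?case using accepts_Frk accepts_ZeroA by fastforce
next
  case (Suc a)
  have r: "(Main \<phi>, Upd False m 0 (Sub \<phi>)) \<in> prog Q" "(Sub \<phi>, Upd True 0 m' (Main \<phi>)) \<in> prog Q"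
    using Q by (auto simp: mul_rules_def)
  have "accepts (prog Q) (Main \<phi>) (counters (m * a) (m' * b + m'))" using Suc.IH[of "Suc b"] Suc.prems
    by (simp add: algebra_simps)
  from accepts_UpdB[OF r(2) this] have "accepts (prog Q) (Sub \<phi>) (counters (m * a + 0) (m' * b))" by simp
  from accepts_UpdA[OF r(1) this] show ?case by (simp add: algebra_simps)
qed

lemma holds_accepts:
  assumes Q: "\<And>\<psi>. \<psi> \<in> Q \<Longrightarrow> subs \<psi> \<subseteq> Q"
  shows "holds \<phi> x \<Longrightarrow> \<phi> \<in> Q \<Longrightarrow> a > 0 \<Longrightarrow> reg a = x \<Longrightarrow> accepts (prog Q) (Main \<phi>) (counters a 0)"
proof (induction arbitrary: a rule: holds.induct)
  case (holds_Zr x i)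
  have r: "(Main (Zr i), Upd False (nth_prime i) 0 (Main (Zr i))) \<in> prog Q"
    "\<And>r. 0 < r \<Longrightarrow> r < nth_prime i \<Longrightarrow> (Main (Zr i), Upd False r 0 ZeroA) \<in> prog Q"
    using holds_Zr.prems by (force simp: prog_def)+
  have "\<not> nth_prime i dvd a" using holds_Zr reg_zero_iff by auto
  then have m: "0 < a mod nth_prime i" "a mod nth_prime i < nth_prime i" by (auto simp: dvd_eq_mod_eq_0)
  have "accepts (prog Q) (Main (Zr i)) (counters (a mod nth_prime i + k * nth_prime i) 0)" for k
  proof (induction k)
    case 0
    show ?case using accepts_UpdA[OF r(2)[OF m], of 0 0] accepts_ZeroA by simp
  next
    case (Suc k)
    then show ?case using accepts_UpdA[OF r(1), of "a mod nth_prime i + k * nth_prime i" 0] by (simp add: ac_simps)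
  qed
  from this[of "a div nth_prime i"] show ?case by simp
next
  case (holds_Inc \<phi> x i)
  have "\<phi> \<in> Q" "mul_rules (Inc i \<phi>) 1 (nth_prime i) \<phi> \<subseteq> prog Q" using holds_Inc.prems Q by (force simp: prog_def)+
  moreover have "accepts (prog Q) (Main \<phi>) (counters (nth_prime i * a) 0)"
    using holds_Inc.prems Q by (intro holds_Inc.IH) (force simp: reg_mult_prime)+
  ultimately show ?case using accepts_mul[of \<phi> Q "Inc i \<phi>" 1 "nth_prime i" a a 0] by simp
next
  case (holds_Dec x i n \<phi>)
  have 1: "\<phi> \<in> Q" "mul_rules (Dec i \<phi>) (nth_prime i) 1 \<phi> \<subseteq> prog Q" using holds_Dec.prems Q by (force simp: prog_def)+
  have "nth_prime i dvd a" using holds_Dec reg_zero_iff[of a i] by auto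
  then obtain a' where a': "a = nth_prime i * a'" by blast
  then have "x = (reg a')(i := Suc (reg a' i))" using holds_Dec.prems reg_mult_prime by auto
  then have "reg a' = x(i := n)" using holds_Dec.hyps(1) by auto
  then have "accepts (prog Q) (Main \<phi>) (counters a' 0)" using 1 a' holds_Dec.prems by (intro holds_Dec.IH) auto
  then show ?case using accepts_mul[OF 1, of a' a' 0] a' by simp
next
  case (holds_Con \<phi> x \<psi>)
  then have r: "(Main (Con \<phi> \<psi>), Frk (Main \<phi>) (Main \<psi>)) \<in> prog Q" "\<phi> \<in> Q" "\<psi> \<in> Q"
    using Q[OF holds_Con.prems(1)] by (force simp: prog_def)+
  show ?case by (rule accepts_Frk[OF r(1)]) (use holds_Con r in auto)
next
  case (holds_alt \<psi> \<phi> x)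
  have alt: "fm_rules \<phi> = (\<lambda>\<psi>. (Main \<phi>, Upd False 0 0 (Main \<psi>))) ` set (alts \<phi>)" "subs \<phi> = set (alts \<phi>)"
    using holds_alt.hyps(1) by (cases \<phi>; simp)+
  have "(Main \<phi>, Upd False 0 0 (Main \<psi>)) \<in> fm_rules \<phi>" unfolding alt using holds_alt.hyps(1) by blast
  then have r: "(Main \<phi>, Upd False 0 0 (Main \<psi>)) \<in> prog Q"
    using holds_alt.prems(1) unfolding prog_def by blast
  have "\<psi> \<in> Q" using Q[OF holds_alt.prems(1)] holds_alt.hyps(1) alt(2) by blast
  then have "accepts (prog Q) (Main \<psi>) (counters a 0)" using holds_alt.IH holds_alt.prems by simp
  then show ?case using accepts_UpdA[OF r, of a 0] by simp
qed

lemma recf_accepts: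
  "\<exists>(P :: (st \<times> st op) set) q. finite P \<and> (\<forall>r i m n r'. (r, Upd i m n r') \<in> P \<longrightarrow> m = 0 \<or> n = 0) \<and>
     (\<forall>k. accepts P q (counters (nth_prime 0 ^ k) 0) \<longleftrightarrow> computes p [k] 0)"
proof -
  \<comment> \<open>Input in register \<open>0\<close>, output in register \<open>1\<close>, scratch
    space from \<open>2\<close>. In \<open>nth_prime 0 ^ k\<close> register \<open>0\<close> is
    \<open>k\<close> and all others are \<open>0\<close>, so the output claimed is
    \<open>0\<close>.\<close>
  define \<phi> where "\<phi> = Cal p [0] 1 2"
  obtain Q where Q: "finite Q" "\<phi> \<in> Q" "\<And>\<psi>. \<psi> \<in> Q \<Longrightarrow> subs \<psi> \<subseteq> Q"
    using finitary_Cal[of p "[0]" 1 2] unfolding finitary_def \<phi>_def by blast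
  have "accepts (prog Q) (Main \<phi>) (counters (nth_prime 0 ^ k) 0) \<longleftrightarrow> computes p [k] 0" for k
  proof -
    have h: "holds \<phi> (reg (nth_prime 0 ^ k)) \<longleftrightarrow> computes p [k] 0"
      unfolding \<phi>_def by (subst holds_Cal) (auto simp: reg_prime_power)
    have "accepts (prog Q) (Main \<phi>) (counters (nth_prime 0 ^ k) 0) \<longleftrightarrow> holds \<phi> (reg (nth_prime 0 ^ k))"
    proof
      assume "accepts (prog Q) (Main \<phi>) (counters (nth_prime 0 ^ k) 0)"
      from invar_MainD accepts_prog_invar[OF this] show "holds \<phi> (reg (nth_prime 0 ^ k))"
        by (auto simp: holdsN_def)
    qed (use holds_accepts[OF Q(3)] Q(2) in auto)
    then show ?thesis using h by simp
  qed
  then show ?thesis using finite_prog[OF Q(1)] prog_Upd by (intro exI[of _ "prog Q"] exI[of _ "Main \<phi>"]) blast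
qed

section \<open>Counters as exponents\<close>

text \<open>A counter value \<open>c\<close> is stored as \<open>K ^ c\<close> copies of the letter \<open>Rg 0\<close> or \<open>Rg 1\<close>. An update multiplies or divides this number by
  moving the letters to \<open>Rg 2\<close> (in \<open>Lp\<close>) and back (in \<open>Bk\<close>); \<open>Zt j\<close> tests that \<open>Rg j\<close> is absent.\<close>

datatype 's letter = Fin | Rg nat | St 's | Lp bool nat nat 's | Bk bool 's | Zt nat

definition reg_of :: "bool \<Rightarrow> nat" where "reg_of i = (if i then 1 else 0)"

text \<open>\<open>K ^ a\<close> rounds of \<open>Lp\<close> exchange \<open>K ^ (a + m)\<close>
  letters for \<open>K ^ (a + n)\<close>. A loop may be left at any time, but the accompanying
  branch into \<open>Zt\<close> succeeds only if no letter of the source remains.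
  \<open>Halt\<close> consumes one letter of each counter because \<open>K ^ 0 = 1\<close>.\<close>

fun op_rules :: "nat \<Rightarrow> 's \<Rightarrow> 's op \<Rightarrow> 's letter arule list" where
  "op_rules K q (Upd i m n q') =
     [([St q], [[Zt 2], [Lp i m n q']]),
      (Lp i m n q' # replicate (K ^ m) (Rg (reg_of i)), [Lp i m n q' # replicate (K ^ n) (Rg 2)]),
      ([Lp i m n q'], [[Zt (reg_of i)], [Bk i q']]),
      ([Bk i q', Rg 2], [[Bk i q', Rg (reg_of i)]]),
      ([Bk i q'], [[Zt 2], [St q']])]"
| "op_rules K q (Frk q1 q2) = [([St q], [[St q1], [St q2]])]"
| "op_rules K q Halt = [([St q, Rg 0, Rg 1], [[Fin]])]"

definition zero_rules :: "'s letter arule list" where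
  "zero_rules = concat (map (\<lambda>i. ([Zt i], [[Fin]]) #
     map (\<lambda>j. ([Zt i, Rg j], [[Zt i]])) (filter (\<lambda>j. j \<noteq> i) [0..<3])) [0..<3])"

definition all_rules :: "nat \<Rightarrow> ('s \<times> 's op) list \<Rightarrow> 's letter arule list" where
  "all_rules K ps = zero_rules @ concat (map (\<lambda>(q, x). op_rules K q x) ps)"

lemma all_rules_nonempty: "(u, []) \<notin> set (all_rules K ps)"
proof -
  have "(u, []) \<notin> set (op_rules K q x)" for q :: 'a and x by (cases x) auto
  then show ?thesis by (auto simp: all_rules_def zero_rules_def)
qed

lemma set_zero_rules:
  "set zero_rules = (\<lambda>i. ([Zt i], [[Fin]])) ` {..<3} \<union>
     {([Zt i, Rg j], [[Zt i]]) | i j. i < 3 \<and> j < 3 \<and> j \<noteq> i}"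
  by (auto simp: zero_rules_def)

text \<open>During a transfer the two letters involved need not be powers of \<open>K\<close> in number, but a linear
  combination of their numbers is.\<close>

fun good :: "('s \<times> 's op) set \<Rightarrow> nat \<Rightarrow> 's letter \<Rightarrow> (nat \<Rightarrow> nat) \<Rightarrow> bool" where
  "good P K Fin v \<longleftrightarrow> v 0 = 0 \<and> v 1 = 0 \<and> v 2 = 0"
| "good P K (Zt i) v \<longleftrightarrow> i < 3 \<and> v i = 0"
| "good P K (St q) v \<longleftrightarrow> (\<exists>c. v 0 = K ^ c False \<and> v 1 = K ^ c True \<and> accepts P q c)"
| "good P K (Lp i m n q) v \<longleftrightarrow> (\<exists>c. K ^ n * v (reg_of i) + K ^ m * v 2 = K ^ (m + c i) \<and>
     v (reg_of (\<not> i)) = K ^ c (\<not> i) \<and> accepts P q c)"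
| "good P K (Bk i q) v \<longleftrightarrow> (\<exists>c. v (reg_of i) + v 2 = K ^ c i \<and>
     v (reg_of (\<not> i)) = K ^ c (\<not> i) \<and> accepts P q c)"
| "good P K (Rg j) v \<longleftrightarrow> False"

definition regs :: "'s letter multiset \<Rightarrow> nat \<Rightarrow> nat" where
  "regs M j = count M (Rg j)"

definition nonreg :: "'s letter \<Rightarrow> bool" where
  "nonreg l \<longleftrightarrow> (\<forall>j. l \<noteq> Rg j)"

text \<open>This set defines the polarity. It is given by letter counts and machine acceptance
  rather than by derivability, so that closure under \<open>[D]\<close> becomes a statement on
  linear functionals.\<close>

definition good_set :: "('s \<times> 's op) set \<Rightarrow> nat \<Rightarrow> 's letter multiset set" where
  "good_set P K = {M. \<exists>l. filter_mset nonreg M = {#l#} \<and> good P K l (regs M)}"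

lemma regs_simps [simp]: "regs {#} j = 0" "regs (M + N) j = regs M j + regs N j"
  "regs (add_mset l M) j = (if l = Rg j then 1 else 0) + regs M j"
  "regs (repeat_mset k M) j = k * regs M j" "regs (replicate_mset k l) j = (if l = Rg j then k else 0)"
  by (auto simp: regs_def)

lemma nonreg_simps [simp]: "nonreg Fin" "\<not> nonreg (Rg j)" "nonreg (St q)" "nonreg (Lp i m n q)"
  "nonreg (Bk i q)" "nonreg (Zt j)"
  by (auto simp: nonreg_def)

lemma filter_replicate_Rg [simp]: "filter_mset nonreg (replicate_mset k (Rg j)) = {#}"
  by (induction k) auto

lemma add_mset_good_set:
  assumes "nonreg l"
  shows "add_mset l M \<in> good_set P K \<longleftrightarrow> filter_mset nonreg M = {#} \<and> good P K l (regs M)"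
proof -
  have "regs (add_mset l M) = regs M" using assms by (auto simp: nonreg_def)
  then show ?thesis using assms by (auto simp: good_set_def)
qed

lemma good_set_rules:
  assumes K: "K \<ge> 2" and P: "\<And>r i m n r'. (r, Upd i m n r') \<in> set ps \<Longrightarrow> m = 0 \<or> n = 0"
    and r: "(u, vs) \<in> set (all_rules K ps)" and vs: "\<forall>v\<in>set vs. mset v + w \<in> good_set (set ps) K"
  shows "mset u + w \<in> good_set (set ps) K"
proof -
  have Kinj: "K ^ a = K ^ b \<longleftrightarrow> a = b" for a b using K by (intro power_inject_exp) auto
  from r consider "(u, vs) \<in> set zero_rules" | q x where "(q, x) \<in> set ps" "(u, vs) \<in> set (op_rules K q x)"
    by (auto simp: all_rules_def)
  then show ?thesis
  proof cases
    case 1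
    then consider (a) i where "i < 3" "u = [Zt i]" "vs = [[Fin]]"
      | (b) i j where "i < 3" "j \<noteq> i" "u = [Zt i, Rg j]" "vs = [[Zt i]]"
      unfolding set_zero_rules by blast
    then show ?thesis
    proof cases
      case a
      have "i = 0 \<or> i = 1 \<or> i = 2" using a(1) by linarith
      then show ?thesis using vs unfolding a(2,3) by (auto simp: add_mset_good_set)
    next
      case b
      show ?thesis using vs b(1,2) unfolding b(3,4) by (simp add: add_mset_good_set)
    qed
  next
    case (2 q x)
    show ?thesis
    proof (cases x)
      case (Frk q1 q2)
      then have uvs: "u = [St q]" "vs = [[St q1], [St q2]]" using 2 by auto
      from vs[unfolded uvs] obtain c c' where w: "filter_mset nonreg w = {#}"
        and c: "regs w 0 = K ^ c False" "regs w 1 = K ^ c True" "accepts (set ps) q1 c"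
        and c': "regs w 0 = K ^ c' False" "regs w 1 = K ^ c' True" "accepts (set ps) q2 c'"
        by (auto simp: add_mset_good_set)
      have "K ^ c False = K ^ c' False" "K ^ c True = K ^ c' True" using c(1,2) c'(1,2) by simp_all
      then have "c False = c' False" "c True = c' True" unfolding Kinj .
      then have "c i = c' i" for i by (cases i) simp_all
      then have "c = c'" by auto
      have "(q, Frk q1 q2) \<in> set ps" using 2(1) Frk by simp
      from accepts_Frk[OF this c(3)] have "accepts (set ps) q c" using c'(3) \<open>c = c'\<close> by simp
      then have "good (set ps) K (St q) (regs w)" unfolding good.simps using c(1,2) by blast
      then show ?thesis using w by (simp add: uvs add_mset_good_set del: good.simps)
    next
      case Halt
      then have uvs: "u = [St q, Rg 0, Rg 1]" "vs = [[Fin]]" using 2 by auto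
      have "accepts (set ps) q (\<lambda>_. 0)" using accepts_Halt 2(1) Halt by fastforce
      then show ?thesis using vs by (auto simp: uvs add_mset_good_set intro!: exI[of _ "\<lambda>_. 0"])
    next
      case (Upd i m n q')
      have mn: "m = 0 \<or> n = 0" using P 2(1) Upd by blast
      have rii: "reg_of i \<noteq> 2" "reg_of (\<not> i) \<noteq> 2" "reg_of i \<noteq> reg_of (\<not> i)" by (auto simp: reg_of_def)
      from 2(2) Upd consider "u = [St q]" "vs = [[Zt 2], [Lp i m n q']]"
        | "u = Lp i m n q' # replicate (K ^ m) (Rg (reg_of i))" "vs = [Lp i m n q' # replicate (K ^ n) (Rg 2)]"
        | "u = [Lp i m n q']" "vs = [[Zt (reg_of i)], [Bk i q']]"
        | "u = [Bk i q', Rg 2]" "vs = [[Bk i q', Rg (reg_of i)]]"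
        | "u = [Bk i q']" "vs = [[Zt 2], [St q']]" by auto
      then show ?thesis
      proof cases
        case 1
        from vs[unfolded 1] obtain c where w: "filter_mset nonreg w = {#}" "regs w 2 = 0"
          and c: "K ^ n * regs w (reg_of i) = K ^ (m + c i)" "regs w (reg_of (\<not> i)) = K ^ c (\<not> i)"
            "accepts (set ps) q' c"
          by (auto simp: add_mset_good_set)
        \<comment> \<open>\<open>c\<close> describes the counters after the update, so
          \<open>a\<close> is \<open>c i\<close> less \<open>n\<close>. If \<open>n = 0\<close> it
          is \<open>c i\<close> itself; if \<open>m = 0\<close> the condition of the first case
          reads \<open>n \<le> c i\<close>.\<close>
        have "\<exists>a. regs w (reg_of i) = K ^ (a + m) \<and> c i = a + n"
        proof (cases "n \<le> m + c i")
          case True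
          then have "K ^ n * regs w (reg_of i) = K ^ n * K ^ (m + c i - n)"
            using c(1) by (simp add: power_add[symmetric])
          then have "regs w (reg_of i) = K ^ (m + c i - n)" using K by simp
          then show ?thesis using True mn by (intro exI[of _ "c i - n"]) (auto simp: add.commute)
        next
          case False
          then have "K ^ (m + c i) < K ^ n" using K by (intro power_strict_increasing) auto
          moreover have "regs w (reg_of i) \<noteq> 0" using c(1) K by (intro notI) simp
          then have "K ^ n \<le> K ^ n * regs w (reg_of i)" by simp
          ultimately show ?thesis using c(1) by simp
        qed
        then obtain a where a: "regs w (reg_of i) = K ^ (a + m)" "c i = a + n" by blast
        have cu: "c = (c(i := a + m))(i := a + n)" using a by auto
        have "accepts (set ps) q (c(i := a + m))"
          using accepts_Upd[of q i m n q' "set ps" "c(i := a + m)" a] 2(1) Upd c(3) cu by auto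
        moreover have "regs w 0 = K ^ (c(i := a + m)) False \<and> regs w 1 = K ^ (c(i := a + m)) True"
          using a(1) c(2) by (cases i) (auto simp: reg_of_def)
        ultimately have "good (set ps) K (St q) (regs w)" unfolding good.simps by blast
        then show ?thesis using w by (simp add: 1 add_mset_good_set del: good.simps)
      next
        case 2
        from vs[unfolded 2] obtain c where w: "filter_mset nonreg w = {#}"
          and c: "K ^ n * regs w (reg_of i) + K ^ m * (K ^ n + regs w 2) = K ^ (m + c i)"
            "regs w (reg_of (\<not> i)) = K ^ c (\<not> i)" "accepts (set ps) q' c"
          using rii by (auto simp: add_mset_good_set)
        \<comment> \<open>One round trades \<open>K ^ m\<close> letters of weight
          \<open>K ^ n\<close> for \<open>K ^ n\<close> letters of weight \<open>K ^ m\<close>,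
          which leaves the weighted sum unchanged.\<close>
        have "K ^ n * (K ^ m + regs w (reg_of i)) + K ^ m * regs w 2 = K ^ (m + c i)"
          using c(1) by (simp add: algebra_simps)
        then have "good (set ps) K (Lp i m n q') (regs (mset (replicate (K ^ m) (Rg (reg_of i))) + w))"
          unfolding good.simps using c(2,3) rii by (intro exI[of _ c]) simp
        then show ?thesis using w by (simp add: 2 add_mset_good_set del: good.simps regs_simps)
      next
        case 3
        from vs[unfolded 3] obtain c where w: "filter_mset nonreg w = {#}" "regs w (reg_of i) = 0"
          and c: "regs w 2 = K ^ c i" "regs w (reg_of (\<not> i)) = K ^ c (\<not> i)" "accepts (set ps) q' c"
          by (auto simp: add_mset_good_set)
        then have "good (set ps) K (Lp i m n q') (regs w)"
          unfolding good.simps by (intro exI[of _ c]) (simp add: power_add)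
        then show ?thesis using w by (simp add: 3 add_mset_good_set del: good.simps)
      next
        case 4
        then show ?thesis using vs rii by (simp add: add_mset_good_set)
      next
        case 5
        from vs[unfolded 5] obtain c where w: "filter_mset nonreg w = {#}" "regs w 2 = 0"
          and c: "regs w 0 = K ^ c False" "regs w 1 = K ^ c True" "accepts (set ps) q' c"
          by (auto simp: add_mset_good_set)
        have "good (set ps) K (Bk i q') (regs w)"
          unfolding good.simps using c w(2) by (intro exI[of _ c]) (cases i; simp add: reg_of_def)
        then show ?thesis using w by (simp add: 5 add_mset_good_set del: good.simps)
      qed
    qed
  qed
qed

section \<open>Closure of the accepted words under simple equations\<close>

definition powers :: "nat \<Rightarrow> nat set" where
  "powers K = insert 0 (range ((^) K))"

lemma sparse_powers: "K \<ge> 2 \<Longrightarrow> sparse K (powers K)"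
proof -
  assume K: "K \<ge> 2"
  have "K * K ^ a \<le> K ^ b" if "K ^ a < K ^ b" for a b
  proof -
    have "a < b" using that K by (simp add: power_strict_increasing_iff)
    then have "K ^ Suc a \<le> K ^ b" using K by (intro power_increasing) auto
    then show ?thesis by simp
  qed
  then show ?thesis by (auto simp: sparse_def powers_def)
qed

lemma powers_memI: "x = 0 \<Longrightarrow> x \<in> powers K" "x = K ^ a \<Longrightarrow> x \<in> powers K"
  by (auto simp: powers_def)

text \<open>The letter fixes the weights \<omega>, so goodness depends on two numbers only, both in
  the sparse set. Where counts have to vanish, both functionals are the sum of these counts with
  value \<open>0\<close>, which is why \<open>0\<close> belongs to \<open>powers K\<close>.\<close>

lemma good_linear:
  "\<exists>\<omega> B. (\<forall>v. good P K l v \<longleftrightarrow> (\<lambda>i :: bool. \<Sum>k<3. \<omega> i k * v k) \<in> B) \<and> (\<forall>f\<in>B. \<forall>i. f i \<in> powers K)"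
proof (cases l)
  case Fin
  have "good P K l v \<longleftrightarrow> (\<lambda>i :: bool. \<Sum>k<3. (\<lambda>_ _. 1) i k * v k) \<in> {\<lambda>_. 0}" for v
    by (auto simp: Fin fun_eq_iff numeral_3_eq_3 numeral_2_eq_2)
  then show ?thesis by (intro exI[of _ "\<lambda>_ _. 1"] exI[of _ "{\<lambda>_. 0}"]) (auto intro: powers_memI)
next
  case (Rg j)
  then show ?thesis by (intro exI[of _ "\<lambda>_ _. 1"] exI[of _ "{}"]) auto
next
  case (Zt j)
  have "good P K l v \<longleftrightarrow> (\<lambda>i :: bool. \<Sum>k<3. (if k = j then 1 else 0) * v k) \<in>
      (if j < 3 then {\<lambda>_. 0} else {})" for v
  proof -
    have "(\<Sum>k<3. (if k = j then 1 else 0) * v k) = (\<Sum>k<3. if k = j then v k else 0)"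
      by (intro sum.cong) auto
    then show ?thesis by (auto simp: Zt fun_eq_iff)
  qed
  then show ?thesis
    by (intro exI[of _ "\<lambda>_ k. if k = j then 1 else 0"] exI[of _ "if j < 3 then {\<lambda>_. 0} else {}"])
      (auto intro: powers_memI split: if_splits)
next
  case (St q)
  let ?w = "\<lambda>i k. if k = reg_of i then 1 else (0 :: nat)" and ?B = "{\<lambda>i. K ^ c i | c. accepts P q c}"
  have s: "(\<Sum>k<3. ?w i k * v k) = v (reg_of i)" for i v
    by (cases i) (auto simp: reg_of_def numeral_3_eq_3)
  have "good P K l v \<longleftrightarrow> (\<lambda>i. \<Sum>k<3. ?w i k * v k) \<in> ?B" for v
    unfolding s by (auto simp: St fun_eq_iff all_bool_eq reg_of_def)
  then show ?thesis by (intro exI[of _ ?w] exI[of _ ?B]) (auto intro: powers_memI)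
next
  case (Lp i m n q)
  let ?w = "\<lambda>j k. if j = i then if k = reg_of i then K ^ n else if k = 2 then K ^ m else 0
    else if k = reg_of j then 1 else 0"
    and ?B = "{\<lambda>j. if j = i then K ^ (m + c i) else K ^ c j | c. accepts P q c}"
  have s: "(\<Sum>k<3. ?w j k * v k) = (if j = i then K ^ n * v (reg_of i) + K ^ m * v 2 else v (reg_of j))" for j v
    by (cases i; cases j) (auto simp: reg_of_def numeral_3_eq_3 numeral_2_eq_2)
  have "good P K l v \<longleftrightarrow> (\<lambda>i. \<Sum>k<3. ?w i k * v k) \<in> ?B" for v
    unfolding s by (cases i) (auto simp: Lp fun_eq_iff all_bool_eq)
  then show ?thesis by (intro exI[of _ ?w] exI[of _ ?B]) (auto intro: powers_memI)
next
  case (Bk i q)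
  let ?w = "\<lambda>j k. if j = i then if k = reg_of i then 1 else if k = 2 then 1 else 0
    else if k = reg_of j then 1 else (0 :: nat)"
    and ?B = "{\<lambda>j. K ^ c j | c. accepts P q c}"
  have s: "(\<Sum>k<3. ?w j k * v k) = (if j = i then v (reg_of i) + v 2 else v (reg_of j))" for j v
    by (cases i; cases j) (auto simp: reg_of_def numeral_3_eq_3 numeral_2_eq_2)
  have "good P K l v \<longleftrightarrow> (\<lambda>i. \<Sum>k<3. ?w i k * v k) \<in> ?B" for v
    unfolding s by (cases i) (auto simp: Bk fun_eq_iff all_bool_eq)
  then show ?thesis by (intro exI[of _ ?w] exI[of _ ?B]) (auto intro: powers_memI)
qed

lemma filter_sum_mset: "filter_mset P (\<Sum>j<n. f j) = (\<Sum>j<n :: nat. filter_mset P (f j))"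
  by (induction n) auto

lemma filter_repeat_mset: "filter_mset P (repeat_mset k M) = repeat_mset k (filter_mset P M)"
  by (induction k) auto

lemma size_sum: "size (\<Sum>j<n. f j :: 'a multiset) = (\<Sum>j<n :: nat. size (f j))"
  by (induction n) auto

lemma regs_sum: "regs (\<Sum>j<n. f j) k = (\<Sum>j<n :: nat. regs (f j) k)"
  by (induction n) auto

lemma sum_singleton_mset:
  assumes "size (\<Sum>j<n :: nat. f j) = 1"
  shows "\<exists>j<n. \<exists>l. f j = {#l#} \<and> (\<forall>i<n. i \<noteq> j \<longrightarrow> f i = {#})"
proof -
  have s: "(\<Sum>j<n. size (f j)) = Suc 0" using assms by (simp add: size_sum)
  then obtain j where j: "j < n" "size (f j) = 1" "\<And>i. i < n \<Longrightarrow> i \<noteq> j \<Longrightarrow> size (f i) = 0"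
    using sum_eq_Suc0_iff[of "{..<n}" "\<lambda>j. size (f j)"] by auto
  then show ?thesis using size_1_singleton_mset[of "f j"] by auto
qed

text \<open>The two-functional property is applied twice: to the number of control letters, with
  \<open>X = {1}\<close>, so that the left-hand side has one control letter as well; and to the
  functionals belonging to that letter.\<close>

lemma good_set_resp_simple:
  fixes P :: "('s \<times> 's op) set"
  assumes D: "spineless n D" and K: "K \<ge> 2"
    and pair: "\<And>X u s. \<lbrakk>sparse K X; \<And>d i. d \<in> D \<Longrightarrow> u (i :: bool) + lin (s i) d \<in> X\<rbrakk> \<Longrightarrow>
      \<exists>d\<in>D. \<forall>i. lin (s i) d = lin (s i) (ones_vec n)"
  shows "resp_simple (good_set P K) n D"
  unfolding resp_simple_def
proof (intro allI impI)
  fix w and x :: "nat \<Rightarrow> 's letter multiset"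
  define y where "y d = w + (\<Sum>j<n. repeat_mset (d $ j) (x j))" for d
  define o' where "o' = w + (\<Sum>j<n. x j)"
  assume "\<forall>d\<in>D. w + (\<Sum>j<n. repeat_mset (d $ j) (x j)) \<in> good_set P K"
  then have y: "y d \<in> good_set P K" if "d \<in> D" for d using that by (simp add: y_def)
  have D': "simple n D" using D by (simp add: spineless_def)
  then have dim: "dim_vec d = n" if "d \<in> D" for d using that by (auto simp: simple_def)
  define F :: "'s letter multiset \<Rightarrow> 's letter multiset" where "F = filter_mset nonreg"
  have Fy: "F (y d) = F w + (\<Sum>j<n. repeat_mset (d $ j) (F (x j)))" for d
    by (simp add: F_def y_def filter_sum_mset filter_repeat_mset)
  have Fo: "F o' = F w + (\<Sum>j<n. F (x j))"
    by (simp add: F_def o'_def filter_sum_mset)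
  have sy: "size (F (y d)) = 1" if "d \<in> D" for d using y[OF that] by (auto simp: good_set_def F_def)
  have ly: "size (F (y d)) = size (F w) + lin (\<lambda>j. size (F (x j))) d" if "d \<in> D" for d
    using dim[OF that] by (simp add: Fy size_sum lin_def mult.commute)
  have "\<exists>d\<in>D. \<forall>i :: bool. lin (\<lambda>j. size (F (x j))) d = lin (\<lambda>j. size (F (x j))) (ones_vec n)"
    by (rule pair[where u = "\<lambda>_. size (F w)" and X = "{1}"]) (use ly sy in \<open>auto simp: sparse_def\<close>)
  then obtain d0 where d0: "d0 \<in> D" "lin (\<lambda>j. size (F (x j))) d0 = lin (\<lambda>j. size (F (x j))) (ones_vec n)"
    by auto
  have so: "size (F o') = 1"
    using sy[OF d0(1)] ly[OF d0(1)] d0(2) by (simp add: Fo size_sum lin_ones)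
  then obtain l where l: "F o' = {#l#}" using size_1_singleton_mset by blast
  \<comment> \<open>The control letter sits either in the context, and then in no
    \<open>x j\<close>, or in exactly one \<open>x j\<close>, and then every right-hand side has
    exponent \<open>1\<close> at \<open>j\<close>. So all words share the letter and the same
    functionals apply to them.\<close>
  have Fyl: "F (y d) = {#l#}" if d: "d \<in> D" for d
  proof (cases "F w = {#}")
    case True
    then have "size (\<Sum>j<n. F (x j)) = 1" using so Fo by simp
    then obtain j l' where j: "j < n" "F (x j) = {#l'#}" "\<forall>i<n. i \<noteq> j \<longrightarrow> F (x i) = {#}"
      using sum_singleton_mset[where n = n and f = "\<lambda>j. F (x j)"] by blast
    have "(\<Sum>i<n. repeat_mset (e i) (F (x i))) = (\<Sum>i<n. if i = j then repeat_mset (e j) {#l'#} else {#})" for e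
      using j by (intro sum.cong) auto
    then have s: "(\<Sum>i<n. repeat_mset (e i) (F (x i))) = repeat_mset (e j) {#l'#}" for e
      using j(1) by simp
    have "l' = l" using s[of "\<lambda>_. 1"] l Fo True by simp
    moreover have "d $ j = 1" using sy[OF d] Fy[of d] s[of "($) d"] True by simp
    ultimately show ?thesis using Fy[of d] s[of "($) d"] True by simp
  next
    case False
    then have "size (F w) > 0" by (simp add: nonempty_has_size)
    moreover have "size (F w) + size (\<Sum>j<n. F (x j)) = 1" using so unfolding Fo by simp
    ultimately have "size (\<Sum>j<n. F (x j)) = 0" by linarith
    then have "(\<Sum>j<n. size (F (x j))) = 0" by (simp only: size_sum)
    then have "F (x j) = {#}" if "j < n" for j using that by simp
    then show ?thesis using Fy[of d] l Fo by simp
  qed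
  have reg: "good P K l (regs (y d))" if "d \<in> D" for d
    using y[OF that] Fyl[OF that] by (auto simp: good_set_def F_def)
  obtain \<omega> B where B: "\<And>v. good P K l v \<longleftrightarrow> (\<lambda>i :: bool. \<Sum>k<3. \<omega> i k * v k) \<in> B" "\<And>f i. f \<in> B \<Longrightarrow> f i \<in> powers K"
    using good_linear[of P K l] by blast
  define s where "s i j = (\<Sum>k<3. \<omega> i k * regs (x j) k)" for i j
  define u where "u i = (\<Sum>k<3. \<omega> i k * regs w k)" for i
  have sum: "(\<Sum>k<3. \<omega> i k * (\<Sum>j<n. e j * regs (x j) k)) = (\<Sum>j<n. s i j * e j)" for i e
    unfolding s_def sum_distrib_left sum_distrib_right
    by (subst sum.swap) (simp add: ac_simps)
  have yd: "(\<Sum>k<3. \<omega> i k * regs (y d) k) = u i + lin (s i) d" if "d \<in> D" for i d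
    using sum[of i "($) d"] dim[OF that]
    by (simp add: y_def u_def regs_sum lin_def distrib_left sum.distrib)
  have yo: "(\<Sum>k<3. \<omega> i k * regs o' k) = u i + lin (s i) (ones_vec n)" for i
    using sum[of i "\<lambda>_. 1"] by (simp add: o'_def u_def regs_sum lin_ones distrib_left sum.distrib)
  have "\<exists>d\<in>D. \<forall>i. lin (s i) d = lin (s i) (ones_vec n)"
  proof (rule pair[OF sparse_powers[OF K]])
    fix d i assume d: "d \<in> D"
    show "u i + lin (s i) d \<in> powers K"
      using B(2)[OF reg[OF d, unfolded B(1)], of i] yd[OF d, of i] by simp
  qed
  then obtain d where d: "d \<in> D" "\<And>i. lin (s i) d = lin (s i) (ones_vec n)" by blast
  have "good P K l (regs o')" using reg[OF d(1)] unfolding B(1) yo yd[OF d(1)] d(2) .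
  then have "o' \<in> good_set P K" using l by (auto simp: good_set_def F_def)
  then show "w + (\<Sum>j<n. x j) \<in> good_set P K" by (simp add: o'_def)
qed

section \<open>Derivations simulating accepting runs\<close>

definition conf :: "'s letter \<Rightarrow> (nat \<Rightarrow> nat) \<Rightarrow> 's letter multiset" where
  "conf l v = add_mset l (replicate_mset (v 0) (Rg 0) + replicate_mset (v 1) (Rg 1) + replicate_mset (v 2) (Rg 2))"

lemma replicate_mset_add: "replicate_mset (a + b) x = replicate_mset a x + replicate_mset b x"
  by (induction a) auto

lemma derivable_Zt:
  assumes P: "set zero_rules \<subseteq> P" and i: "i < 3" and v: "v i = 0"
  shows "derivable P Fin (conf (Zt i) v)"
proof -
  have r: "([Zt i], [[Fin]]) \<in> P" "\<And>j. j < 3 \<Longrightarrow> j \<noteq> i \<Longrightarrow> ([Zt i, Rg j], [[Zt i]]) \<in> P"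
    using P i by (auto simp: set_zero_rules)
  have base: "derivable P Fin {#Zt i#}"
    using derivable_step[OF r(1), of Fin "{#}"] by (simp add: derivable_final)
  have add: "derivable P Fin (add_mset (Zt i) (replicate_mset k (Rg j) + w))"
    if "derivable P Fin (add_mset (Zt i) w)" "j < 3" "j \<noteq> i \<or> k = 0" for j k w
    using that
  proof (induction k)
    case (Suc k)
    have "derivable P Fin (mset [Zt i, Rg j] + (replicate_mset k (Rg j) + w))"
      by (rule derivable_step[OF r(2)]) (use Suc in auto)
    then show ?case by (simp add: ac_simps)
  qed auto
  have vz: "j \<noteq> i \<or> v j = 0" for j using v by auto
  have "derivable P Fin (add_mset (Zt i) (replicate_mset (v 0) (Rg 0) + (replicate_mset (v 1) (Rg 1) +
      (replicate_mset (v 2) (Rg 2) + {#}))))"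
    by (intro add vz) (use base in simp_all)
  then show ?thesis by (simp add: conf_def ac_simps)
qed

definition enc :: "nat \<Rightarrow> (bool \<Rightarrow> nat) \<Rightarrow> nat \<Rightarrow> nat" where
  "enc K c j = (if j = 0 then K ^ c False else if j = 1 then K ^ c True else 0)"

lemma enc_simps [simp]: "enc K c (reg_of i) = K ^ c i" "enc K c 2 = 0" "enc K c 0 = K ^ c False" "enc K c 1 = K ^ c True" "enc K c (Suc 0) = K ^ c True"
  by (auto simp: enc_def reg_of_def)

lemma conf_regs: "conf l v = add_mset l (replicate_mset (v (reg_of i)) (Rg (reg_of i)) +
    replicate_mset (v (reg_of (\<not> i))) (Rg (reg_of (\<not> i))) + replicate_mset (v 2) (Rg 2))"
  by (cases i) (auto simp: conf_def reg_of_def ac_simps)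

lemma accepts_derivable:
  assumes K: "K \<ge> 1"
  shows "accepts (set ps) q c \<Longrightarrow> derivable (set (all_rules K ps)) Fin (conf (St q) (enc K c))"
proof (induction rule: accepts.induct)
  case (accepts_Halt q c)
  have "([St q, Rg 0, Rg 1], [[Fin]]) \<in> set (all_rules K ps)"
    using accepts_Halt by (force simp: all_rules_def)
  from derivable_step[OF this, of Fin "{#}"] show ?case
    using accepts_Halt by (simp add: conf_def derivable_final add_mset_commute)
next
  case (accepts_Frk q q1 q2 c)
  have "([St q], [[St q1], [St q2]]) \<in> set (all_rules K ps)"
    using accepts_Frk by (force simp: all_rules_def)
  from derivable_step[OF this] accepts_Frk.IH show ?case by (simp add: conf_def)
next
  case (accepts_Upd q i m n q' c a)
  let ?P = "set (all_rules K ps)" and ?r = "Rg (reg_of i)" and ?A = "Rg 2"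
  have sub: "set (op_rules K q (Upd i m n q')) \<subseteq> ?P"
    using accepts_Upd.hyps(1) by (force simp: all_rules_def)
  then have r: "([St q], [[Zt 2], [Lp i m n q']]) \<in> ?P"
      "(Lp i m n q' # replicate (K ^ m) ?r, [Lp i m n q' # replicate (K ^ n) ?A]) \<in> ?P"
      "([Lp i m n q'], [[Zt (reg_of i)], [Bk i q']]) \<in> ?P"
      "([Bk i q', ?A], [[Bk i q', ?r]]) \<in> ?P"
      "([Bk i q'], [[Zt 2], [St q']]) \<in> ?P"
    by auto
  have zr: "set zero_rules \<subseteq> ?P" by (auto simp: all_rules_def)
  have ri3: "reg_of i < 3" "reg_of i \<noteq> 2" "reg_of (\<not> i) \<noteq> reg_of i" "reg_of (\<not> i) \<noteq> 2" by (auto simp: reg_of_def)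
  let ?o = "replicate_mset (K ^ c (\<not> i)) (Rg (reg_of (\<not> i)))"
  let ?C = "\<lambda>l x z. add_mset l (replicate_mset x ?r + ?o + replicate_mset z ?A)"
  have C: "?C l x z = conf l ((enc K c)(reg_of i := x, 2 := z))" for l x z
    using ri3 by (auto simp: conf_regs[of _ _ i])
  have St: "conf (St q') (enc K (c(i := a + n))) = ?C (St q') (K ^ (a + n)) 0"
    by (auto simp: conf_regs[of _ _ i])
  have "derivable ?P Fin (?C (Zt 2) (K ^ (a + n)) 0)"
    unfolding C by (rule derivable_Zt[OF zr]) auto
  with accepts_Upd.IH[unfolded St] have B0: "derivable ?P Fin (?C (Bk i q') (K ^ (a + n)) 0)"
    using derivable_step[OF r(5), of Fin "replicate_mset (K ^ (a + n)) ?r + ?o"] by simp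
  have Bm: "derivable ?P Fin (?C (Bk i q') x z)" if "derivable ?P Fin (?C (Bk i q') (x + z) 0)" for x z
    using that
  proof (induction z arbitrary: x)
    case (Suc z)
    have "derivable ?P Fin (?C (Bk i q') (Suc x) z)" by (rule Suc.IH) (use Suc.prems in simp)
    then show ?case
      using derivable_step[OF r(4), of Fin "replicate_mset x ?r + ?o + replicate_mset z ?A"]
      by (simp add: add_mset_commute)
  qed simp
  have "derivable ?P Fin (?C (Bk i q') 0 (K ^ (a + n)))" using Bm[of 0 "K ^ (a + n)"] B0 by simp
  moreover have "derivable ?P Fin (?C (Zt (reg_of i)) 0 (K ^ (a + n)))"
    unfolding C by (rule derivable_Zt[OF zr]) (use ri3 in auto)
  ultimately have L0: "derivable ?P Fin (?C (Lp i m n q') 0 (K ^ (a + n)))"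
    using derivable_step[OF r(3), of Fin "?o + replicate_mset (K ^ (a + n)) ?A"] by simp
  \<comment> \<open>\<open>t\<close> rounds exchange \<open>t * K ^ m\<close> letters for
    \<open>t * K ^ n\<close>; the case \<open>t = K ^ a\<close> performs the whole update.\<close>
  have Lm: "derivable ?P Fin (?C (Lp i m n q') (t * K ^ m) z)"
    if "derivable ?P Fin (?C (Lp i m n q') 0 (t * K ^ n + z))" for t z
    using that
  proof (induction t arbitrary: z)
    case (Suc t)
    have "derivable ?P Fin (?C (Lp i m n q') (t * K ^ m) (K ^ n + z))"
      by (rule Suc.IH) (use Suc.prems in \<open>simp add: ac_simps\<close>)
    then show ?case
      using derivable_step[OF r(2), of Fin "replicate_mset (t * K ^ m) ?r + ?o + replicate_mset z ?A"]
      by (simp add: replicate_mset_add ac_simps)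
  qed simp
  have "derivable ?P Fin (?C (Lp i m n q') (K ^ (a + m)) 0)"
    using Lm[of "K ^ a" 0] L0 by (simp add: power_add)
  moreover have "derivable ?P Fin (?C (Zt 2) (K ^ (a + m)) 0)"
    unfolding C by (rule derivable_Zt[OF zr]) auto
  ultimately have "derivable ?P Fin (?C (St q) (K ^ (a + m)) 0)"
    using derivable_step[OF r(1), of Fin "replicate_mset (K ^ (a + m)) ?r + ?o"] by simp
  moreover have "conf (St q) (enc K c) = ?C (St q) (K ^ (a + m)) 0"
    using accepts_Upd.hyps(2) by (simp add: conf_regs[of _ _ i])
  ultimately show ?case by simp
qed

lemma good_conf: 
  assumes "K \<ge> 2" "conf (St q) (enc K c) \<in> good_set P K"
  shows "accepts P q c"
proof -
  define M :: "'a letter multiset" where "M = replicate_mset (enc K c 0) (Rg 0) +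
    replicate_mset (enc K c 1) (Rg 1) + replicate_mset (enc K c 2) (Rg 2)"
  have r: "regs M = enc K c" unfolding M_def by (rule ext) (auto simp: enc_def)
  have "conf (St q) (enc K c) = add_mset (St q) M" by (simp add: conf_def M_def)
  then have "good P K (St q) (enc K c)" using assms(2) by (simp add: add_mset_good_set r del: good.simps)
  then obtain c' where c': "K ^ c False = K ^ c' False" "K ^ c True = K ^ c' True" "accepts P q c'"
    by auto
  then have "c i = c' i" for i using assms(1) by (cases i) (auto simp: power_inject_exp)
  then have "c = c'" by auto
  then show ?thesis using c' by simp
qed

section \<open>Diagonalization\<close>

instance recf :: countable by countable_datatype
instance fm :: countable by countable_datatype
instance st :: countable by countable_datatype
instance letter :: (countable) countable by countable_datatype

section \<open>Recursiveness of the coding of the test equations\<close>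

definition recursive :: "nat \<Rightarrow> (nat list \<Rightarrow> nat) \<Rightarrow> bool" where
  "recursive k F \<longleftrightarrow> (\<exists>p. \<forall>xs. length xs = k \<longrightarrow> computes p xs (F xs))"

lemma recursive_proj: "i < k \<Longrightarrow> recursive k (\<lambda>xs. xs ! i)"
  unfolding recursive_def by (intro exI[of _ "RProj i"]) (auto intro: computes.intros)

lemma recursive_comp1:
  assumes "recursive 1 H" "recursive k F"
  shows "recursive k (\<lambda>xs. H [F xs])"
proof -
  from assms obtain h f where "\<And>xs. length xs = 1 \<Longrightarrow> computes h xs (H xs)"
    "\<And>xs. length xs = k \<Longrightarrow> computes f xs (F xs)" by (auto simp: recursive_def)
  then show ?thesis unfolding recursive_def
    by (intro exI[of _ "RComp h [f]"]) (auto intro!: computes.comp[where zs = "[_]"])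
qed

lemma recursive_comp2:
  assumes "recursive 2 H" "recursive k F" "recursive k G"
  shows "recursive k (\<lambda>xs. H [F xs, G xs])"
proof -
  from assms obtain h f g where "\<And>xs. length xs = 2 \<Longrightarrow> computes h xs (H xs)"
    "\<And>xs. length xs = k \<Longrightarrow> computes f xs (F xs)" "\<And>xs. length xs = k \<Longrightarrow> computes g xs (G xs)"
    by (auto simp: recursive_def)
  then show ?thesis unfolding recursive_def
    by (intro exI[of _ "RComp h [f, g]"]) (auto intro!: computes.comp[where zs = "[_, _]"])
qed

lemma recursive_Suc: "recursive k F \<Longrightarrow> recursive k (\<lambda>xs. Suc (F xs))"
proof -
  have "computes RSucc xs (Suc (hd xs))" if "length xs = 1" for xs
    using that by (cases xs) (auto intro: computes.intros)
  then have "recursive 1 (\<lambda>xs. Suc (hd xs))" unfolding recursive_def by blast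
  from recursive_comp1[OF this] show "recursive k F \<Longrightarrow> recursive k (\<lambda>xs. Suc (F xs))" by simp
qed

lemma recursive_const: "recursive k (\<lambda>_. c)"
proof (induction c)
  case 0
  show ?case unfolding recursive_def by (auto intro: computes.intros)
qed (rule recursive_Suc)

lemma recursive_prim:
  assumes "recursive k B" "recursive (Suc (Suc k)) G"
    and "\<And>xs. f 0 xs = B xs" "\<And>n xs. f (Suc n) xs = G (n # f n xs # xs)"
  shows "recursive (Suc k) (\<lambda>xs. f (hd xs) (tl xs))"
proof -
  from assms(1,2) obtain b g where bg: "\<And>xs. length xs = k \<Longrightarrow> computes b xs (B xs)"
    "\<And>xs. length xs = Suc (Suc k) \<Longrightarrow> computes g xs (G xs)" by (auto simp: recursive_def)
  have "computes (RPrim b g) (n # xs) (f n xs)" if "length xs = k" for n xs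
  proof (induction n)
    case 0
    then show ?case using bg(1)[OF that] assms(3) by (auto intro: computes.intros)
  next
    case (Suc n)
    then show ?case using bg(2)[of "n # f n xs # xs"] that assms(4) by (auto intro: computes.intros)
  qed
  then have "computes (RPrim b g) xs (f (hd xs) (tl xs))" if "length xs = Suc k" for xs
    using that by (cases xs) auto
  then show ?thesis unfolding recursive_def by blast
qed

lemma recursive_iter:
  assumes "recursive 1 G" "recursive k F" and f: "\<And>n. f (Suc n) = G [f n]"
  shows "recursive k (\<lambda>xs. f (F xs))"
proof -
  have "recursive (Suc 0) (\<lambda>xs. (\<lambda>n _. f n) (hd xs) (tl xs))"
    by (rule recursive_prim[where B = "\<lambda>_. f 0" and G = "\<lambda>xs. G [xs ! 1]"])
      (use f in \<open>auto intro!: recursive_const recursive_comp1[OF assms(1)] recursive_proj\<close>)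
  then have "recursive 1 (\<lambda>xs. f (hd xs))" by simp
  from recursive_comp1[OF this assms(2)] show ?thesis by simp
qed

lemma recursive_add:
  assumes "recursive k F" "recursive k G"
  shows "recursive k (\<lambda>xs. F xs + G xs)"
proof -
  have "recursive (Suc 1) (\<lambda>xs. (\<lambda>n ys. n + ys ! 0) (hd xs) (tl xs))"
    by (rule recursive_prim[where B = "\<lambda>xs. xs ! 0" and G = "\<lambda>xs. Suc (xs ! 1)"])
      (auto intro!: recursive_Suc recursive_proj)
  then have "recursive 2 (\<lambda>xs. hd xs + tl xs ! 0)" by (simp add: numeral_2_eq_2)
  from recursive_comp2[OF this assms] show ?thesis by simp
qed

lemma recursive_mult_const:
  assumes "recursive k F"
  shows "recursive k (\<lambda>xs. b * F xs)"
proof (induction b)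
  case (Suc b)
  then show ?case using recursive_add[OF assms] by simp
qed (simp add: recursive_const)

lemma recursive_power:
  assumes "recursive k F"
  shows "recursive k (\<lambda>xs. b ^ F xs)"
  by (rule recursive_iter[where f = "\<lambda>n. b ^ n" and G = "\<lambda>xs. b * xs ! 0"])
    (auto intro!: recursive_mult_const recursive_proj assms)

lemma recursive_triangle:
  assumes "recursive k F"
  shows "recursive k (\<lambda>xs. triangle (F xs))"
proof -
  have "recursive (Suc 0) (\<lambda>xs. (\<lambda>n _. triangle n) (hd xs) (tl xs))"
    by (rule recursive_prim[where B = "\<lambda>_. 0" and G = "\<lambda>xs. xs ! 1 + Suc (xs ! 0)"])
      (auto intro!: recursive_const recursive_add recursive_Suc recursive_proj)
  then have "recursive 1 (\<lambda>xs. triangle (hd xs))" by simp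
  from recursive_comp1[OF this assms] show ?thesis by simp
qed

lemma recursive_prod_encode:
  "\<lbrakk>recursive k F; recursive k G\<rbrakk> \<Longrightarrow> recursive k (\<lambda>xs. prod_encode (F xs, G xs))"
  by (simp add: prod_encode_def recursive_add recursive_triangle)

lemma recursive_power_code:
  assumes "recursive k F"
  shows "recursive k (\<lambda>xs. trm_code (power_trm t (F xs)))"
  by (rule recursive_iter[where f = "\<lambda>n. trm_code (power_trm t n)" and
        G = "\<lambda>xs. prod_encode (4, prod_encode (trm_code t, xs ! 0))"])
    (auto intro!: recursive_prod_encode recursive_const recursive_proj assms)

text \<open>The term \<open>C\<close> holds the program; an input changes nothing but an exponent.
  \<open>r\<close> and \<open>y\<close> will be the variables of the first counter and of the final
  letter.\<close>

definition test_eqn :: "nat \<Rightarrow> trm \<Rightarrow> trm \<Rightarrow> trm \<Rightarrow> nat \<Rightarrow> eqn" where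
  "test_eqn K r y C c = Ineq (Mult C (power_trm r (K ^ (nth_prime 0 ^ c)))) y"

text \<open>As \<open>C\<close> enters the code of the equation only through its own code, which is
  also the input, no decoding is required.\<close>

lemma test_eqn_code:
  "\<exists>F. recursive 1 F \<and> (\<forall>C. eqn_code (test_eqn K r y C (trm_code C)) = F [trm_code C])"
proof -
  define F where "F xs = prod_encode (prod_encode (2, prod_encode
    (prod_encode (4, prod_encode (xs ! 0, trm_code (power_trm r (K ^ (nth_prime 0 ^ (xs ! 0)))))), trm_code y)),
     trm_code y)" for xs
  have "recursive 1 F" unfolding F_def
    by (intro recursive_prod_encode recursive_const recursive_power_code recursive_power recursive_proj) simp_all
  moreover have "eqn_code (test_eqn K r y C (trm_code C)) = F [trm_code C]" for C
    by (simp add: F_def test_eqn_def eqn_code_def Ineq_def)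
  ultimately show ?thesis by blast
qed

text \<open>A decision procedure composed with \<open>F\<close> returns \<open>0\<close> on the code
  of \<open>C\<close> iff the equation of \<open>C\<close> at its own code is not in
  \<open>T\<close>. The term \<open>C\<close> that represents this very program gives a
  contradiction.\<close>

lemma undecidable_by_diagonal:
  assumes rep: "\<And>p. \<exists>C. \<forall>c. test_eqn K r y C c \<in> T \<longleftrightarrow> computes p [c] 0"
  shows "\<not> decidable (eqn_code ` T)"
proof
  assume "decidable (eqn_code ` T)"
  then obtain d where d: "\<And>n. computes d [n] (if n \<in> eqn_code ` T then 1 else 0)"
    by (auto simp: decidable_def)
  obtain F where F: "recursive 1 F" "\<And>C. eqn_code (test_eqn K r y C (trm_code C)) = F [trm_code C]"
    using test_eqn_code by blast
  from F(1) obtain f where "\<And>xs. length xs = 1 \<Longrightarrow> computes f xs (F xs)"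
    unfolding recursive_def by blast
  then have f: "computes f [c] (F [c])" for c by simp
  have p: "computes (RComp d [f]) [c] (if F [c] \<in> eqn_code ` T then 1 else 0)" for c
    using d[of "F [c]"] f[of c] by (auto intro!: computes.comp[where zs = "[_]"])
  obtain C where C: "\<And>c. test_eqn K r y C c \<in> T \<longleftrightarrow> computes (RComp d [f]) [c] 0" using rep by blast
  let ?c = "trm_code C"
  have "test_eqn K r y C ?c \<in> T \<longleftrightarrow> F [?c] \<in> eqn_code ` T"
    using F(2)[of C] inj_image_mem_iff[OF eqn_code_inj] by metis
  also have "\<dots> \<longleftrightarrow> \<not> computes (RComp d [f]) [?c] 0"
    using p[of ?c] computes_deterministic[OF p[of ?c]] by (auto split: if_splits)
  finally show False using C by blast
qed

section \<open>The canonical valuation in the algebra of a polarity\<close>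

context
  fixes S :: "'l :: countable multiset set" and h :: "nat \<Rightarrow> 'l multiset set"
  defines "h \<equiv> \<lambda>i. clos S {{#from_nat i#}}"
begin

interpretation comm_residuated_lattice "polar_alg S" by (rule polar_alg_CRL)

lemma canonical_closed: "h i \<in> carrier (polar_alg S)"
  by (simp add: h_def carrier_polar_alg)

lemma sumset_singletons: "sumset {a} {b} = {a + b}"
  by (auto simp: sumset_def)

lemma eval_word_canonical: "eval (polar_alg S) h (word_trm us) = clos S {mset us}"
proof (induction us)
  case Nil
  then show ?case by (simp add: word_trm_def polar_alg_def)
next
  case (Cons u us)
  have "eval (polar_alg S) h (word_trm (u # us)) = clos S (sumset (h (to_nat u)) (eval (polar_alg S) h (word_trm us)))"
    by (simp add: word_trm_def polar_alg_def)
  also have "\<dots> = clos S {mset (u # us)}" unfolding Cons by (simp add: h_def sumset_singletons)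
  finally show ?case .
qed

lemma eval_power_Var_canonical:
  "eval (polar_alg S) h (power_trm (Var (to_nat l)) k) = clos S {replicate_mset k l}"
proof (induction k)
  case (Suc k)
  have "eval (polar_alg S) h (power_trm (Var (to_nat l)) (Suc k))
      = clos S (sumset (h (to_nat l)) (eval (polar_alg S) h (power_trm (Var (to_nat l)) k)))"
    by (simp add: polar_alg_def)
  then show ?case unfolding Suc by (simp add: h_def sumset_singletons)
qed (simp add: polar_alg_def)

text \<open>A context accepting the join of the \<open>vs\<close> accepts each \<open>v\<close>,
  hence \<open>u\<close> because \<open>S\<close> is closed under the rule. So \<open>u\<close> lies
  below the join, and the residual contains the empty word.\<close>

lemma eval_rule_canonical:
  assumes rule: "\<And>w. \<forall>v\<in>set vs. mset v + w \<in> S \<Longrightarrow> mset u + w \<in> S"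
  shows "rle (polar_alg S) (one (polar_alg S)) (eval (polar_alg S) h (rule_trm (u, vs)))"
proof -
  have J: "eval (polar_alg S) h t \<in> carrier (polar_alg S)" for t
    by (rule eval_closed[of h, OF canonical_closed])
  define J where "J = eval (polar_alg S) h (join_list (map word_trm vs))"
  have cJ: "clos S J = J" using J unfolding J_def carrier_polar_alg .
  have "mset v \<in> J" if "v \<in> set vs" for v
  proof -
    have "eval (polar_alg S) h (word_trm v) \<subseteq> J"
      using join_list_upper[of h "word_trm v" "map word_trm vs", OF canonical_closed] that
        rle_polar_alg[OF J] by (auto simp: J_def)
    then show ?thesis using subset_clos[of "{mset v}" S] by (auto simp: eval_word_canonical)
  qed
  then have "\<forall>v\<in>set vs. mset v + p \<in> S" if "p \<in> polar S J" for p
    using that by (auto simp: polar_def)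
  then have "p + mset u \<in> S" if "p \<in> polar S J" for p
    using rule[of p] that by (simp add: add.commute)
  then have "mset u \<in> clos S J" by (simp add: clos_def polar_def[of S "polar S J"])
  then have "clos S {mset u} \<subseteq> J" using cJ by (simp add: clos_subset_iff)
  then have "{#} \<in> resid (clos S {mset u}) J" by (auto simp: resid_def)
  moreover have e: "eval (polar_alg S) h (rule_trm (u, vs)) = resid (clos S {mset u}) J"
    by (simp add: rule_trm_def polar_alg_def eval_word_canonical[unfolded polar_alg_def] J_def)
  ultimately have "{{#}} \<subseteq> eval (polar_alg S) h (rule_trm (u, vs))" by simp
  moreover have "clos S (eval (polar_alg S) h (rule_trm (u, vs))) = eval (polar_alg S) h (rule_trm (u, vs))"
    using J unfolding carrier_polar_alg .
  ultimately have "clos S {{#}} \<subseteq> eval (polar_alg S) h (rule_trm (u, vs))"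
    using clos_subset_iff by blast
  then show ?thesis using rle_polar_alg[OF J] by (simp add: polar_alg_def)
qed

text \<open>\<theta> is at most \<open>1\<close> by construction and at least \<open>1\<close> since
  every rule is valid, so its powers disappear from the inequality.\<close>

lemma eval_rules_canonical:
  assumes rules: "\<And>u vs w. \<lbrakk>(u, vs) \<in> set rs; \<forall>v\<in>set vs. mset v + w \<in> S\<rbrakk> \<Longrightarrow> mset u + w \<in> S"
  shows "eval (polar_alg S) h (rules_trm rs) = one (polar_alg S)"
proof -
  have c: "eval (polar_alg S) h t \<in> carrier (polar_alg S)" for t
    by (rule eval_closed[of h, OF canonical_closed])
  have "rle (polar_alg S) (one (polar_alg S)) (eval (polar_alg S) h (rules_trm rs))"
    using rules
  proof (induction rs)
    case Nil
    then show ?case by (simp add: rules_trm_def rle_refl)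
  next
    case (Cons r rs)
    obtain u vs where r: "r = (u, vs)" by (cases r)
    have "rle (polar_alg S) (one (polar_alg S)) (eval (polar_alg S) h (rule_trm r))"
      unfolding r by (rule eval_rule_canonical) (use Cons.prems r in auto)
    moreover have "rle (polar_alg S) (one (polar_alg S)) (eval (polar_alg S) h (rules_trm rs))"
      by (rule Cons.IH) (use Cons.prems in auto)
    ultimately show ?case using c by (auto simp: rules_trm_def intro!: meet_greatest)
  qed
  then show ?thesis
    using rle_antisym rules_trm_le(1)[of h rs, OF canonical_closed] c by blast
qed

text \<open>With \<theta> valued at \<open>1\<close> the inequality says that the word lies in the
  closure of the final letter. That letter is in \<open>S\<close>, so the empty context is in its
  polar, and membership in \<open>S\<close> follows.\<close>

lemma satisfies_imp_mem:
  assumes rules: "\<And>u vs w. \<lbrakk>(u, vs) \<in> set rs; \<forall>v\<in>set vs. mset v + w \<in> S\<rbrakk> \<Longrightarrow> mset u + w \<in> S"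
    and y: "{#y#} \<in> S"
    and sat: "satisfies (polar_alg S)
      (Ineq (Mult (Mult (power_trm (rules_trm rs) e) (word_trm us)) (power_trm (Var (to_nat l)) k)) (Var (to_nat y)))"
  shows "mset us + replicate_mset k l \<in> S"
proof -
  have "eval (polar_alg S) h (power_trm (rules_trm rs) e) = one (polar_alg S)"
    using eval_rules_canonical[OF rules] by (simp add: eval_power_trm[of h, OF canonical_closed])
  then have ev: "eval (polar_alg S) h (Mult (Mult (power_trm (rules_trm rs) e) (word_trm us)) (power_trm (Var (to_nat l)) k))
      = clos S {mset us + replicate_mset k l}"
    by (simp add: eval_word_canonical eval_power_Var_canonical) (simp add: polar_alg_def sumset_singletons)
  define L where "L = Mult (Mult (power_trm (rules_trm rs) e) (word_trm us)) (power_trm (Var (to_nat l)) k)"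
  have "eval (polar_alg S) h (fst (Ineq L (Var (to_nat y)))) = eval (polar_alg S) h (snd (Ineq L (Var (to_nat y))))"
    using sat canonical_closed unfolding satisfies_def L_def by blast
  then have "rle (polar_alg S) (clos S {mset us + replicate_mset k l}) (h (to_nat y))"
    by (simp add: Ineq_def rle_def ev[folded L_def])
  then have "clos S {mset us + replicate_mset k l} \<subseteq> clos S {{#y#}}"
    using rle_polar_alg[OF canonical_closed[of "to_nat y"]] by (simp add: h_def)
  then have "mset us + replicate_mset k l \<in> clos S {{#y#}}" using subset_clos by blast
  moreover have "{#} \<in> polar S {{#y#}}" using y by (simp add: polar_def)
  ultimately show ?thesis by (auto simp: clos_def polar_def[of S "polar S _"])
qed

end

lemma satisfies_of_derivable:
  fixes R :: "'a rlat" and y :: "'l :: countable"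
  assumes R: "comm_residuated_lattice R" and ne: "\<And>u. (u, []) \<notin> set rs"
    and e: "\<And>t. \<lbrakk>t \<in> carrier R; rle R t (one R)\<rbrakk> \<Longrightarrow> rle R (t [^]\<^bsub>R\<^esub> (e :: nat)) (t [^]\<^bsub>R\<^esub> (e + 1))"
    and der: "derivable (set rs) y (mset us + replicate_mset k l)"
  shows "satisfies R
      (Ineq (Mult (Mult (power_trm (rules_trm rs) e) (word_trm us)) (power_trm (Var (to_nat l)) k)) (Var (to_nat y)))"
  unfolding satisfies_def
proof (intro allI impI)
  interpret comm_residuated_lattice R by (rule R)
  fix h :: "nat \<Rightarrow> 'a" assume h: "\<forall>i. h i \<in> carrier R"
  note h' = h[rule_format]
  have c: "eval R h t \<in> carrier R" for t by (rule eval_closed[of h, OF h'])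
  have rep: "eval R h (word_trm (replicate k l)) = h (to_nat l) [^]\<^bsub>R\<^esub> k"
    using h' by (induction k) (auto simp: word_trm_def m_comm)
  have "rle R (eval R h (rules_trm rs) [^]\<^bsub>R\<^esub> e \<otimes>\<^bsub>R\<^esub> eval R h (word_trm (us @ replicate k l))) (h (to_nat y))"
    by (rule derivable_sound[of h rs e y "mset us + replicate_mset k l", OF h' ne _ der])
      (use e[OF c rules_trm_le(1)[of h rs, OF h']] in simp_all)
  then show "eval R h (fst (Ineq (Mult (Mult (power_trm (rules_trm rs) e) (word_trm us)) (power_trm (Var (to_nat l)) k)) (Var (to_nat y))))
      = eval R h (snd (Ineq (Mult (Mult (power_trm (rules_trm rs) e) (word_trm us)) (power_trm (Var (to_nat l)) k)) (Var (to_nat y))))"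
    using c h' by (simp add: Ineq_def rle_def eval_power_trm[of h, OF h'] eval_word_append[of h, OF h'] rep m_assoc)
qed

text \<open>Finitely many equations have a largest threshold. The quantifier over \<open>P\<close>
  comes after \<open>K\<close>: the threshold does not see the machine.\<close>

lemma ex_uniform_base:
  assumes "finite \<Gamma>" and sp: "\<And>n D. (n, D) \<in> \<Gamma> \<Longrightarrow> spineless n D"
  shows "\<exists>K\<ge>2. \<forall>(n, D)\<in>\<Gamma>. \<forall>P :: ('s \<times> 's op) set. resp_simple (good_set P K) n D"
proof -
  define Q where "Q n D K0 \<longleftrightarrow> (\<forall>K\<ge>K0. \<forall>X u s. sparse K X \<longrightarrow>
    (\<forall>d\<in>D. \<forall>i :: bool. u i + lin (s i) d \<in> X) \<longrightarrow>
    (\<exists>d\<in>D. \<forall>i. lin (s i) d = lin (s i) (ones_vec n)))" for n D K0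
  have "\<exists>K0. Q n D K0" if "(n, D) \<in> \<Gamma>" for n D
    unfolding Q_def by (rule sparse_pair_closed[OF sp[OF that]])
  then obtain k where k: "\<And>n D. (n, D) \<in> \<Gamma> \<Longrightarrow> Q n D (k n D)" by metis
  define K where "K = Max (insert 2 ((\<lambda>(n, D). k n D) ` \<Gamma>))"
  have K2: "K \<ge> 2" and Kk: "\<And>n D. (n, D) \<in> \<Gamma> \<Longrightarrow> K \<ge> k n D"
    using assms(1) by (auto simp: K_def intro!: Max_ge)
  have "resp_simple (good_set P K) n D" if "(n, D) \<in> \<Gamma>" for n D and P :: "('s \<times> 's op) set"
    by (rule good_set_resp_simple[OF sp[OF that] K2]) (use k[OF that] Kk[OF that] in \<open>unfold Q_def, blast\<close>)
  then show ?thesis using K2 by blast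
qed

theorem theorem5p9:
  fixes \<Gamma> :: "(nat \<times> nat vec set) set"
  assumes "infinite (UNIV :: 'a set)"
    and "finite \<Gamma>"
    and "\<And>n D. (n, D) \<in> \<Gamma> \<Longrightarrow> spineless n D"
    and "\<exists>(n, D) \<in> \<Gamma>. expansive n D"
  shows "\<not> decidable (eqn_code `
           equational_theory TYPE('a) (\<Union>(n, D) \<in> \<Gamma>. simple_eqns n D))"
proof -
  define E where "E = (\<Union>(n, D) \<in> \<Gamma>. simple_eqns n D)"
  obtain K where K: "K \<ge> 2"
    and resp: "\<And>n D (P :: (st \<times> st op) set). (n, D) \<in> \<Gamma> \<Longrightarrow> resp_simple (good_set P K) n D"
    using ex_uniform_base[OF assms(2,3), where 's = st] by blast
  obtain e where e: "\<And>(R :: 'a rlat) t. \<lbrakk>R \<in> CRL_plus E; t \<in> carrier R; rle R t (one R)\<rbrakk> \<Longrightarrow>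
      rle R (t [^]\<^bsub>R\<^esub> (e :: nat)) (t [^]\<^bsub>R\<^esub> (e + 1))"
  proof -
    from assms(4) obtain n D where nD: "(n, D) \<in> \<Gamma>" "expansive n D" by blast
    then have "simple_eqns n D \<subseteq> E" by (auto simp: E_def)
    then show ?thesis using that expansive_pow_le[OF nD(2), where 'a = 'a] unfolding CRL_plus_def by blast
  qed
  \<comment> \<open>Derivations are interpreted in algebras on \<open>'a\<close>, but the
    countermodel lives on sets of multisets of letters; both types are infinite, so they have the
    same equational theory.\<close>
  have indep: "equational_theory TYPE('a) E = equational_theory TYPE(st letter multiset set) E"
  proof (rule equational_theory_indep[OF assms(1)])
    have "inj (\<lambda>n. {replicate_mset n (Fin :: st letter)})"
      by (auto intro!: injI dest: arg_cong[where f = size])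
    then show "infinite (UNIV :: st letter multiset set set)"
      using range_inj_infinite finite_subset[OF subset_UNIV] by blast
  qed
  have "\<exists>C. \<forall>c. test_eqn K (Var (to_nat (Rg 0 :: st letter))) (Var (to_nat (Fin :: st letter))) C c
      \<in> equational_theory TYPE('a) E \<longleftrightarrow> computes p [c] 0" for p
  proof -
    obtain P :: "(st \<times> st op) set" and q where P: "finite P"
      "\<And>r i m n r'. (r, Upd i m n r') \<in> P \<Longrightarrow> m = 0 \<or> n = 0"
      "\<And>c. accepts P q (counters (nth_prime 0 ^ c) 0) \<longleftrightarrow> computes p [c] 0"
      using recf_accepts[of p] by blast
    obtain ps where ps: "set ps = P" using finite_list[OF P(1)] by blast
    define rs where "rs = all_rules K ps"
    \<comment> \<open>The single letter \<open>Rg 1\<close> is \<open>K ^ 0\<close>: the second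
      counter starts at \<open>0\<close>. The first counter is supplied by the power in
      \<open>test_eqn\<close>.\<close>
    define C where "C = Mult (power_trm (rules_trm rs) e) (word_trm [St q, Rg 1])"
    have conf: "mset [St q, Rg 1] + replicate_mset (K ^ (nth_prime 0 ^ c)) (Rg 0) = conf (St q) (enc K (counters (nth_prime 0 ^ c) 0))" for c
      by (simp add: conf_def)
    have "test_eqn K (Var (to_nat (Rg 0 :: st letter))) (Var (to_nat (Fin :: st letter))) C c
      \<in> equational_theory TYPE('a) E \<longleftrightarrow> accepts P q (counters (nth_prime 0 ^ c) 0)" (is "?eq \<in> _ \<longleftrightarrow> ?acc") for c
    proof
      assume ?acc
      then have der: "derivable (set rs) Fin (mset [St q, Rg 1] + replicate_mset (K ^ (nth_prime 0 ^ c)) (Rg 0))"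
        unfolding conf rs_def using K ps by (intro accepts_derivable) auto
      have "satisfies R ?eq" if R: "R \<in> CRL_plus E" for R :: "'a rlat"
        unfolding test_eqn_def C_def
        by (rule satisfies_of_derivable[OF _ _ e[OF R] der])
          (use R all_rules_nonempty in \<open>auto simp: CRL_plus_def rs_def\<close>)
      then show "?eq \<in> equational_theory TYPE('a) E" by (simp add: equational_theory_def)
    next
      assume "?eq \<in> equational_theory TYPE('a) E"
      then have eq: "?eq \<in> equational_theory TYPE(st letter multiset set) E" using indep by simp
      have "satisfies (polar_alg (good_set P K)) x" if "x \<in> E" for x
      proof -
        from that obtain n D where nD: "(n, D) \<in> \<Gamma>" "x \<in> simple_eqns n D" by (auto simp: E_def)
        then have "simple n D" using assms(3) by (simp add: spineless_def)
        from polar_alg_satisfies_simple[OF this resp[OF nD(1)] nD(2)] show ?thesis .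
      qed
      then have "polar_alg (good_set P K) \<in> CRL_plus E"
        using polar_alg_CRL by (auto simp: CRL_plus_def)
      then have sat: "satisfies (polar_alg (good_set P K)) ?eq"
        using eq by (simp add: equational_theory_def)
      have "mset [St q, Rg 1] + replicate_mset (K ^ (nth_prime 0 ^ c)) (Rg 0) \<in> good_set P K"
      proof (rule satisfies_imp_mem[OF _ _ sat[unfolded test_eqn_def C_def]])
        fix u vs w assume "(u, vs) \<in> set rs" "\<forall>v\<in>set vs. mset v + w \<in> good_set P K"
        then show "mset u + w \<in> good_set P K"
          using good_set_rules[OF K, of ps u vs w] P(2) unfolding rs_def ps by blast
      next
        show "{#Fin#} \<in> good_set P K" by (simp add: add_mset_good_set)
      qed
      then show ?acc unfolding conf by (rule good_conf[OF K])
    qed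
    then show ?thesis using P(3) by blast
  qed
  then show ?thesis unfolding E_def[symmetric] by (rule undecidable_by_diagonal)
qed

end
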